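(* For every integer $m\ge 1$, the symplectic class $[\Omega_{2m}]\in H^2(M(2m))$ of the nilmanifold $M(2m)$ is a $2m$-tuple matrix Massey product whose weight is strictly equal to $2m$. That is, $[\Omega_{2m}]$ is an element of some $2m$-tuple matrix Massey product $\langle X_1,\dots,X_{2m}\rangle$ in $H^{\ast}(M(2m),\mathbb{R})$, and it does not belong to the linear subspace generated by all matrix Massey products $\langle Y_1,\dots,Y_l\rangle$ in $H^{\ast}(M(2m),\mathbb{R})$ with $l<2m$.
   Context: The nilmanifolds $M(n)$. Let $\mathcal{V}_n$ be the nilpotent Lie algebra with basis $e_1,\dots,e_n$ and brackets $[e_i,e_j]=(j-i)e_{i+j}$ if $i+j\le n$ and $[e_i,e_j]=0$ if $i+j>n$. Let $V_n$ be the corresponding simply connected nilpotent Lie group, identified with $\mathcal{V}_n$ as a set, with multiplication $\times$ given by the Campbell--Hausdorff formula. Let $\Gamma_n\subset V_n$ be the uniform lattice generated by $e_1,\dots,e_n$ with respect to $\times$, and put $M(n)=V_n/\Gamma_n$. Let $\omega_1,\dots,\omega_n$ be the basis of left-invariant $1$-forms dual to $e_1,\dots,e_n$; with the paper's sign convention $d\omega_k=(k-2)\,\omega_1\wedge\omega_{k-1}+(k-4)\,\omega_2\wedge\omega_{k-2}+\cdots$ (sum of $(j-i)\,\omega_i\wedge\omega_j$ over $i<j$, $i+j=k$), so $d\omega_1=d\omega_2=0$. The left-invariant form $$\Omega_{2m}=(2m-1)\,\omega_1\wedge\omega_{2m}+(2m-3)\,\omega_2\wedge\omega_{2m-1}+\cdots+\omega_m\wedge\omega_{m+1}$$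 defines a symplectic form on $M(2m)$, also denoted $\Omega_{2m}$. Matrix Massey products. $N(W)$ denotes the set of finite rectangular matrices with homogeneous entries in $W$. Let $(\mathcal{A},d)$ be an augmented graded-commutative differential graded algebra over $\mathbb{R}$ with augmentation ideal $I$; for a manifold $M$ take $\mathcal{A}=\mathcal{E}^{\ast}(M)$, the smooth forms, augmented by restriction to a point, with $H^{\ast}(\mathcal{A})=H^{\ast}(M,\mathbb{R})$; quasi-isomorphic algebras may be used instead. Put $\bar a=(-1)^{\deg a}a$, applied entrywise to matrices. For $X=(x_{ij})\in N(I)$ let $\mathcal{D}(X)=(\deg x_{ij})$. Matrices $X$ of size $p\times q$ and $Y$ of size $r\times s$ are multipliable (in this order) if $q=r$ and $\deg x_{ij}+\deg y_{jk}$ is independent of $j$ for all $(i,k)$; then $\mathcal{D}(X)\ast\mathcal{D}(Y)=(\deg x_{ij}+\deg y_{jk})_{ik}$. For an integer matrix $K$ and an integer $t$, $K+t$ is obtained by adding $t$ to every entry. Let $n\ge 2$, $V_1,\dots,V_n\in N(H^+(\mathcal{A}))$ with $V_i,V_{i+1}$ multipliable, and let $X_i\in N(I)$ be matrices of cocycles with $[X_i]=V_i$. A defining system for $\langle X_1,\dots,X_n\rangle$ is a family $A=(X(i,j))$, $1\le i\le j\le n$, $(i,j)\ne(1,n)$, in $N(I)$ with: (1) $X(i,i)=X_i$; (2) $\mathcal{D}(X(i,j))=(\mathcal{D}(X_i)-1)\ast\cdots\ast(\mathcal{D}(X_j)-1)+1$; (3) $dX(i,j)=\sum_{r=i}^{j-1}\overline{X(i,r)}\cdot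 X(r+1,j)$. Its cocycle is $c(A)=\sum_{r=1}^{n-1}\overline{X(1,r)}\cdot X(r+1,n)$. The product is defined if a defining system exists; then the $n$-tuple matrix Massey product $\langle V_1,\dots,V_n\rangle$ is the set of matrix cohomology classes $[c(A)]$ over all defining systems (it depends only on $V_1,\dots,V_n$). A $1\times 1$ matrix class is identified with a cohomology class; the linear subspace generated by matrix Massey products is the span of all entries of their elements ($l$-tuple products are considered for $l\ge 2$). *)

theory Defs
  imports "HOL-Analysis.Analysis"
begin

section \<open>The nilpotent groups and their lattices\<close>

text \<open>The index set \<open>{1,\<dots>,n}\<close> is an arbitrary finite linearly ordered type
  with \<open>n\<close> elements; \<open>idx\<close> is its order isomorphism with \<open>{1,\<dots>,n}\<close>.
  The vector \<open>e\<^sub>k\<close> is the \<open>axis i 1\<close> with \<open>idx i = k\<close>.\<close>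

type_synonym 'n rvec = "(real, 'n) vec"

definition idx :: "'n::{finite,linorder} \<Rightarrow> nat"
  where "idx i = card {j. j \<le> i}"

text \<open>The bilinear extension of \<open>[e\<^sub>i,e\<^sub>j] = (j - i) e\<^sub>i\<^sub>+\<^sub>j\<close>
  for \<open>i + j \<le> n\<close>, and \<open>0\<close> otherwise.\<close>

definition lie :: "('n::{finite,linorder}) rvec \<Rightarrow> 'n rvec \<Rightarrow> 'n rvec"
  where "lie x y = (\<chi> k. \<Sum>i\<in>UNIV. \<Sum>j\<in>UNIV.
    (if idx i + idx j = idx k then (real (idx j) - real (idx i)) * x $ i * y $ j else 0))"

fun nested_lie :: "('n::{finite,linorder}) rvec list \<Rightarrow> 'n rvec" where
  "nested_lie [] = 0"
| "nested_lie [v] = v"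
| "nested_lie (v # w # vs) = lie v (nested_lie (w # vs))"

text \<open>The Campbell--Hausdorff formula in Dynkin's form:
  \[ x \times y = \sum_{k\ge 1} \frac{(-1)^{k-1}}{k} \sum_{r_i+s_i>0}
     \frac{[x^{r_1}y^{s_1}\cdots x^{r_k}y^{s_k}]}{\sum_i (r_i+s_i)\,\prod_i r_i!\,s_i!} \]
  with right-nested brackets. The element \<open>e\<^sub>k\<close> has weight \<open>k\<close>, so brackets of
  more than \<open>n\<close> vectors vanish and the series is the finite sum over the terms of total
  degree at most \<open>n\<close>.\<close>

definition dynkin_words :: "nat \<Rightarrow> (nat \<times> nat) list set"
  where "dynkin_words N = {ps. ps \<noteq> [] \<and> (\<forall>(r,s)\<in>set ps. r + s > 0) \<and>
    (\<Sum>(r,s)\<leftarrow>ps. r + s) \<le> N}"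

definition dynkin_coeff :: "(nat \<times> nat) list \<Rightarrow> real"
  where "dynkin_coeff ps = (-1) ^ (length ps - 1) / real (length ps) /
    (real (\<Sum>(r,s)\<leftarrow>ps. r + s) * (\<Prod>(r,s)\<leftarrow>ps. fact r * fact s))"

definition bch :: "('n::{finite,linorder}) rvec \<Rightarrow> 'n rvec \<Rightarrow> 'n rvec"
  where "bch x y = (\<Sum>ps\<in>dynkin_words CARD('n). dynkin_coeff ps *\<^sub>R
    nested_lie (concat (map (\<lambda>(r,s). replicate r x @ replicate s y) ps)))"

text \<open>The subgroup generated by the basis; the inverse of \<open>x\<close> for \<open>bch\<close> is \<open>- x\<close>.\<close>

inductive_set lattice :: "('n::{finite,linorder}) rvec set" where
  basis: "axis i 1 \<in> lattice"
| unit: "0 \<in> lattice"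
| inverse: "x \<in> lattice \<Longrightarrow> - x \<in> lattice"
| product: "x \<in> lattice \<Longrightarrow> y \<in> lattice \<Longrightarrow> bch x y \<in> lattice"


section \<open>Differential forms on the nilmanifold\<close>

primrec C_k :: "nat \<Rightarrow> (('n::finite) rvec \<Rightarrow> real) \<Rightarrow> bool" where
  "C_k 0 f \<longleftrightarrow> continuous_on UNIV f"
| "C_k (Suc k) f \<longleftrightarrow> f differentiable_on UNIV \<and>
     (\<forall>v. C_k k (\<lambda>x. frechet_derivative f (at x) v))"

definition smooth :: "(('n::finite) rvec \<Rightarrow> real) \<Rightarrow> bool"
  where "smooth f \<longleftrightarrow> (\<forall>k. C_k k f)"

text \<open>A (possibly inhomogeneous) form sends a point \<open>x\<close> and a list of \<open>k\<close> tangent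
  vectors to the value of its degree \<open>k\<close> component.\<close>

type_synonym 'n form = "'n rvec \<Rightarrow> 'n rvec list \<Rightarrow> real"

text \<open>The algebra of smooth forms on the nilmanifold. The quotient is taken by left
  translations by the lattice, so that left-invariant forms descend to it; pulling back along
  the covering identifies its forms with the smooth forms on the group that are invariant
  under these translations. Alternating forms of degree above \<open>n\<close> vanish, so every element
  has finitely many homogeneous components.\<close>

definition forms :: "('n::{finite,linorder}) form set"
  where "forms = {a.
    (\<forall>x us ws. linear (\<lambda>v. a x (us @ v # ws))) \<and>
    (\<forall>x vs. \<not> distinct vs \<longrightarrow> a x vs = 0) \<and>
    (\<forall>vs. smooth (\<lambda>x. a x vs)) \<and>
    (\<forall>g\<in>lattice. \<forall>x vs.
       a (bch g x) (map (frechet_derivative (bch g) (at x)) vs) = a x vs)}"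

definition forms_deg :: "int \<Rightarrow> ('n::{finite,linorder}) form set"
  where "forms_deg k = {a \<in> forms. \<forall>x vs. int (length vs) \<noteq> k \<longrightarrow> a x vs = 0}"

text \<open>The augmentation is restriction to the image of the unit of the group.\<close>

definition aug_ideal :: "('n::{finite,linorder}) form set"
  where "aug_ideal = {a \<in> forms. a 0 [] = 0}"

text \<open>The wedge product as a sum over shuffles, so that
  \<open>(\<alpha> \<and> \<beta>)(u,v) = \<alpha>(u) \<beta>(v) - \<alpha>(v) \<beta>(u)\<close> for 1-forms.\<close>

definition wedge :: "('n::finite) form \<Rightarrow> 'n form \<Rightarrow> 'n form" (infixr "\<and>\<^sub>w" 70)
  where "(a \<and>\<^sub>w b) x vs = (\<Sum>S\<in>Pow {..<length vs}.
    (-1) ^ card {(i,j). i \<in> S \<and> j \<in> {..<length vs} - S \<and> j < i} *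
    a x (nths vs S) * b x (nths vs ({..<length vs} - S)))"

text \<open>The exterior derivative, evaluated on constant vector fields. With this standard sign,
  left-invariant forms satisfy \<open>d\<omega>(X,Y) = - \<omega>([X,Y])\<close>. The opposite convention
  replaces \<open>ext_d\<close> by its negative; the involution \<open>bar\<close> below is an isomorphism
  between the two differential graded algebras which fixes even forms, so both conventions
  give the same statements about matrix Massey products.\<close>

definition ext_d :: "('n::finite) form \<Rightarrow> 'n form"
  where "ext_d a x vs = (\<Sum>i<length vs. (-1) ^ i *
    frechet_derivative (\<lambda>y. a y (take i vs @ drop (Suc i) vs)) (at x) (vs ! i))"

definition bar :: "'n form \<Rightarrow> 'n form"
  where "bar a = (\<lambda>x vs. (-1) ^ length vs * a x vs)"

definition cocycles :: "('n::{finite,linorder}) form set"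
  where "cocycles = {a \<in> forms. ext_d a = (\<lambda>x vs. 0)}"

definition cohom_class :: "('n::{finite,linorder}) form \<Rightarrow> 'n form set"
  where "cohom_class a = {\<lambda>x vs. a x vs + ext_d b x vs | b. b \<in> forms}"

definition cohom :: "int \<Rightarrow> ('n::{finite,linorder}) form set set"
  where "cohom k = cohom_class ` (cocycles \<inter> forms_deg k)"

text \<open>The linear span of a set of cohomology classes, with linear combinations computed on
  representing cocycles.\<close>

definition cohom_span :: "('n::{finite,linorder}) form set set \<Rightarrow> 'n form set set"
  where "cohom_span S = {cohom_class (\<lambda>x vs. \<Sum>a\<in>T. c a * a x vs) | T c.
    finite T \<and> T \<subseteq> cocycles \<and> cohom_class ` T \<subseteq> S}"


section \<open>The symplectic form\<close>

text \<open>The left-invariant 1-form with value at the unit dual to \<open>axis i 1\<close>.\<close>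

definition coframe :: "'n::{finite,linorder} \<Rightarrow> 'n form"
  where "coframe i x vs = (case vs of
    [v] \<Rightarrow> frechet_derivative (bch (- x)) (at x) v $ i | _ \<Rightarrow> 0)"

text \<open>The sum of \<open>(j - i) \<omega>\<^sub>i \<and> \<omega>\<^sub>j\<close> over \<open>i < j\<close>, \<open>i + j = 2m + 1\<close>.\<close>

definition Omega :: "nat \<Rightarrow> ('n::{finite,linorder}) form"
  where "Omega m = (\<lambda>x vs. \<Sum>(i,j) | i < j \<and> idx i + idx j = 2 * m + 1.
    (real (idx j) - real (idx i)) * (coframe i \<and>\<^sub>w coframe j) x vs)"


section \<open>Matrix Massey products\<close>

text \<open>Matrices of homogeneous elements, with 0-based entries. The degrees of the entries are
  recorded because the zero element is homogeneous of every degree. Values outside the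
  range are irrelevant.\<close>

record 'e gmatrix =
  nrows :: nat
  ncols :: nat
  dg :: "nat \<Rightarrow> nat \<Rightarrow> int"
  ent :: "nat \<Rightarrow> nat \<Rightarrow> 'e"

definition matrix_of :: "(int \<Rightarrow> 'e set) \<Rightarrow> 'e gmatrix \<Rightarrow> bool"
  where "matrix_of W X \<longleftrightarrow> nrows X > 0 \<and> ncols X > 0 \<and>
    (\<forall>p<nrows X. \<forall>q<ncols X. ent X p q \<in> W (dg X p q))"

definition N_I :: "('n::{finite,linorder}) form gmatrix \<Rightarrow> bool"
  where "N_I = matrix_of (\<lambda>k. forms_deg k \<inter> aug_ideal)"

definition N_H_plus :: "('n::{finite,linorder}) form set gmatrix \<Rightarrow> bool"
  where "N_H_plus = matrix_of (\<lambda>k. if k > 0 then cohom k else {})"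

definition multipliable :: "'e gmatrix \<Rightarrow> 'f gmatrix \<Rightarrow> bool"
  where "multipliable X Y \<longleftrightarrow> ncols X = nrows Y \<and>
    (\<forall>p<nrows X. \<forall>q<ncols Y. \<forall>s<ncols X. \<forall>t<ncols X.
       dg X p s + dg Y s q = dg X p t + dg Y t q)"

text \<open>\<open>deg_chain X i k\<close> is
  \<open>(D(X\<^sub>i) - 1) * \<dots> * (D(X\<^sub>i\<^sub>+\<^sub>k) - 1)\<close>. The sums defining \<open>*\<close> do not
  depend on the middle index for multipliable matrices; index 0 is used.\<close>

primrec deg_chain :: "(nat \<Rightarrow> 'e gmatrix) \<Rightarrow> nat \<Rightarrow> nat \<Rightarrow> nat \<Rightarrow> nat \<Rightarrow> int" where
  "deg_chain X i 0 = (\<lambda>p q. dg (X i) p q - 1)"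
| "deg_chain X i (Suc k) = (\<lambda>p q. deg_chain X i k p 0 + (dg (X (i + k + 1)) 0 q - 1))"

definition bar_mult ::
    "('n::finite) form gmatrix \<Rightarrow> 'n form gmatrix \<Rightarrow> nat \<Rightarrow> nat \<Rightarrow> 'n form"
  where "bar_mult X Y p q = (\<lambda>x vs. \<Sum>s<ncols X. (bar (ent X p s) \<and>\<^sub>w ent Y s q) x vs)"

definition defining_system :: "nat \<Rightarrow> (nat \<Rightarrow> ('n::{finite,linorder}) form gmatrix) \<Rightarrow>
    (nat \<Rightarrow> nat \<Rightarrow> 'n form gmatrix) \<Rightarrow> bool"
  where "defining_system n X A \<longleftrightarrow>
    (\<forall>i j. 1 \<le> i \<and> i \<le> j \<and> j \<le> n \<and> (i, j) \<noteq> (1, n) \<longrightarrow>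
      N_I (A i j) \<and>
      (i = j \<longrightarrow> A i j = X i) \<and>
      nrows (A i j) = nrows (X i) \<and> ncols (A i j) = ncols (X j) \<and>
      (\<forall>p<nrows (A i j). \<forall>q<ncols (A i j).
         dg (A i j) p q = deg_chain X i (j - i) p q + 1 \<and>
         ext_d (ent (A i j) p q) =
           (\<lambda>x vs. \<Sum>r=i..<j. bar_mult (A i r) (A (r + 1) j) p q x vs)))"

definition class_matrix :: "('n::{finite,linorder}) form gmatrix \<Rightarrow> 'n form set gmatrix"
  where "class_matrix X = \<lparr>nrows = nrows X, ncols = ncols X, dg = dg X,
    ent = (\<lambda>p q. cohom_class (ent X p q))\<rparr>"

definition massey_cocycle :: "nat \<Rightarrow> (nat \<Rightarrow> ('n::{finite,linorder}) form gmatrix) \<Rightarrow>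
    (nat \<Rightarrow> nat \<Rightarrow> 'n form gmatrix) \<Rightarrow> 'n form gmatrix"
  where "massey_cocycle n X A = \<lparr>nrows = nrows (X 1), ncols = ncols (X n),
    dg = (\<lambda>p q. deg_chain X 1 (n - 1) p q + 2),
    ent = (\<lambda>p q x vs. \<Sum>r=1..<n. bar_mult (A 1 r) (A (r + 1) n) p q x vs)\<rparr>"

definition massey_arguments ::
    "nat \<Rightarrow> (nat \<Rightarrow> ('n::{finite,linorder}) form set gmatrix) \<Rightarrow> bool"
  where "massey_arguments n V \<longleftrightarrow> n \<ge> 2 \<and> (\<forall>i\<in>{1..n}. N_H_plus (V i)) \<and>
    (\<forall>i\<in>{1..<n}. multipliable (V i) (V (i + 1)))"

definition represents ::
    "('n::{finite,linorder}) form gmatrix \<Rightarrow> 'n form set gmatrix \<Rightarrow> bool"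
  where "represents X V \<longleftrightarrow> N_I X \<and>
    nrows X = nrows V \<and> ncols X = ncols V \<and>
    (\<forall>p<nrows X. \<forall>q<ncols X. dg X p q = dg V p q \<and>
      ent X p q \<in> cocycles \<and> cohom_class (ent X p q) = ent V p q)"

text \<open>The matrix Massey product \<open>\<langle>V\<^sub>1,\<dots>,V\<^sub>n\<rangle>\<close>, collected over all choices of
  representing cocycles (on which it does not depend); it is empty if it is not defined.\<close>

definition massey :: "nat \<Rightarrow> (nat \<Rightarrow> ('n::{finite,linorder}) form set gmatrix) \<Rightarrow>
    'n form set gmatrix set"
  where "massey n V = {class_matrix (massey_cocycle n X A) | X A.
    (\<forall>i\<in>{1..n}. represents (X i) (V i)) \<and> defining_system n X A}"

definition massey_entries :: "nat \<Rightarrow> ('n::{finite,linorder}) form set set"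
  where "massey_entries n = {ent C p q | V C p q.
    massey_arguments n V \<and> C \<in> massey n V \<and> p < nrows C \<and> q < ncols C}"

end

theory Submission
  imports Defs "HOL-Computational_Algebra.Formal_Power_Series"
begin

text \<open>Dynkin's formula is transported to matrices by the faithful module with basis
  \<open>f\<^sub>0, \<dots>, f\<^sub>n\<close> and \<open>e\<^sub>i f\<^sub>j = (j - 1) f\<^sub>i\<^sub>+\<^sub>j\<close>: there
  \<open>Z(t) = log (exp (t x) exp (t y))\<close> satisfies a differential equation whose solution is Dynkin's
  series. Hence \<open>bch\<close> is a group law and the left-invariant forms obey the Maurer--Cartan equation.

  Since \<open>e\<^sub>i f\<^sub>1 = 0\<close>, dividing out \<open>f\<^sub>1\<close> leaves a flat connection matrix of size \<open>n\<close>.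
  Continued by one step to \<open>n + 1\<close>, its missing corner entry has curvature \<open>\<Omega>\<close>, which
  exhibits the class as an element of \<open>\<langle>\<omega>\<^sub>2, \<omega>\<^sub>1, \<dots>, \<omega>\<^sub>1\<rangle>\<close>.

  Conversely, some \<open>b = N e\<^sub>n\<close> with \<open>N \<noteq> 0\<close> is an \<open>(n - 1)\<close>-fold commutator of lattice
  elements, and it commutes with \<open>e\<^sub>1\<close>. A defining system of length \<open>l < n\<close> is a
  block unipotent connection that is flat up to its corner; its monodromy along \<open>b\<close> is trivial, so
  its curvature integrates to zero over the torus spanned by \<open>e\<^sub>1\<close> and \<open>b\<close>, whereas
  \<open>\<Omega>\<close> does not.\<close>

subsection \<open>Power series in nilpotent operators\<close>

text \<open>Associativity is invisible in the sum over words that defines \<open>bch\<close>, and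
  the adjoint module cannot reveal it, because it kills the centre. In the module used here
  \<open>e_i\<close> sends \<open>f_0\<close> to \<open>- f_i\<close>, which makes it faithful; the
  coefficient that vanishes at \<open>f_1\<close> is what later allows \<open>f_1\<close> to be
  divided out.

  The obstacle in the second half is that the connection of a defining system need not extend to a
  flat one. Parallel transport from the first node exists in every column but the last, where the
  missing corner entry interferes. The difference between the transport and its translate along
  \<open>e_1\<close> starts with 0, so that entry drops out and a last component exists after all. A
  commutator of weight \<open>k\<close> acts trivially on parallel rows below level
  \<open>k\<close>, and one level further if they vanish at the start. With weight n - 1 this
  reaches exactly the lengths up to n - 1.

  Integration over the torus is a linear functional that kills exact forms, so it excludes the whole
  span at once and not only single products.\<close>

definition op_series :: "nat \<Rightarrow> ('a::real_vector \<Rightarrow> 'a) \<Rightarrow> real fps \<Rightarrow> 'a \<Rightarrow> 'a"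
  where "op_series K T f M = (\<Sum>k\<le>K. fps_nth f k *\<^sub>R (T ^^ k) M)"

lemma sum_triangle_square:
  fixes f :: "nat \<Rightarrow> nat \<Rightarrow> 'a::comm_monoid_add"
  assumes "\<And>i j. i + j > K \<Longrightarrow> f i j = 0"
  shows "(\<Sum>n\<le>K. \<Sum>j\<le>n. f j (n - j)) = (\<Sum>j\<le>K. \<Sum>i\<le>K. f j i)"
proof -
  have "(\<Sum>n\<le>K. \<Sum>j\<le>n. f j (n - j)) = (\<Sum>(i,j) \<in> {(i,j). i + j \<le> K}. f i j)"
    by (rule sum.triangle_reindex_eq [symmetric])
  also have "\<dots> = (\<Sum>(i,j) \<in> {..K} \<times> {..K}. f i j)"
    by (rule sum.mono_neutral_left) (auto intro: assms simp: not_le)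
  finally show ?thesis by (simp add: sum.cartesian_product)
qed

context
  fixes T :: "'a::real_vector \<Rightarrow> 'a"
  assumes lin: "linear T"
begin

lemma linear_funpow: "linear (T ^^ k)"
  by (induction k) (use lin in \<open>auto simp: linear_id[unfolded id_def] intro: linear_compose[unfolded o_def]
    simp: o_def id_def\<close>)

lemma linear_op_series: "linear (op_series K T f)"
  unfolding op_series_def
  by (intro linear_compose_sum ballI linear_compose_scale_right linear_funpow)

lemma funpow_zero: "(T ^^ k) 0 = 0"
  using linear_0[OF linear_funpow] .

lemma nil_mono:
  assumes "(T ^^ Suc K) M = 0" "k > K"
  shows "(T ^^ k) M = 0"
proof -
  have "k = (k - Suc K) + Suc K" using assms by simp
  then have "(T ^^ k) M = (T ^^ (k - Suc K)) ((T ^^ Suc K) M)"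
    by (metis comp_apply funpow_add)
  then show ?thesis using assms(1) funpow_zero by simp
qed

lemma op_series_funpow: "(T ^^ k) (op_series K T f M) = op_series K T f ((T ^^ k) M)"
  unfolding op_series_def linear_sum[OF linear_funpow]
  by (simp add: linear_scale[OF linear_funpow] flip: comp_apply[of "_ ^^ _" "_ ^^ _"] funpow_add)
     (simp add: add.commute)

text \<open>Truncation at \<open>K\<close> respects products because the terms of the Cauchy product
  of total degree above \<open>K\<close> vanish on \<open>M\<close>.\<close>

lemma op_series_mult:
  assumes "(T ^^ Suc K) M = 0"
  shows "op_series K T (f * g) M = op_series K T f (op_series K T g M)"
proof -
  have "op_series K T (f * g) M = (\<Sum>n\<le>K. \<Sum>j\<le>n. (fps_nth f j * fps_nth g (n - j)) *\<^sub>R (T ^^ (j + (n - j))) M)"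
    unfolding op_series_def fps_mult_nth scaleR_sum_left by (auto simp: atLeast0AtMost intro!: sum.cong)
  also have "\<dots> = (\<Sum>j\<le>K. \<Sum>i\<le>K. (fps_nth f j * fps_nth g i) *\<^sub>R (T ^^ (j + i)) M)"
    by (rule sum_triangle_square) (simp add: nil_mono[OF assms])
  also have "\<dots> = op_series K T f (op_series K T g M)"
    unfolding op_series_def linear_sum[OF linear_funpow]
    by (simp add: linear_scale[OF linear_funpow] scaleR_sum_right funpow_add)
  finally show ?thesis .
qed

lemma op_series_power:
  assumes "(T ^^ Suc K) M = 0"
  shows "op_series K T (f ^ j) M = (op_series K T f ^^ j) M"
proof (induction j)
  case 0
  have "op_series K T 1 M = (\<Sum>k\<le>K. if k = 0 then M else 0)"
    unfolding op_series_def by (rule sum.cong) auto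
  then show ?case by simp
next
  case (Suc j)
  then show ?case by (simp add: op_series_mult[OF assms])
qed

lemma op_series_X:
  assumes "(T ^^ Suc K) M = 0"
  shows "op_series K T fps_X M = T M"
proof -
  have "op_series K T fps_X M = (\<Sum>k\<le>K. if k = 1 then T M else 0)"
    unfolding op_series_def by (rule sum.cong) auto
  also have "\<dots> = T M" using assms by (cases K) auto
  finally show ?thesis .
qed

lemma op_series_cong:
  "(\<And>k. k \<le> K \<Longrightarrow> (T ^^ k) M = 0 \<or> fps_nth f k = fps_nth g k) \<Longrightarrow> op_series K T f M = op_series K T g M"
  unfolding op_series_def by (rule sum.cong) force+

lemma op_series_add: "op_series K T (f + g) M = op_series K T f M + op_series K T g M"
  and op_series_diff: "op_series K T (f - g) M = op_series K T f M - op_series K T g M"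
  and op_series_scale: "op_series K T (fps_const c * f) M = c *\<^sub>R op_series K T f M"
  by (auto simp: op_series_def algebra_simps sum.distrib sum_subtractf scaleR_sum_right)

lemma op_series_one: "op_series K T 1 M = M"
proof -
  have "op_series K T 1 M = (\<Sum>k\<le>K. if k = 0 then M else 0)"
    unfolding op_series_def by (rule sum.cong) auto
  then show ?thesis by simp
qed

lemma op_series_sum: "op_series K T (sum f I) M = (\<Sum>i\<in>I. op_series K T (f i) M)"
proof -
  have "op_series K T 0 M = 0" by (simp add: op_series_def)
  then show ?thesis by (induction I rule: infinite_finite_induct) (auto simp: op_series_add)
qed

text \<open>Since \<open>g\<close> has no constant term, \<open>g ^ j\<close> starts in degree
  \<open>j\<close>, so up to order \<open>K\<close> only the powers with \<open>j \<le> K\<close>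
  are seen.\<close>

lemma op_series_compose:
  assumes "(T ^^ Suc K) M = 0" and g: "fps_nth g 0 = 0"
  shows "op_series K T (f oo g) M = (\<Sum>j\<le>K. fps_nth f j *\<^sub>R (op_series K T g ^^ j) M)"
proof -
  have "op_series K T (f oo g) M = op_series K T (\<Sum>j\<le>K. fps_const (fps_nth f j) * g ^ j) M"
  proof (rule op_series_cong, rule disjI2)
    fix k assume "k \<le> K"
    have "fps_nth (f oo g) k = (\<Sum>j\<in>{0..k}. fps_nth f j * fps_nth (g ^ j) k)"
      by (simp add: fps_compose_nth)
    also have "\<dots> = (\<Sum>j\<le>K. fps_nth f j * fps_nth (g ^ j) k)"
      using \<open>k \<le> K\<close> by (intro sum.mono_neutral_left) (auto simp: startsby_zero_power_prefix[OF g])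
    finally show "fps_nth (f oo g) k = fps_nth (\<Sum>j\<le>K. fps_const (fps_nth f j) * g ^ j) k"
      by (simp add: fps_sum_nth)
  qed
  then show ?thesis by (simp add: op_series_sum op_series_scale op_series_power[OF assms(1)])
qed

end

subsection \<open>Exponential and logarithm in a nilpotent algebra\<close>

text \<open>With left multiplication as the operator, \<open>op_series\<close> evaluates a power
  series at the element \<open>u\<close>; formal identities thus carry over to elements.\<close>

lemma op_series_mult_eq:
  fixes u :: "'a::real_algebra_1"
  shows "op_series K ((*) u) f M = op_series K ((*) u) f 1 * M"
proof -
  have "((*) u ^^ k) M = u ^ k * M" for k and M :: 'a
    by (induction k) (auto simp: mult.assoc)
  then show ?thesis by (simp add: op_series_def sum_distrib_right)
qed

lemma mult_funpow: "((*) u ^^ k) 1 = (u :: 'a::monoid_mult) ^ k"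
  by (induction k) auto

definition commutator :: "'a::ring \<Rightarrow> 'a \<Rightarrow> 'a" where "commutator x y = x * y - y * x"

lemma linear_commutator: "linear (commutator (x::'a::real_algebra))"
  by (rule linearI) (auto simp: commutator_def algebra_simps)

lemma sum_scaleR_shift:
  fixes f :: "nat \<Rightarrow> 'a::real_vector" and c :: "nat \<Rightarrow> real"
  assumes "c (Suc n) = 0"
  shows "(\<Sum>j\<le>n. c j *\<^sub>R (f (Suc j) + f j)) = c 0 *\<^sub>R f 0 + (\<Sum>j\<le>n. (c j + c (Suc j)) *\<^sub>R f (Suc j))"
proof -
  have "(\<Sum>j\<le>n. c j *\<^sub>R f j) = (\<Sum>j\<le>Suc n. c j *\<^sub>R f j)"
    using assms by simp
  also have "\<dots> = c 0 *\<^sub>R f 0 + (\<Sum>j\<le>n. c (Suc j) *\<^sub>R f (Suc j))"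
    by (rule sum.atMost_Suc_shift)
  finally show ?thesis
    by (simp add: scaleR_add_right scaleR_add_left sum.distrib add_ac)
qed

text \<open>Left multiplication by \<open>z\<close> is \<open>commutator z\<close> plus right
  multiplication by \<open>z\<close>. Moving every \<open>z\<close> to the right turns the sum,
  which comes from the derivative of a power, into binomial coefficients by Pascal's rule.\<close>

lemma sum_powers_commutator:
  fixes z M :: "'a::real_algebra_1"
  shows "(\<Sum>a\<le>n. z ^ a * M * z ^ (n - a)) =
    (\<Sum>j\<le>n. real (Suc n choose Suc j) *\<^sub>R ((commutator z ^^ j) M * z ^ (n - j)))"
proof (induction n)
  case (Suc n)
  have comm: "z * v = commutator z v + v * z" for v by (simp add: commutator_def)
  let ?f = "\<lambda>j. (commutator z ^^ j) M * z ^ (Suc n - j)"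
  have "(\<Sum>a\<le>Suc n. z ^ a * M * z ^ (Suc n - a)) = M * z ^ Suc n + z * (\<Sum>a\<le>n. z ^ a * M * z ^ (n - a))"
    by (simp add: sum.atMost_Suc_shift sum_distrib_left mult.assoc del: sum.atMost_Suc)
  also have "z * (\<Sum>a\<le>n. z ^ a * M * z ^ (n - a)) =
      (\<Sum>j\<le>n. real (Suc n choose Suc j) *\<^sub>R (?f (Suc j) + ?f j))"
    unfolding Suc sum_distrib_left
  proof (rule sum.cong, goal_cases)
    case (2 j)
    have "z * ((commutator z ^^ j) M * z ^ (n - j)) = ((commutator z ^^ Suc j) M + (commutator z ^^ j) M * z) * z ^ (n - j)"
      using comm[of "(commutator z ^^ j) M"] by (simp flip: mult.assoc)
    also have "\<dots> = ?f (Suc j) + ?f j"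
      using 2 by (simp add: Suc_diff_le algebra_simps)
    finally show ?case by (simp add: mult_scaleR_right)
  qed auto
  also have "\<dots> = real (Suc n choose Suc 0) *\<^sub>R ?f 0 +
      (\<Sum>j\<le>n. (real (Suc n choose Suc j) + real (Suc n choose Suc (Suc j))) *\<^sub>R ?f (Suc j))"
    by (rule sum_scaleR_shift) (simp add: binomial_eq_0)
  also have "M * z ^ Suc n + \<dots> = real (Suc (Suc n) choose Suc 0) *\<^sub>R ?f 0 +
      (\<Sum>j\<le>n. real (Suc (Suc n) choose Suc (Suc j)) *\<^sub>R ?f (Suc j))"
    by (simp add: scaleR_add_left scaleR_2 del: binomial_Suc_Suc add: binomial_Suc_Suc[of "Suc n" "Suc _"])
  also have "\<dots> = (\<Sum>j\<le>Suc n. real (Suc (Suc n) choose Suc j) *\<^sub>R ?f j)"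
    by (rule sum.atMost_Suc_shift[symmetric])
  finally show ?case .
qed auto

text \<open>The binomial theorem for the commuting operators \<open>commutator z\<close> and right
  multiplication by \<open>z\<close>.\<close>

lemma power_mult_commutator:
  fixes z M :: "'a::real_algebra_1"
  shows "z ^ n * M = (\<Sum>j\<le>n. real (n choose j) *\<^sub>R ((commutator z ^^ j) M * z ^ (n - j)))"
proof (induction n)
  case (Suc n)
  have comm: "z * v = commutator z v + v * z" for v by (simp add: commutator_def)
  let ?f = "\<lambda>j. (commutator z ^^ j) M * z ^ (Suc n - j)"
  have "z ^ Suc n * M = z * (z ^ n * M)" by (simp add: mult.assoc)
  also have "\<dots> = (\<Sum>j\<le>n. real (n choose j) *\<^sub>R (?f (Suc j) + ?f j))"
    unfolding Suc sum_distrib_left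
  proof (rule sum.cong, goal_cases)
    case (2 j)
    have "z * ((commutator z ^^ j) M * z ^ (n - j)) = ((commutator z ^^ Suc j) M + (commutator z ^^ j) M * z) * z ^ (n - j)"
      using comm[of "(commutator z ^^ j) M"] by (simp flip: mult.assoc)
    also have "\<dots> = ?f (Suc j) + ?f j"
      using 2 by (simp add: Suc_diff_le algebra_simps)
    finally show ?case by (simp add: mult_scaleR_right)
  qed auto
  also have "\<dots> = real (n choose 0) *\<^sub>R ?f 0 +
      (\<Sum>j\<le>n. (real (n choose j) + real (n choose Suc j)) *\<^sub>R ?f (Suc j))"
    by (rule sum_scaleR_shift) (simp add: binomial_eq_0)
  also have "\<dots> = real (Suc n choose 0) *\<^sub>R ?f 0 + (\<Sum>j\<le>n. real (Suc n choose Suc j) *\<^sub>R ?f (Suc j))"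
    by simp
  also have "\<dots> = (\<Sum>j\<le>Suc n. real (Suc n choose j) *\<^sub>R ?f j)"
    by (rule sum.atMost_Suc_shift[symmetric])
  finally show ?case .
qed auto

lemma has_vector_derivative_power_noncomm:
  fixes Z :: "real \<Rightarrow> 'a::{real_normed_algebra,real_algebra_1}"
  assumes "(Z has_vector_derivative Z') (at t)"
  shows "((\<lambda>s. Z s ^ n) has_vector_derivative (\<Sum>a<n. Z t ^ a * Z' * Z t ^ (n - Suc a))) (at t)"
proof (induction n)
  case (Suc n)
  have "((\<lambda>s. Z s * Z s ^ n) has_vector_derivative
      Z t * (\<Sum>a<n. Z t ^ a * Z' * Z t ^ (n - Suc a)) + Z' * Z t ^ n) (at t)"
    by (rule has_vector_derivative_mult[OF assms Suc])
  also have "Z t * (\<Sum>a<n. Z t ^ a * Z' * Z t ^ (n - Suc a)) + Z' * Z t ^ n =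
     (\<Sum>a<Suc n. Z t ^ a * Z' * Z t ^ (Suc n - Suc a))"
    by (subst sum.lessThan_Suc_shift) (simp add: sum_distrib_left mult.assoc)
  finally show ?case by simp
qed auto

text \<open>Nilpotency of single elements is not stable under sums and products; a filtration is,
  and it also records leading terms. The class \<open>real_normed_algebra_1\<close> is avoided
  because the matrix norm used below gives \<open>1\<close> the size of the matrix.\<close>

locale nilpotent_filtration =
  fixes F :: "nat \<Rightarrow> 'a::{real_normed_algebra,real_algebra_1} set" and N :: nat
  assumes subspace: "subspace (F i)"
    and one: "1 \<in> F 0"
    and mult: "x \<in> F i \<Longrightarrow> y \<in> F j \<Longrightarrow> x * y \<in> F (i + j)"
    and antimono: "i \<le> j \<Longrightarrow> F j \<subseteq> F i"
    and nil: "F (Suc N) = {0}"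
    and N_pos: "N > 0"
begin

lemma zero: "i > N \<Longrightarrow> x \<in> F i \<Longrightarrow> x = 0"
  using antimono[of "Suc N" i] nil by auto

lemma power: "x \<in> F 1 \<Longrightarrow> x ^ k \<in> F k"
  by (induction k) (use one mult[of x 1] in auto)

lemma commutator_mem: "x \<in> F i \<Longrightarrow> y \<in> F j \<Longrightarrow> commutator x y \<in> F (i + j)"
  unfolding commutator_def using mult[of x i y j] mult[of y j x i] subspace_diff[OF subspace]
  by (auto simp: add.commute)

lemma commutator_pow_mem: "x \<in> F 1 \<Longrightarrow> y \<in> F j \<Longrightarrow> (commutator x ^^ k) y \<in> F (k + j)"
  by (induction k) (use commutator_mem[of x 1] in auto)

lemma commutator_nil: "x \<in> F 1 \<Longrightarrow> y \<in> F j \<Longrightarrow> k + j > N \<Longrightarrow> (commutator x ^^ k) y = 0"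
  using commutator_pow_mem zero by blast

lemma mult_nil: "x \<in> F 1 \<Longrightarrow> ((*) x ^^ Suc N) 1 = 0"
  unfolding mult_funpow using power[of x "Suc N"] nil by blast

definition nexp :: "'a \<Rightarrow> 'a" where "nexp x = (\<Sum>k\<le>N. (1 / fact k) *\<^sub>R x ^ k)"
text \<open>The argument is shifted: \<open>nlog u\<close> stands for log (1 + u), so that
  \<open>u\<close> can be nilpotent.\<close>

definition nlog :: "'a \<Rightarrow> 'a" where "nlog u = (\<Sum>k=1..N. ((-1) ^ (k - 1) / k) *\<^sub>R u ^ k)"

lemma op_series_exp: "op_series N ((*) x) (fps_exp 1) 1 = nexp x"
  by (simp add: op_series_def nexp_def mult_funpow)

lemma op_series_ln: "op_series N ((*) x) (fps_ln 1) 1 = nlog x"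
  unfolding op_series_def nlog_def mult_funpow fps_ln_nth
  by (rule sum.mono_neutral_cong_right) auto

lemma linear_mult: "linear ((*) (x::'a))"
  by (simp add: linear_iff algebra_simps)

lemma op_series_mem: 
  assumes "x \<in> F 1" "i \<le> 1" "\<And>k. k < i \<Longrightarrow> fps_nth f k = 0"
  shows "op_series N ((*) x) f 1 \<in> F i"
  unfolding op_series_def mult_funpow
proof (rule subspace_sum[OF subspace])
  fix k assume "k \<in> {..N}"
  show "fps_nth f k *\<^sub>R x ^ k \<in> F i"
  proof (cases "k < i")
    case False
    then have "x ^ k \<in> F i" using power[OF assms(1), of k] antimono[of i k] by auto
    then show ?thesis by (rule subspace_scale[OF subspace])
  qed (use assms subspace_0[OF subspace] in auto)
qed

lemma nexp_mem: "x \<in> F 1 \<Longrightarrow> nexp x \<in> F 0"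
  using op_series_mem[of x 0 "fps_exp 1"] by (auto simp: op_series_exp)

lemma nexp_minus_one: "nexp x - 1 = op_series N ((*) x) (fps_exp 1 - 1) 1"
  by (simp add: op_series_diff op_series_one op_series_exp linear_mult)

lemma nexp_minus_one_mem: "x \<in> F 1 \<Longrightarrow> nexp x - 1 \<in> F 1"
  unfolding nexp_minus_one by (rule op_series_mem) auto

lemma nlog_mem: "x \<in> F 1 \<Longrightarrow> nlog x \<in> F 1"
  using op_series_mem[of x 1 "fps_ln 1"] by (auto simp: op_series_ln)

lemma op_series_mult_funpow: "(op_series N ((*) (x::'a)) g ^^ j) 1 = (op_series N ((*) x) g 1) ^ j"
proof (induction j)
  case (Suc j)
  then show ?case by (simp add: op_series_mult_eq[of N x g "_ ^ _"])
qed auto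

lemma op_series_compose_one:
  assumes "x \<in> F 1" "fps_nth g 0 = 0"
  shows "op_series N ((*) x) (f oo g) 1 = op_series N ((*) (op_series N ((*) x) g 1)) f 1"
  by (simp add: op_series_compose[OF linear_mult mult_nil[OF assms(1)] assms(2)] op_series_mult_funpow
     op_series_def[of _ "(*) (op_series _ _ _ _)"] mult_funpow)

text \<open>This is the formal identity (exp X - 1) o ln (1 + X) = X, evaluated at
  \<open>u\<close>.\<close>

lemma nexp_nlog: assumes "u \<in> F 1" shows "nexp (nlog u) = 1 + u"
proof -
  have "(fps_exp 1 - 1) oo fps_ln 1 = (fps_X :: real fps)"
    by (simp add: fps_ln_fps_exp_inv fps_inv_fps_exp_compose)
  then have "nexp (nlog u) - 1 = op_series N ((*) u) fps_X 1"
    unfolding nexp_minus_one by (simp add: op_series_compose_one[OF assms, symmetric] flip: op_series_ln)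
  then show ?thesis
    by (simp add: op_series_X[OF linear_mult mult_nil[OF assms]] algebra_simps)
qed

lemma nlog_nexp: assumes "x \<in> F 1" shows "nlog (nexp x - 1) = x"
proof -
  have "fps_ln 1 oo (fps_exp 1 - 1) = (fps_X :: real fps)"
    by (simp add: fps_ln_fps_exp_inv fps_inv_fps_exp_compose)
  then have "nlog (nexp x - 1) = op_series N ((*) x) fps_X 1"
    unfolding nexp_minus_one by (simp add: op_series_compose_one[OF assms, symmetric] flip: op_series_ln)
  then show ?thesis
    by (simp add: op_series_X[OF linear_mult mult_nil[OF assms]] algebra_simps)
qed

lemma nexp_uminus: "nexp (- x) = op_series N ((*) x) (fps_exp (- 1)) 1"
  unfolding nexp_def op_series_def mult_funpow
  by (rule sum.cong) (auto simp: power_minus[of x] minus_one_power_iff)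

lemma nexp_inverse: assumes "x \<in> F 1" shows "nexp (- x) * nexp x = 1" 
proof -
  have "nexp (-x) * nexp x = op_series N ((*) x) (fps_exp (-1)) (op_series N ((*) x) (fps_exp 1) 1)"
    unfolding nexp_uminus op_series_exp op_series_mult_eq[of N x "fps_exp (-1)" "nexp x"] ..
  also have "\<dots> = op_series N ((*) x) (fps_exp (-1) * fps_exp 1) 1"
    by (rule op_series_mult[OF linear_mult mult_nil[OF assms], symmetric])
  also have "fps_exp (-1) * fps_exp 1 = (1 :: real fps)"
    by (simp flip: fps_exp_add_mult)
  finally show ?thesis by (simp add: op_series_one linear_mult)
qed

lemma nexp_inverse': "x \<in> F 1 \<Longrightarrow> nexp x * nexp (- x) = 1" 
  using nexp_inverse[of "-x"] subspace_neg[OF subspace] by auto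

text \<open>Conjugation by exp z is exp (ad z), written without an inverse.\<close>

lemma nexp_mult_eq:
  assumes "z \<in> F 1" "M \<in> F 0"
  shows "nexp z * M = op_series N (commutator z) (fps_exp 1) M * nexp z"
proof -
  have "nexp z * M = (\<Sum>n\<le>N. \<Sum>j\<le>n. (1 / (fact j * fact (n - j))) *\<^sub>R ((commutator z ^^ j) M * z ^ (n - j)))"
    unfolding nexp_def sum_distrib_right
    by (intro sum.cong) (auto simp: power_mult_commutator scaleR_sum_right binomial_fact intro!: sum.cong)
  also have "\<dots> = (\<Sum>j\<le>N. \<Sum>i\<le>N. (1 / (fact j * fact i)) *\<^sub>R ((commutator z ^^ j) M * z ^ i))"
  proof (rule sum_triangle_square)
    fix i j assume "i + j > N"
    then have "(commutator z ^^ i) M * z ^ j = 0"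
      using mult[OF commutator_pow_mem[OF assms, of i] power[OF assms(1)], of j] zero by auto
    then show "(1 / (fact i * fact j)) *\<^sub>R ((commutator z ^^ i) M * z ^ j) = 0" by simp
  qed
  also have "\<dots> = op_series N (commutator z) (fps_exp 1) M * nexp z"
    unfolding op_series_def nexp_def sum_product by (intro sum.cong) (auto simp: mult.commute)
  finally show ?thesis .
qed

text \<open>The series (exp X - 1) / X, the correction factor in the derivative of the exponential
  map.\<close>

definition fps_phi :: "real fps" where "fps_phi = Abs_fps (\<lambda>n. 1 / fact (Suc n))"

text \<open>The derivative of a power is a sum over the positions of \<open>Z'\<close>; moving
  \<open>Z t\<close> to the right replaces positions by iterated commutators with coefficients 1 /
  (j + 1)!.\<close>

lemma nexp_derivative:
  assumes Z: "(Z has_vector_derivative Z') (at t)" and "Z t \<in> F 1" "Z' \<in> F 1"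
  shows "((\<lambda>s. nexp (Z s)) has_vector_derivative op_series N (commutator (Z t)) fps_phi Z' * nexp (Z t)) (at t)"
proof -
  let ?z = "Z t"
  let ?D = "\<Sum>k\<le>N. (1 / fact k) *\<^sub>R (\<Sum>a<k. ?z ^ a * Z' * ?z ^ (k - Suc a))"
  let ?g = "\<lambda>n. \<Sum>j\<le>n. (1 / (fact (Suc j) * fact (n - j))) *\<^sub>R ((commutator ?z ^^ j) Z' * ?z ^ (n - j))"
  have 0: "(commutator ?z ^^ i) Z' * ?z ^ j = 0" if "i + j \<ge> N" for i j
    using mult[OF commutator_pow_mem[OF assms(2,3), of i] power[OF assms(2)], of j]
      zero[of "Suc (i + j)"] that by auto
  have "((\<lambda>s. nexp (Z s)) has_vector_derivative ?D) (at t)"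
    unfolding nexp_def
    by (intro has_vector_derivative_sum bounded_linear.has_vector_derivative[OF bounded_linear_scaleR_right]
       has_vector_derivative_power_noncomm Z)
  also have "?D = (\<Sum>k<N. (1 / fact (Suc k)) *\<^sub>R (\<Sum>a\<le>k. ?z ^ a * Z' * ?z ^ (k - a)))"
    by (subst sum.atMost_shift) (simp add: lessThan_Suc_atMost)
  also have "\<dots> = (\<Sum>k<N. ?g k)"
    unfolding sum_powers_commutator scaleR_sum_right
    by (intro sum.cong) (auto simp: binomial_fact simp del: fact_Suc binomial_Suc_Suc)
  \<comment> \<open>The added term \<open>k = N\<close> is zero: \<open>N\<close> factors
    \<open>Z t\<close> together with \<open>Z'\<close> lie in \<open>F (Suc N)\<close>.\<close>
  also have "\<dots> = (\<Sum>k\<le>N. ?g k)"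
    by (rule sum.mono_neutral_left) (auto intro!: sum.neutral simp: 0)
  also have "\<dots> = (\<Sum>j\<le>N. \<Sum>i\<le>N. (1 / (fact (Suc j) * fact i)) *\<^sub>R ((commutator ?z ^^ j) Z' * ?z ^ i))"
    by (rule sum_triangle_square) (use 0 in auto)
  also have "\<dots> = op_series N (commutator ?z) fps_phi Z' * nexp ?z"
    unfolding op_series_def nexp_def fps_phi_def sum_product by (intro sum.cong) (auto simp: mult_ac)
  finally show ?thesis .
qed

end

subsection \<open>Dynkin's formula\<close>

fun nested_commutator :: "'a::ring list \<Rightarrow> 'a" where
  "nested_commutator [] = 0"
| "nested_commutator [v] = v"
| "nested_commutator (v # w # vs) = commutator v (nested_commutator (w # vs))"

abbreviation weight :: "(nat \<times> nat) list \<Rightarrow> nat"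
  where "weight ps \<equiv> \<Sum>(r,s)\<leftarrow>ps. r + s"

abbreviation word :: "'a \<Rightarrow> 'a \<Rightarrow> (nat \<times> nat) list \<Rightarrow> 'a list"
  where "word x y ps \<equiv> concat (map (\<lambda>(r,s). replicate r x @ replicate s y) ps)"

abbreviation fact_prod :: "(nat \<times> nat) list \<Rightarrow> real"
  where "fact_prod ps \<equiv> \<Prod>(r,s)\<leftarrow>ps. fact r * fact s"

lemma set_word: "set (word x y ps) \<subseteq> {x, y}"
proof -
  have "(if r = 0 then {} else {x}) \<union> (if s = 0 then {} else {y}) \<subseteq> {x, y}" for r s :: nat
    by simp
  then show ?thesis by (simp add: set_replicate_conv_if split_def UN_subset_iff)
qed

lemma nested_commutator_Cons: "w \<noteq> [] \<Longrightarrow> nested_commutator (v # w) = commutator v (nested_commutator w)"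
  by (cases w) auto

lemma nested_commutator_replicate: "w \<noteq> [] \<Longrightarrow> nested_commutator (replicate r x @ w) = (commutator x ^^ r) (nested_commutator w)"
  by (induction r) (auto simp: nested_commutator_Cons)

context nilpotent_filtration
begin

lemma commutator_self: "(commutator x ^^ k) x = (if k = 0 then x else 0)" for x :: 'a
proof (induction k)
  case (Suc k)
  then show ?case using linear_0[OF linear_commutator] by (auto simp: commutator_def)
qed auto

lemma nexp_scaled_derivative:
  assumes "x \<in> F 1"
  shows "((\<lambda>t. nexp (t *\<^sub>R x)) has_vector_derivative x * nexp (t *\<^sub>R x)) (at t)"
proof -
  have "((\<lambda>t. nexp (t *\<^sub>R x)) has_vector_derivative
      op_series N (commutator (t *\<^sub>R x)) fps_phi x * nexp (t *\<^sub>R x)) (at t)"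
    by (rule nexp_derivative) (use assms subspace_scale[OF subspace] in \<open>auto intro!: derivative_eq_intros\<close>)
  moreover have "op_series N (commutator (t *\<^sub>R x)) fps_phi x = op_series N (commutator (t *\<^sub>R x)) 1 x"
  proof (rule op_series_cong[OF linear_commutator])
    fix k
    have "(commutator (t *\<^sub>R x) ^^ k) x = 0" if "k > 0"
      using that linear_0[OF linear_commutator, of "t *\<^sub>R x"]
      by (induction k rule: nat_induct_non_zero) (auto simp: commutator_def)
    then show "(commutator (t *\<^sub>R x) ^^ k) x = 0 \<or> fps_nth fps_phi k = fps_nth 1 k"
      by (cases "k = 0") (auto simp: fps_phi_def)
  qed
  ultimately show ?thesis by (simp add: op_series_one[OF linear_commutator])
qed

text \<open>With u = exp X - 1 the sum without \<open>fps_phi\<close> is the truncation of ln (1 +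
  u) / u, and \<open>fps_phi\<close> is u / X, so the product is ln (1 + u) / X = 1. Cutting off at
  \<open>N\<close> leaves the coefficients below \<open>N\<close> intact. This inverts
  \<open>fps_phi\<close>.\<close>

lemma fps_log_phi:
  assumes "n < N"
  shows "fps_nth (\<Sum>k=1..N. fps_const ((-1) ^ (k - 1) / k) * ((fps_exp 1 - 1) ^ (k - 1) * fps_phi)) n =
    fps_nth (1 :: real fps) n"
    (is "fps_nth ?S n = _")
proof -
  let ?e = "fps_exp 1 - 1 :: real fps"
  have phi: "fps_X * fps_phi = ?e"
  proof (rule fps_ext)
    fix n show "fps_nth (fps_X * fps_phi) n = fps_nth ?e n" by (cases n) (auto simp: fps_phi_def algebra_simps)
  qed
  have "fps_X * ?S = (\<Sum>k=1..N. fps_const ((-1) ^ (k - 1) / k) * (?e ^ (k - 1) * (fps_X * fps_phi)))"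
    unfolding sum_distrib_left by (intro sum.cong) (auto simp: algebra_simps)
  also have "\<dots> = (\<Sum>k=1..N. fps_const (fps_nth (fps_ln 1) k) * ?e ^ k)"
    unfolding phi
  proof (rule sum.cong)
    fix k assume "k \<in> {1..N}"
    then obtain j where k: "k = Suc j" by (cases k) auto
    show "fps_const ((-1) ^ (k - 1) / k) * (?e ^ (k - 1) * ?e) = fps_const (fps_nth (fps_ln 1) k) * ?e ^ k"
      unfolding k by (simp add: fps_ln_nth mult_ac)
  qed auto
  finally have "fps_nth (fps_X * ?S) (Suc n) = (\<Sum>k=1..N. fps_nth (fps_ln 1) k * fps_nth (?e ^ k) (Suc n))"
    by (simp only: fps_sum_nth fps_mult_left_const_nth)
  also have "\<dots> = (\<Sum>k=0..Suc n. fps_nth (fps_ln 1) k * fps_nth (?e ^ k) (Suc n))"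
    using assms by (intro sum.mono_neutral_cong) (auto simp: fps_ln_nth startsby_zero_power_prefix not_le)
  also have "\<dots> = fps_nth (fps_ln 1 oo ?e) (Suc n)" by (simp add: fps_compose_nth)
  also have "fps_ln 1 oo ?e = fps_X" 
    by (simp add: fps_ln_fps_exp_inv fps_inv_fps_exp_compose)
  finally show ?thesis by simp
qed

text \<open>The exponents of one block of a Dynkin word. The pair (0, 0) is the identity that is
  subtracted in \<open>op_series_exp_pairs\<close>; exponents above \<open>N\<close> only give
  vanishing brackets.\<close>

definition pairs :: "(nat \<times> nat) set" where "pairs = {(r,s). r \<le> N \<and> s \<le> N \<and> r + s > 0}"

lemma finite_pairs: "finite pairs"
  by (rule finite_subset[of _ "{..N} \<times> {..N}"]) (auto simp: pairs_def)

lemma nested_commutator_word_mem: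
  assumes "x \<in> F 1" "y \<in> F 1" "ps \<noteq> []" "\<forall>(r,s)\<in>set ps. r + s > 0"
  shows "nested_commutator (word x y ps) \<in> F (weight ps)"
proof -
  have len: "length (word x y ps) = weight ps" by (induction ps) auto
  have "set ws \<subseteq> F 1 \<Longrightarrow> ws \<noteq> [] \<Longrightarrow> nested_commutator ws \<in> F (length ws)" for ws
  proof (induction ws rule: nested_commutator.induct)
    case (3 v w vs)
    then show ?case using commutator_mem[of v 1 "nested_commutator (w # vs)" "length (w # vs)"] by auto
  qed auto
  moreover have "set (word x y ps) \<subseteq> {x, y}" by (rule set_word)
  then have "set (word x y ps) \<subseteq> F 1" using assms(1,2) by blast
  moreover have "weight ps > 0" using assms(3,4) by (cases ps) auto
  then have "word x y ps \<noteq> []" unfolding length_greater_0_conv[symmetric] len .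
  ultimately show ?thesis using len by metis
qed

lemma sum_pairs:
  "(\<Sum>(r,s)\<in>pairs. f r s) + f 0 0 = (\<Sum>r\<le>N. \<Sum>s\<le>N. f r s)" for f :: "nat \<Rightarrow> nat \<Rightarrow> 'a"
proof -
  have "{..N} \<times> {..N} = insert (0,0) pairs" by (auto simp: pairs_def)
  then have "(\<Sum>r\<le>N. \<Sum>s\<le>N. f r s) = (\<Sum>(r,s)\<in>insert (0,0) pairs. f r s)"
    by (simp add: sum.cartesian_product)
  then show ?thesis using finite_pairs by (simp add: pairs_def add.commute)
qed

lemma commutator_scaleR_pow: "(commutator (t *\<^sub>R x) ^^ k) M = t ^ k *\<^sub>R (commutator x ^^ k) M" for x :: 'a
  by (induction k) (auto simp: commutator_def algebra_simps)

lemma op_series_exp_pairs: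
  fixes x y M :: 'a
  shows "op_series N (commutator (t *\<^sub>R x)) (fps_exp 1) (op_series N (commutator (t *\<^sub>R y)) (fps_exp 1) M) - M =
    (\<Sum>(r,s)\<in>pairs. (t ^ (r + s) / (fact r * fact s)) *\<^sub>R (commutator x ^^ r) ((commutator y ^^ s) M))"
proof -
  have "op_series N (commutator (t *\<^sub>R x)) (fps_exp 1) (op_series N (commutator (t *\<^sub>R y)) (fps_exp 1) M) =
    (\<Sum>r\<le>N. \<Sum>s\<le>N. (t ^ (r + s) / (fact r * fact s)) *\<^sub>R (commutator x ^^ r) ((commutator y ^^ s) M))"
    unfolding op_series_def commutator_scaleR_pow linear_sum[OF linear_funpow[OF linear_commutator]] scaleR_sum_right
      linear_scale[OF linear_funpow[OF linear_commutator]]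
    by (simp add: power_add mult_ac)
  then show ?thesis by (simp add: sum_pairs[symmetric] algebra_simps)
qed

lemma finite_lists_pairs: "finite {ps. set ps \<subseteq> pairs \<and> length ps = k}"
  by (rule finite_lists_length_eq[OF finite_pairs])

lemma sum_lists_Suc:
  fixes f :: "(nat \<times> nat) list \<Rightarrow> 'a"
  shows "(\<Sum>ps | set ps \<subseteq> pairs \<and> length ps = Suc k. f ps) =
    (\<Sum>p\<in>pairs. \<Sum>ps | set ps \<subseteq> pairs \<and> length ps = k. f (p # ps))"
proof -
  have "{ps. set ps \<subseteq> pairs \<and> length ps = Suc k} =
      (\<lambda>(p,ps). p # ps) ` (pairs \<times> {ps. set ps \<subseteq> pairs \<and> length ps = k})"
    by (auto simp: length_Suc_conv image_iff)
  then show ?thesis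
    by (simp add: sum.reindex inj_on_def sum.cartesian_product case_prod_unfold)
qed

text \<open>A right-nested bracket of x^r y^s vanishes unless s = 1, or s = 0 and r = 1. Hence the
  one-block words add up to the logarithmic derivative of exp (t x) exp (t y).\<close>

lemma sum_single_block:
  assumes "x \<in> F 1" "y \<in> F 1"
  shows "x + op_series N (commutator (t *\<^sub>R x)) (fps_exp 1) y =
    (\<Sum>(r,s)\<in>pairs. (t ^ (r + s - 1) / (fact r * fact s)) *\<^sub>R nested_commutator (replicate r x @ replicate s y))"
    (is "_ = (\<Sum>(r,s)\<in>pairs. ?f r s)")
proof -
  have nested: "nested_commutator (replicate r x @ replicate (Suc s) y) = (if s = 0 then (commutator x ^^ r) y else 0)" for r s
  proof -
    have "nested_commutator (replicate (Suc s) y) = (commutator y ^^ s) y"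
      using nested_commutator_replicate[of "[y]" s y] by (simp add: replicate_append_same)
    then have "nested_commutator (replicate r x @ replicate (Suc s) y) = (commutator x ^^ r) ((commutator y ^^ s) y)"
      by (subst nested_commutator_replicate) auto
    then show ?thesis using linear_0[OF linear_funpow[OF linear_commutator]] by (cases "s = 0") (auto simp: commutator_self)
  qed
  have nested0: "nested_commutator (replicate (Suc r) x) = (if r = 0 then x else 0)" for r
    using nested_commutator_replicate[of "[x]" r x] by (simp add: replicate_append_same commutator_self)
  \<comment> \<open>The pair (0, 0) may be added because \<open>nested_commutator []\<close> is
    0.\<close>
  have "(\<Sum>(r,s)\<in>pairs. ?f r s) = (\<Sum>r\<le>N. \<Sum>s\<le>N. ?f r s)"
    using sum_pairs[of ?f] by simp
  also have "\<dots> = (\<Sum>r\<le>N. ?f r 0 + ?f r 1)"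
  proof (rule sum.cong)
    fix r
    have "?f r s = 0" if "s \<noteq> 0" "s \<noteq> 1" for s
      using nested[of r "s - 1"] that by simp
    then have "(\<Sum>s\<le>N. ?f r s) = (\<Sum>s\<in>{0,1}. ?f r s)"
      using N_pos by (intro sum.mono_neutral_right) auto
    then show "(\<Sum>s\<le>N. ?f r s) = ?f r 0 + ?f r 1" by simp
  qed auto
  also have "\<dots> = (\<Sum>r\<le>N. ?f r 0) + (\<Sum>r\<le>N. ?f r 1)" by (rule sum.distrib)
  also have "(\<Sum>r\<le>N. ?f r 0) = (\<Sum>r\<in>{1}. ?f r 0)"
  proof (rule sum.mono_neutral_right)
    show "\<forall>i\<in>{..N} - {1}. ?f i 0 = 0"
    proof
      fix i assume "i \<in> {..N} - {1}"
      then show "?f i 0 = 0" using nested0[of "i - 1"] by (cases "i = 0") auto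
    qed
  qed (use N_pos in auto)
  also have "\<dots> = x" by simp
  also have "(\<Sum>r\<le>N. ?f r 1) = op_series N (commutator (t *\<^sub>R x)) (fps_exp 1) y"
    using nested[of _ 0] by (simp add: op_series_def commutator_scaleR_pow)
  finally show ?thesis ..
qed

text \<open>Each application of \<open>T\<close>, that is exp (ad t x) exp (ad t y) - 1, puts one
  more block in front of every word.\<close>

lemma pow_single_block:
  assumes "x \<in> F 1" "y \<in> F 1"
    and T: "\<And>M. T M = (\<Sum>(r,s)\<in>pairs. (t ^ (r + s) / (fact r * fact s)) *\<^sub>R (commutator x ^^ r) ((commutator y ^^ s) M))"
  shows "(T ^^ k) (x + op_series N (commutator (t *\<^sub>R x)) (fps_exp 1) y) =
    (\<Sum>ps | set ps \<subseteq> pairs \<and> length ps = Suc k.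
      (t ^ (weight ps - 1) / fact_prod ps) *\<^sub>R nested_commutator (word x y ps))"
proof (induction k)
  case 0
  have "{ps. set ps \<subseteq> pairs \<and> length ps = 0} = {[]}" by auto
  then show ?case
    by (simp add: sum_single_block[OF assms(1,2)] sum_lists_Suc case_prod_unfold)
next
  case (Suc k)
  let ?g = "\<lambda>ps. (t ^ (weight ps - 1) / fact_prod ps) *\<^sub>R nested_commutator (word x y ps)"
  have lin: "linear (\<lambda>M. (commutator x ^^ r) ((commutator y ^^ s) M))" for r s
    using linear_compose[OF linear_funpow[OF linear_commutator] linear_funpow[OF linear_commutator]] by (simp add: o_def)
  have "(T ^^ Suc k) (x + op_series N (commutator (t *\<^sub>R x)) (fps_exp 1) y) =
      (\<Sum>(r,s)\<in>pairs. \<Sum>ps | set ps \<subseteq> pairs \<and> length ps = Suc k.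
       (t ^ (r + s) / (fact r * fact s)) *\<^sub>R (commutator x ^^ r) ((commutator y ^^ s) (?g ps)))"
    unfolding funpow.simps comp_apply Suc T linear_sum[OF lin] scaleR_sum_right ..
  also have "\<dots> = (\<Sum>p\<in>pairs. \<Sum>ps | set ps \<subseteq> pairs \<and> length ps = Suc k. ?g (p # ps))"
  proof (intro sum.cong refl, clarify, intro sum.cong refl, clarify)
    fix r s and ps :: "(nat \<times> nat) list" assume ps: "set ps \<subseteq> pairs" "length ps = Suc k"
    then obtain q qs where qs: "ps = q # qs" by (cases ps) auto
    obtain a b where q: "q = (a,b)" by force
    have pos: "a + b > 0" using ps qs q by (auto simp: pairs_def)
    \<comment> \<open>Non-emptiness matters: putting \<open>v\<close> in front of the empty word
      gives \<open>v\<close> and not \<open>commutator v 0\<close>.\<close>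
    then have w: "word x y ps \<noteq> []" unfolding qs q by auto
    have "nested_commutator (word x y ((r,s) # ps)) = (commutator x ^^ r) ((commutator y ^^ s) (nested_commutator (word x y ps)))"
      using w by (simp add: nested_commutator_replicate)
    moreover have "t ^ (weight ((r,s) # ps) - 1) = t ^ (r + s) * t ^ (weight ps - 1)"
    proof -
      have "weight ((r,s) # ps) - 1 = (r + s) + (weight ps - 1)" using pos unfolding qs q by simp linarith
      then show ?thesis by (simp only: power_add)
    qed
    ultimately show "(t ^ (r + s) / (fact r * fact s)) *\<^sub>R (commutator x ^^ r) ((commutator y ^^ s) (?g ps)) = ?g ((r,s) # ps)"
      by (simp add: linear_scale[OF lin])
  qed
  also have "\<dots> = (\<Sum>ps | set ps \<subseteq> pairs \<and> length ps = Suc (Suc k). ?g ps)"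
    by (rule sum_lists_Suc[symmetric])
  finally show ?case .
qed

text \<open>Only existence and membership in \<open>F 1\<close> are recorded; the value will follow
  from the differential equation satisfied by the exponential.\<close>

lemma nlog_derivative:
  assumes "(W has_vector_derivative W') (at t)" "W t - 1 \<in> F 1" "W' \<in> F 1"
  obtains Z' where "((\<lambda>s. nlog (W s - 1)) has_vector_derivative Z') (at t)" "Z' \<in> F 1"
proof -
  let ?u = "W t - 1"
  let ?Z = "\<Sum>k=1..N. ((-1) ^ (k - 1) / k) *\<^sub>R (\<Sum>a<k. ?u ^ a * W' * ?u ^ (k - Suc a))"
  have "((\<lambda>s. W s - 1) has_vector_derivative W') (at t)"
    using assms(1) by (auto intro!: derivative_eq_intros)
  then have "((\<lambda>s. nlog (W s - 1)) has_vector_derivative ?Z) (at t)"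
    unfolding nlog_def
    by (intro has_vector_derivative_sum bounded_linear.has_vector_derivative[OF bounded_linear_scaleR_right]
       has_vector_derivative_power_noncomm)
  moreover have "?Z \<in> F 1"
  proof (intro subspace_sum[OF subspace] subspace_scale[OF subspace])
    fix k a
    show "?u ^ a * W' * ?u ^ (k - Suc a) \<in> F 1"
      using mult[OF mult[OF power[OF assms(2), of a] assms(3)] power[OF assms(2), of "k - Suc a"]]
        antimono[of 1 "a + 1 + (k - Suc a)"] by auto
  qed
  ultimately show ?thesis using that by blast
qed

definition dynkin :: "'a \<Rightarrow> 'a \<Rightarrow> 'a" where
  "dynkin x y = (\<Sum>ps\<in>dynkin_words N. dynkin_coeff ps *\<^sub>R nested_commutator (word x y ps))"

lemma dynkin_words_sub:
  "dynkin_words N = {ps. set ps \<subseteq> pairs \<and> ps \<noteq> [] \<and> weight ps \<le> N}"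
    and length_le_weight: "set ps \<subseteq> pairs \<Longrightarrow> length ps \<le> weight ps"
proof -
  have "r + s \<le> weight ps" if "(r,s) \<in> set ps" for r s ps
    using that by (induction ps) auto
  then show "dynkin_words N = {ps. set ps \<subseteq> pairs \<and> ps \<noteq> [] \<and> weight ps \<le> N}"
    unfolding dynkin_words_def pairs_def by fastforce
  show "set ps \<subseteq> pairs \<Longrightarrow> length ps \<le> weight ps"
    by (induction ps) (auto simp: pairs_def)
qed

lemma finite_dynkin_words: "finite (dynkin_words N)"
proof (rule finite_subset)
  show "dynkin_words N \<subseteq> {ps. set ps \<subseteq> pairs \<and> length ps \<le> N}"
    unfolding dynkin_words_sub using length_le_weight order.trans by blast
qed (rule finite_lists_length_le[OF finite_pairs])

text \<open>The equation for Z(t) = log (exp (t x) exp (t y)) is phi (ad Z) Z' = x + exp (ad t x) y,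
  where phi is \<open>fps_phi\<close>. Inverting phi by \<open>fps_log_phi\<close> and using exp (ad
  Z) = exp (ad t x) exp (ad t y) makes Z' an explicit polynomial in t.\<close>

lemma nexp_dynkin:
  assumes x: "x \<in> F 1" and y: "y \<in> F 1"
  shows "nexp (dynkin x y) = nexp x * nexp y"
proof -
  define W where "W t = nexp (t *\<^sub>R x) * nexp (t *\<^sub>R y)" for t :: real
  define Z where "Z t = nlog (W t - 1)" for t
  \<comment> \<open>The weight of a word is its total degree in \<open>x\<close> and
    \<open>y\<close>, so this is Dynkin's series of \<open>t *\<^sub>R x\<close> and
    \<open>t *\<^sub>R y\<close>.\<close>
  define z where "z t = (\<Sum>ps\<in>dynkin_words N. dynkin_coeff ps *\<^sub>R t ^ weight ps *\<^sub>R nested_commutator (word x y ps))"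
    for t :: real
  define z' where "z' t = (\<Sum>ps\<in>dynkin_words N. dynkin_coeff ps *\<^sub>R
    (weight ps * t ^ (weight ps - 1)) *\<^sub>R nested_commutator (word x y ps))" for t :: real
  have tx: "t *\<^sub>R x \<in> F 1" and ty: "t *\<^sub>R y \<in> F 1" for t
    using x y subspace_scale[OF subspace] by auto
  have W1: "W t - 1 \<in> F 1" for t
  proof -
    have "W t - 1 = (nexp (t *\<^sub>R x) - 1) * nexp (t *\<^sub>R y) + (nexp (t *\<^sub>R y) - 1)"
      by (simp add: W_def algebra_simps)
    moreover have "(nexp (t *\<^sub>R x) - 1) * nexp (t *\<^sub>R y) \<in> F 1"
      using mult[OF nexp_minus_one_mem[OF tx] nexp_mem[OF ty]] by simp
    ultimately show ?thesis
      by (simp only: subspace_add[OF subspace _ nexp_minus_one_mem[OF ty]])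
  qed
  have Z1: "Z t \<in> F 1" for t unfolding Z_def by (rule nlog_mem[OF W1])
  have expZ: "nexp (Z t) = W t" for t unfolding Z_def nexp_nlog[OF W1] by simp
  have dz: "(z has_vector_derivative z' t) (at t)" for t
    unfolding z_def z'_def
    by (intro has_vector_derivative_sum bounded_linear.has_vector_derivative[OF bounded_linear_scaleR_right])
       (auto intro!: derivative_eq_intros simp: has_real_derivative_iff_has_vector_derivative[symmetric])
  have dZ: "(Z has_vector_derivative z' t) (at t)" for t
  proof -
    define X where "X = t *\<^sub>R x"
    define Y where "Y = t *\<^sub>R y"
    have X: "X \<in> F 1" and Y: "Y \<in> F 1" using tx ty by (auto simp: X_def Y_def)
    \<comment> \<open>The logarithmic derivative of \<open>W\<close>, found by moving
      \<open>y\<close> to the left past exp X.\<close>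
    define V where "V = x + op_series N (commutator X) (fps_exp 1) y"
    have "(W has_vector_derivative nexp X * (y * nexp Y) + x * nexp X * nexp Y) (at t)"
      unfolding W_def X_def Y_def
      by (rule has_vector_derivative_mult[OF nexp_scaled_derivative[OF x] nexp_scaled_derivative[OF y]])
    moreover have y0: "y \<in> F 0" using y antimono[of 0 1] by auto
    have "nexp X * (y * nexp Y) + x * nexp X * nexp Y = V * W t"
      using nexp_mult_eq[OF X y0] unfolding V_def W_def X_def[symmetric] Y_def[symmetric]
      by (simp add: algebra_simps flip: mult.assoc)
    ultimately have dW: "(W has_vector_derivative V * W t) (at t)" by simp
    have Wt0: "W t \<in> F 0"
      using mult[OF nexp_mem[OF X] nexp_mem[OF Y]] by (simp add: W_def X_def Y_def)
    have op_series_mem0: "op_series N (commutator u) f M \<in> F i" if "u \<in> F 1" "M \<in> F i" for u f M i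
      unfolding op_series_def
    proof (intro subspace_sum[OF subspace] subspace_scale[OF subspace])
      fix k show "(commutator u ^^ k) M \<in> F i"
        using commutator_pow_mem[OF that, of k] antimono[of i "k + i"] by auto
    qed
    have V1: "V \<in> F 1"
      unfolding V_def using x op_series_mem0[OF X y] subspace_add[OF subspace] by blast
    have "V * W t \<in> F 1" using mult[OF V1 Wt0] by simp
    then obtain Z' where Z': "(Z has_vector_derivative Z') (at t)" "Z' \<in> F 1"
      using nlog_derivative[OF dW W1] unfolding Z_def by blast
    have "(W has_vector_derivative op_series N (commutator (Z t)) fps_phi Z' * W t) (at t)"
      using nexp_derivative[OF Z'(1) Z1 Z'(2)] by (simp add: expZ)
    then have "V * W t = op_series N (commutator (Z t)) fps_phi Z' * W t"
      using dW vector_derivative_unique_at by blast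
    moreover have "W t * nexp (- Z t) = 1"
      using nexp_inverse'[OF Z1] by (simp add: expZ)
    then have cancel: "A = B" if "A * W t = B * W t" for A B
      using arg_cong[OF that, of "\<lambda>u. u * nexp (- Z t)"] by (simp add: mult.assoc)
    ultimately have V: "V = op_series N (commutator (Z t)) fps_phi Z'"
      by blast
    \<comment> \<open>Conjugation by \<open>W t = nexp (Z t)\<close>, computed in two ways,
      identifies \<open>T\<close> with exp (ad Z) - 1.\<close>
    define T where "T M = op_series N (commutator X) (fps_exp 1) (op_series N (commutator Y) (fps_exp 1) M) - M" for M
    have T_Z: "T M = op_series N (commutator (Z t)) (fps_exp 1 - 1) M" if "M \<in> F 0" for M
    proof -
      have "W t * M = op_series N (commutator X) (fps_exp 1) (op_series N (commutator Y) (fps_exp 1) M) * W t"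
        using nexp_mult_eq[OF Y that] nexp_mult_eq[OF X op_series_mem0[OF Y that, of "fps_exp 1"]]
        unfolding W_def X_def[symmetric] Y_def[symmetric] by (simp add: mult.assoc) (simp flip: mult.assoc)
      moreover have "W t * M = op_series N (commutator (Z t)) (fps_exp 1) M * W t"
        using nexp_mult_eq[OF Z1 that, of t] by (simp add: expZ)
      ultimately have "op_series N (commutator X) (fps_exp 1) (op_series N (commutator Y) (fps_exp 1) M) = op_series N (commutator (Z t)) (fps_exp 1) M"
        using cancel by simp
      then show ?thesis
        unfolding T_def by (simp add: op_series_diff[OF linear_commutator] op_series_one[OF linear_commutator])
    qed
    have V0: "V \<in> F 0" using V1 antimono[of 0 1] by auto
    have nilZ: "(commutator (Z t) ^^ Suc N) M = 0" if "M \<in> F 0" for M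
      by (rule commutator_nil[OF Z1 that]) simp
    have Tpow: "(T ^^ k) V = op_series N (commutator (Z t)) ((fps_exp 1 - 1) ^ k * fps_phi) Z'" for k
    proof -
      have "(T ^^ k) V = (op_series N (commutator (Z t)) (fps_exp 1 - 1) ^^ k) V \<and> (T ^^ k) V \<in> F 0"
        by (induction k) (auto simp: V0 T_Z intro: op_series_mem0[OF Z1])
      then have "(T ^^ k) V = op_series N (commutator (Z t)) ((fps_exp 1 - 1) ^ k) V"
        by (simp add: op_series_power[OF linear_commutator nilZ[OF V0]])
      then show ?thesis
        using Z'(2) antimono[of 0 1] by (auto simp: V op_series_mult[OF linear_commutator nilZ])
    qed
    \<comment> \<open>The series ln (1 + u) / u in u = \<open>T\<close> undoes
      \<open>fps_phi\<close>, and only \<open>Z'\<close> is left.\<close>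
    have "(\<Sum>k=1..N. ((-1) ^ (k - 1) / k) *\<^sub>R (T ^^ (k - 1)) V) =
        op_series N (commutator (Z t)) (\<Sum>k=1..N. fps_const ((-1) ^ (k - 1) / k) * ((fps_exp 1 - 1) ^ (k - 1) * fps_phi)) Z'"
      by (simp add: Tpow op_series_sum[OF linear_commutator] op_series_scale[OF linear_commutator])
    also have "\<dots> = op_series N (commutator (Z t)) 1 Z'"
    proof (rule op_series_cong[OF linear_commutator])
      fix k assume "k \<le> N"
      \<comment> \<open>At \<open>k = N\<close> the truncated coefficient may be wrong, but there
        \<open>N\<close> commutators with \<open>Z t\<close> already kill \<open>Z'\<close>.\<close>
      show "(commutator (Z t) ^^ k) Z' = 0 \<or> fps_nth (\<Sum>k=1..N. fps_const ((-1) ^ (k - 1) / k) *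
          ((fps_exp 1 - 1) ^ (k - 1) * fps_phi)) k = fps_nth 1 k"
        using fps_log_phi[of k] commutator_nil[OF Z1 Z'(2), of k t] \<open>k \<le> N\<close> by (cases "k = N") auto
    qed
    finally have "Z' = (\<Sum>k=1..N. ((-1) ^ (k - 1) / k) *\<^sub>R (T ^^ (k - 1)) V)"
      by (simp add: op_series_one[OF linear_commutator])
    also have "\<dots> = (\<Sum>k=1..N. \<Sum>ps | set ps \<subseteq> pairs \<and> length ps = k.
        ((-1) ^ (length ps - 1) / length ps * (t ^ (weight ps - 1) / fact_prod ps)) *\<^sub>R nested_commutator (word x y ps))"
    proof (rule sum.cong)
      fix k assume "k \<in> {1..N}"
      then have k: "Suc (k - 1) = k" by auto
      have "(T ^^ (k - 1)) V = (\<Sum>ps | set ps \<subseteq> pairs \<and> length ps = k.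
        (t ^ (weight ps - 1) / fact_prod ps) *\<^sub>R nested_commutator (word x y ps))"
        unfolding V_def X_def using pow_single_block[OF x y, of T t "k - 1"] unfolding k
        by (simp add: T_def X_def Y_def op_series_exp_pairs)
      then show "((-1) ^ (k - 1) / k) *\<^sub>R (T ^^ (k - 1)) V = (\<Sum>ps | set ps \<subseteq> pairs \<and> length ps = k.
        ((-1) ^ (length ps - 1) / length ps * (t ^ (weight ps - 1) / fact_prod ps)) *\<^sub>R nested_commutator (word x y ps))"
        by (simp add: scaleR_sum_right)
    qed auto
    also have "\<dots> = (\<Sum>ps\<in>(\<Union>k\<in>{1..N}. {ps. set ps \<subseteq> pairs \<and> length ps = k}).
        ((-1) ^ (length ps - 1) / length ps * (t ^ (weight ps - 1) / fact_prod ps)) *\<^sub>R nested_commutator (word x y ps))"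
      by (rule sum.UNION_disjoint[symmetric]) (auto simp: finite_lists_pairs)
    \<comment> \<open>Words of weight above \<open>N\<close> have vanishing bracket; all others have
      at most \<open>N\<close> blocks, as every block has positive weight.\<close>
    also have "\<dots> = (\<Sum>ps\<in>dynkin_words N.
        ((-1) ^ (length ps - 1) / length ps * (t ^ (weight ps - 1) / fact_prod ps)) *\<^sub>R nested_commutator (word x y ps))"
    proof (rule sum.mono_neutral_right)
      show "dynkin_words N \<subseteq> (\<Union>k\<in>{1..N}. {ps. set ps \<subseteq> pairs \<and> length ps = k})"
        unfolding dynkin_words_sub using length_le_weight by (fastforce simp: Suc_le_eq)
      show "\<forall>ps\<in>(\<Union>k\<in>{1..N}. {ps. set ps \<subseteq> pairs \<and> length ps = k}) - dynkin_words N.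
        ((-1) ^ (length ps - 1) / length ps * (t ^ (weight ps - 1) / fact_prod ps)) *\<^sub>R nested_commutator (word x y ps) = 0"
      proof
        fix ps assume "ps \<in> (\<Union>k\<in>{1..N}. {ps. set ps \<subseteq> pairs \<and> length ps = k}) - dynkin_words N"
        then have ps: "set ps \<subseteq> pairs" "ps \<noteq> []" "weight ps > N"
          unfolding dynkin_words_sub by auto
        then have "nested_commutator (word x y ps) = 0"
          using nested_commutator_word_mem[OF x y, of ps] zero by (auto simp: pairs_def)
        then show "((-1) ^ (length ps - 1) / length ps * (t ^ (weight ps - 1) / fact_prod ps)) *\<^sub>R
            nested_commutator (word x y ps) = 0" by simp
      qed
    qed (auto simp: finite_lists_pairs)
    also have "\<dots> = z' t"
      unfolding z'_def
    proof (rule sum.cong)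
      fix ps assume "ps \<in> dynkin_words N"
      then have "weight ps > 0"
        using length_le_weight[of ps] unfolding dynkin_words_sub by (cases ps) auto
      moreover have cancel: "w > 0 \<Longrightarrow> a / l * (p / f) = a / l / (w * f) * (w * p)" for a l p f w :: real
        by simp
      ultimately show "((-1) ^ (length ps - 1) / length ps * (t ^ (weight ps - 1) / fact_prod ps)) *\<^sub>R nested_commutator (word x y ps) =
          dynkin_coeff ps *\<^sub>R (weight ps * t ^ (weight ps - 1)) *\<^sub>R nested_commutator (word x y ps)"
        using cancel[of "real (weight ps)"] by (simp only: dynkin_coeff_def scaleR_scaleR of_nat_0_less_iff of_nat_eq_0_iff)
    qed auto
    finally show ?thesis using Z'(1) by simp
  qed
  have "((\<lambda>t. Z t - z t) has_vector_derivative 0) (at t within UNIV)" for t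
    using has_vector_derivative_diff[OF dZ dz] by simp
  then obtain c where c: "Z t - z t = c" for t
    using has_vector_derivative_zero_constant[of UNIV "\<lambda>t. Z t - z t"] by auto
  have nexp0: "nexp 0 = 1"
    using nexp_minus_one_mem nexp_inverse[of 0] subspace_0[OF subspace] 
    by (simp add: nexp_def power_0_left if_distrib cong: if_cong)
  have "Z 0 = 0" by (auto simp: Z_def W_def nexp0 nlog_def power_0_left intro!: sum.neutral)
  moreover have "z 0 = 0"
    unfolding z_def
  proof (rule sum.neutral, rule ballI)
    fix ps assume "ps \<in> dynkin_words N"
    then have "weight ps > 0"
      using length_le_weight[of ps] unfolding dynkin_words_sub by (cases ps) auto
    then show "dynkin_coeff ps *\<^sub>R 0 ^ weight ps *\<^sub>R nested_commutator (word x y ps) = 0" by simp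
  qed
  ultimately have "Z 1 = z 1" using c[of 0] c[of 1] by simp
  moreover have "z 1 = dynkin x y" by (simp add: z_def dynkin_def)
  ultimately show ?thesis using expZ[of 1] by (simp add: W_def)
qed

end

subsection \<open>Square matrices\<close>

text \<open>A type of its own, so that \<open>*\<close> is the matrix product and \<open>1\<close>
  the identity matrix, as the filtration locale requires.\<close>

typedef 'k sqmat = "UNIV :: ('k \<Rightarrow> 'k \<Rightarrow> real) set"
  morphisms entry Mat ..

declare Mat_inverse [simplified, simp]

lemma sqmat_eq_iff: "A = B \<longleftrightarrow> (\<forall>p q. entry A p q = entry B p q)"
  by (metis entry_inject ext)

instantiation sqmat :: (finite) real_algebra_1
begin

definition "0 = Mat (\<lambda>p q. 0)"
definition "1 = Mat (\<lambda>p q. if p = q then 1 else 0)"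
definition "A + B = Mat (\<lambda>p q. entry A p q + entry B p q)"
definition "A - B = Mat (\<lambda>p q. entry A p q - entry B p q)"
definition "- A = Mat (\<lambda>p q. - entry A p q)"
definition "c *\<^sub>R A = Mat (\<lambda>p q. c * entry A p q)"
definition "A * B = Mat (\<lambda>p q. \<Sum>k\<in>UNIV. entry A p k * entry B k q)"

lemma entry_simps [simp]:
  "entry 0 p q = 0"
  "entry (A + B) p q = entry A p q + entry B p q"
  "entry (A - B) p q = entry A p q - entry B p q"
  "entry (- A) p q = - entry A p q"
  "entry (c *\<^sub>R A) p q = c * entry A p q"
  by (auto simp: zero_sqmat_def plus_sqmat_def minus_sqmat_def uminus_sqmat_def scaleR_sqmat_def)

lemma entry_one: "entry 1 p q = (if p = q then 1 else 0)"
  by (simp add: one_sqmat_def)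

lemma entry_mult: "entry (A * B) p q = (\<Sum>k\<in>UNIV. entry A p k * entry B k q)"
  by (simp add: times_sqmat_def)

instance
proof
  fix A B C :: "'a sqmat"
  show "A * B * C = A * (B * C)"
    unfolding sqmat_eq_iff entry_mult sum_distrib_left sum_distrib_right
    by (subst sum.swap) (simp add: mult.assoc)
  show "(0::'a sqmat) \<noteq> 1"
    by (auto simp: sqmat_eq_iff entry_one)
qed (auto simp: sqmat_eq_iff entry_one entry_mult algebra_simps sum.distrib sum_distrib_left
     if_distrib[of "\<lambda>x. x * _"] if_distrib[of "\<lambda>x. _ * x"] cong: if_cong)

end

instantiation sqmat :: (finite) real_normed_algebra
begin

definition "norm A = (\<Sum>p\<in>UNIV. \<Sum>q\<in>UNIV. \<bar>entry A p q\<bar>)"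
definition "dist (A :: 'a sqmat) B = norm (A - B)"
definition "sgn (A :: 'a sqmat) = A /\<^sub>R norm A"
definition "(uniformity :: ('a sqmat \<times> 'a sqmat) filter) = (INF e\<in>{0<..}. principal {(A, B). dist A B < e})"
definition "open (U :: 'a sqmat set) \<longleftrightarrow> (\<forall>A\<in>U. eventually (\<lambda>(A', B). A' = A \<longrightarrow> B \<in> U) uniformity)"

instance
proof
  fix A B :: "'a sqmat" and r :: real
  show "norm A = 0 \<longleftrightarrow> A = 0"
    by (simp add: norm_sqmat_def sqmat_eq_iff sum_nonneg_eq_0_iff sum_nonneg)
  show "norm (A + B) \<le> norm A + norm B"
    by (auto simp: norm_sqmat_def intro!: sum_mono simp flip: sum.distrib)
  show "norm (r *\<^sub>R A) = \<bar>r\<bar> * norm A"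
    by (simp add: norm_sqmat_def abs_mult sum_distrib_left)
  have "norm (A * B) \<le> (\<Sum>p\<in>UNIV. \<Sum>q\<in>UNIV. \<Sum>k\<in>UNIV. \<bar>entry A p k\<bar> * \<bar>entry B k q\<bar>)"
    unfolding norm_sqmat_def entry_mult
    by (intro sum_mono order.trans[OF sum_abs]) (simp add: abs_mult)
  also have "\<dots> = (\<Sum>p\<in>UNIV. \<Sum>k\<in>UNIV. \<bar>entry A p k\<bar> * (\<Sum>q\<in>UNIV. \<bar>entry B k q\<bar>))"
  proof (rule sum.cong[OF refl])
    fix p
    show "(\<Sum>q\<in>UNIV. \<Sum>k\<in>UNIV. \<bar>entry A p k\<bar> * \<bar>entry B k q\<bar>) =
        (\<Sum>k\<in>UNIV. \<bar>entry A p k\<bar> * (\<Sum>q\<in>UNIV. \<bar>entry B k q\<bar>))"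
      by (subst sum.swap) (simp add: sum_distrib_left)
  qed
  also have "\<dots> \<le> (\<Sum>p\<in>UNIV. \<Sum>k\<in>UNIV. \<bar>entry A p k\<bar> * norm B)"
    unfolding norm_sqmat_def
    by (intro sum_mono mult_left_mono member_le_sum) (auto intro: sum_nonneg)
  also have "\<dots> = norm A * norm B"
    by (simp add: norm_sqmat_def sum_distrib_right)
  finally show "norm (A * B) \<le> norm A * norm B" .
qed (simp_all add: dist_sqmat_def sgn_sqmat_def uniformity_sqmat_def open_sqmat_def)

end

lemma bounded_linear_entry: "bounded_linear (\<lambda>A. entry A p q)" for p q :: "'k::finite"
proof (rule bounded_linear_intro[of _ 1])
  fix A :: "'k sqmat"
  have "\<bar>entry A p q\<bar> \<le> (\<Sum>q\<in>UNIV. \<bar>entry A p q\<bar>)" by (rule member_le_sum) auto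
  also have "\<dots> \<le> norm A" unfolding norm_sqmat_def
    by (rule member_le_sum[of p UNIV "\<lambda>p. \<Sum>q\<in>UNIV. \<bar>entry A p q\<bar>"]) (auto intro: sum_nonneg)
  finally show "norm (entry A p q) \<le> norm A * 1" by simp
qed auto

lemma entry_sum: "entry (sum f S) p q = (\<Sum>x\<in>S. entry (f x) p q)" for p q :: "'k::finite"
  using linear_sum[OF bounded_linear.linear[OF bounded_linear_entry]] .

subsection \<open>A faithful representation\<close>

lemma idx_less_iff: "idx i < idx j \<longleftrightarrow> i < j" for i j :: "'n::{finite,linorder}"
proof -
  have "idx i < idx j" if "i < j" for i j :: 'n
    unfolding idx_def using that by (intro psubset_card_mono psubsetI) (auto simp: set_eq_iff not_le intro!: exI[of _ j])
  then show ?thesis by (metis less_asym less_linear)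
qed

lemma inj_idx: "inj (idx :: 'n::{finite,linorder} \<Rightarrow> nat)"
  by (metis injI idx_less_iff less_irrefl neqE)

lemma idx_eq_iff: "idx i = idx j \<longleftrightarrow> i = j" for i j :: "'n::{finite,linorder}"
  using inj_idx by (auto dest: injD)

lemma idx_pos: "idx i > 0" for i :: "'n::{finite,linorder}"
  unfolding idx_def by (rule card_gt_0_iff[THEN iffD2]) auto

lemma range_idx: "range (idx :: 'n::{finite,linorder} \<Rightarrow> nat) = {1..CARD('n)}"
proof (rule card_subset_eq)
  have "idx i \<le> CARD('n)" for i :: 'n
    unfolding idx_def by (rule card_mono) auto
  then show "range (idx :: 'n \<Rightarrow> nat) \<subseteq> {1..CARD('n)}"
    using idx_pos by (auto simp: Suc_le_eq)
qed (auto simp: card_image[OF inj_idx])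

lemma idx_le: "idx i \<le> CARD('n)" for i :: "'n::{finite,linorder}"
  using range_idx[where 'n='n] by (metis atLeastAtMost_iff rangeI)

lemma sum_idx: "(\<Sum>i\<in>UNIV. f (idx (i::'n::{finite,linorder}))) = (\<Sum>a=1..CARD('n). f a)"
  by (rule sum.reindex_bij_betw) (simp add: bij_betw_def inj_idx range_idx)

text \<open>Indexing by all natural numbers, with value 0 outside 1, ..., n, lets brackets be
  written as sums over splittings of a number.\<close>

definition coord :: "('n::{finite,linorder}) rvec \<Rightarrow> nat \<Rightarrow> real"
  where "coord x k = (\<Sum>i\<in>UNIV. if idx i = k then x $ i else 0)"

lemma coord_idx [simp]: "coord x (idx i) = x $ i"
  by (simp add: coord_def idx_eq_iff)

lemma coord_0: "coord (x :: ('n::{finite,linorder}) rvec) k = 0" if "k = 0 \<or> k > CARD('n)"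
proof -
  have "idx i \<noteq> k" for i :: 'n using that idx_pos[of i] idx_le[of i] by auto
  then show ?thesis by (simp add: coord_def)
qed

lemma linear_coord: "linear (\<lambda>x. coord x k)"
  by (rule linearI) (auto simp: coord_def sum_distrib_left simp flip: sum.distrib intro!: sum.cong)

text \<open>The bound on \<open>k\<close> is essential: above n the bracket is cut off while the sum
  goes on. Its value at k = n + 1 is what becomes \<open>Omega\<close>.\<close>

lemma coord_lie:
  fixes x y :: "('n::{finite,linorder}) rvec"
  assumes "k \<le> CARD('n)"
  shows "coord (lie x y) k = (\<Sum>a=1..<k. (real (k - a) - real a) * coord x a * coord y (k - a))"
proof (cases "k = 0")
  case False
  then have "k \<in> range (idx :: 'n \<Rightarrow> nat)" using assms by (auto simp: range_idx)
  then obtain l :: 'n where l: "k = idx l" by auto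
  let ?g = "\<lambda>a b. (real b - real a) * coord x a * coord y b"
  have "coord (lie x y) k = (\<Sum>i\<in>(UNIV::'n set). \<Sum>j\<in>(UNIV::'n set). if idx i + idx j = k then ?g (idx i) (idx j) else 0)"
    unfolding l by (simp add: lie_def cong: if_cong)
  also have "\<dots> = (\<Sum>a=1..CARD('n). \<Sum>b=1..CARD('n). if a + b = k then ?g a b else 0)"
    unfolding sum_idx[of "\<lambda>b. if _ + b = k then ?g _ b else 0", where 'n='n]
    by (rule sum_idx)
  also have "\<dots> = (\<Sum>a=1..CARD('n). if a < k then ?g a (k - a) else 0)"
  proof (rule sum.cong)
    fix a assume "a \<in> {1..CARD('n)}"
    have "(\<Sum>b=1..CARD('n). if a + b = k then ?g a b else 0) =
        (\<Sum>b=1..CARD('n). if b = k - a then (if a < k then ?g a b else 0) else 0)"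
      by (rule sum.cong) auto
    also have "\<dots> = (if a < k then ?g a (k - a) else 0)"
      using assms by auto
    finally show "(\<Sum>b=1..CARD('n). if a + b = k then ?g a b else 0) = (if a < k then ?g a (k - a) else 0)" .
  qed auto
  also have "\<dots> = (\<Sum>a=1..<k. ?g a (k - a))"
    using assms by (intro sum.mono_neutral_cong_right) auto
  finally show ?thesis .
qed (simp add: coord_0)

text \<open>\<open>None\<close> indexes the extra basis vector \<open>f_0\<close>, and
  \<open>Some i\<close> the vector \<open>f_k\<close> with \<open>k = idx i\<close>.\<close>

definition lev :: "'n::{finite,linorder} option \<Rightarrow> nat"
  where "lev p = (case p of None \<Rightarrow> 0 | Some i \<Rightarrow> idx i)"

lemma lev_simps [simp]: "lev None = 0" "lev (Some i) = idx i"
  by (auto simp: lev_def)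

lemma lev_le: "lev (p :: 'n::{finite,linorder} option) \<le> CARD('n)"
  by (cases p) (auto simp: idx_le)

lemma bij_lev: "bij_betw (lev :: 'n::{finite,linorder} option \<Rightarrow> nat) UNIV {..CARD('n)}"
proof -
  have "inj (lev :: 'n option \<Rightarrow> nat)"
    using idx_pos by (auto simp: lev_def inj_def idx_eq_iff split: option.splits)
  moreover have "range (lev :: 'n option \<Rightarrow> nat) = {..CARD('n)}"
    using range_idx[where 'n='n] by (auto simp: UNIV_option_conv image_image)
  ultimately show ?thesis by (simp add: bij_betw_def)
qed

lemma sum_lev: "(\<Sum>p\<in>UNIV. f (lev (p::'n::{finite,linorder} option))) = (\<Sum>c\<le>CARD('n). f c)"
  using sum.reindex_bij_betw[OF bij_lev, of f] .

text \<open>The action \<open>e\<^sub>i f\<^sub>j = (j - 1) f\<^sub>i\<^sub>+\<^sub>j\<close> on \<open>f\<^sub>0, \<dots>, f\<^sub>n\<close>. Matrices act on row vectors, which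
  reverses products and is compensated by the sign \<open>1 - j\<close>. The coordinates of \<open>x\<close> form row 0.\<close>

definition rho :: "('n::{finite,linorder}) rvec \<Rightarrow> 'n option sqmat"
  where "rho x = Mat (\<lambda>p q. if lev p < lev q then (1 - real (lev p)) * coord x (lev q - lev p) else 0)"

lemma entry_rho: "entry (rho x) p q = (if lev p < lev q then (1 - real (lev p)) * coord x (lev q - lev p) else 0)"
  by (simp add: rho_def)

lemma entry_rho_None: "entry (rho x) None (Some i) = x $ i"
  by (simp add: entry_rho idx_pos)

lemma linear_rho: "linear rho"
  by (rule linearI) (auto simp: sqmat_eq_iff entry_rho linear_add[OF linear_coord] linear_scale[OF linear_coord] algebra_simps)

lemma inj_rho: "inj rho"
  by (rule injI) (metis entry_rho_None vec_eq_iff)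

lemma sum_reflect: "(\<Sum>a=1..<k. f a (k - a)) = (\<Sum>a=1..<k. f (k - a) a)" for f :: "nat \<Rightarrow> nat \<Rightarrow> 'a::comm_monoid_add"
  by (rule sum.reindex_bij_witness[of _ "\<lambda>a. k - a" "\<lambda>a. k - a"]) auto

text \<open>After reflecting a to k - a in one of the two products, the coefficients differ by (1 -
  P - a) - (1 - P - (k - a)) = (k - a) - a, the structure constant; the common factor 1 - P is that
  of \<open>rho\<close>.\<close>

lemma rho_lie: "rho (lie x y) = commutator (rho x) (rho y)" for x y :: "('n::{finite,linorder}) rvec"
proof (unfold sqmat_eq_iff, intro allI)
  fix p q :: "'n option"
  define P Q k where "P = lev p" and "Q = lev q" and "k = Q - P"
  have Q: "Q \<le> CARD('n)" unfolding Q_def by (rule lev_le)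
  have prod: "entry (rho x * rho y) p q = (1 - real P) * (\<Sum>a=1..<k. (1 - real P - real a) * coord x a * coord y (k - a))"
    for x y :: "'n rvec"
  proof -
    let ?h = "\<lambda>c. if P < c \<and> c < Q then (1 - real P) * coord x (c - P) * ((1 - real c) * coord y (Q - c)) else 0"
    have "entry (rho x * rho y) p q = (\<Sum>r\<in>UNIV. ?h (lev (r::'n option)))"
      unfolding entry_mult entry_rho by (rule sum.cong) (auto simp: P_def Q_def)
    also have "\<dots> = (\<Sum>c\<le>CARD('n). ?h c)" by (rule sum_lev)
    also have "\<dots> = (\<Sum>c\<in>{P<..<Q}. (1 - real P) * coord x (c - P) * ((1 - real c) * coord y (Q - c)))"
      using Q by (intro sum.mono_neutral_cong_right) auto
    also have "\<dots> = (\<Sum>a=1..<k. (1 - real P) * coord x a * ((1 - real P - real a) * coord y (k - a)))"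
      by (rule sum.reindex_bij_witness[of _ "\<lambda>a. a + P" "\<lambda>c. c - P"]) (auto simp: k_def)
    finally show ?thesis by (simp add: sum_distrib_left mult_ac)
  qed
  have "entry (commutator (rho x) (rho y)) p q = (1 - real P) *
     ((\<Sum>a=1..<k. (1 - real P - real a) * coord x a * coord y (k - a)) -
      (\<Sum>a=1..<k. (1 - real P - real a) * coord y a * coord x (k - a)))"
    by (simp add: commutator_def prod algebra_simps)
  also have "(\<Sum>a=1..<k. (1 - real P - real a) * coord y a * coord x (k - a)) =
      (\<Sum>a=1..<k. (1 - real P - real (k - a)) * coord y (k - a) * coord x a)"
    by (rule sum_reflect)
  also have "(\<Sum>a=1..<k. (1 - real P - real a) * coord x a * coord y (k - a)) - \<dots> =
      (\<Sum>a=1..<k. (real (k - a) - real a) * coord x a * coord y (k - a))"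
    by (simp add: algebra_simps flip: sum_subtractf)
  also have "\<dots> = coord (lie x y) k"
    by (rule coord_lie[symmetric]) (use Q in \<open>simp add: k_def\<close>)
  finally show "entry (rho (lie x y)) p q = entry (commutator (rho x) (rho y)) p q"
    by (auto simp: entry_rho P_def Q_def k_def coord_0)
qed

definition Fil :: "nat \<Rightarrow> 'n::{finite,linorder} option sqmat set"
  where "Fil d = {A. \<forall>p q. lev q < lev p + d \<longrightarrow> entry A p q = 0}"

global_interpretation nf: nilpotent_filtration "Fil :: nat \<Rightarrow> 'n::{finite,linorder} option sqmat set" "CARD('n)"
proof
  fix i j :: nat and x y :: "'n option sqmat"
  show "subspace (Fil i :: 'n option sqmat set)"
    by (auto simp: subspace_def Fil_def)
  show "(1 :: 'n option sqmat) \<in> Fil 0"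
    by (auto simp: Fil_def entry_one)
  show "i \<le> j \<Longrightarrow> (Fil j :: 'n option sqmat set) \<subseteq> Fil i"
    by (auto simp: Fil_def)
  have "lev q < lev p + Suc CARD('n)" for p q :: "'n option"
    using lev_le[of q] by simp
  then show "(Fil (Suc CARD('n)) :: 'n option sqmat set) = {0}"
    by (auto simp: Fil_def sqmat_eq_iff)
  show "x * y \<in> Fil (i + j)" if "x \<in> Fil i" "y \<in> Fil j"
    unfolding Fil_def mem_Collect_eq entry_mult
  proof (intro allI impI sum.neutral ballI)
    fix p q k :: "'n option" assume "lev q < lev p + (i + j)"
    then have "lev k < lev p + i \<or> lev q < lev k + j" by linarith
    then show "entry x p k * entry y k q = 0"
      using that by (auto simp: Fil_def)
  qed
qed simp

lemma rho_mem: "rho x \<in> Fil 1"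
  by (auto simp: Fil_def entry_rho)

section \<open>The group law transported from matrices\<close>

definition Exp :: "('n::{finite,linorder}) rvec \<Rightarrow> 'n option sqmat"
  where "Exp x = nf.nexp (rho x)"

lemma rho_nested: "rho (nested_lie vs) = nested_commutator (map rho vs)"
  by (induction vs rule: nested_lie.induct) (auto simp: rho_lie linear_0[OF linear_rho])

lemma rho_bch: "rho (bch x y) = nf.dynkin (rho x) (rho y)"
proof -
  have "map rho (word x y ps) = word (rho x) (rho y) ps" for ps
    by (induction ps) auto
  then show ?thesis
    by (simp add: bch_def nf.dynkin_def linear_sum[OF linear_rho] linear_scale[OF linear_rho] rho_nested)
qed

lemma Exp_bch: "Exp (bch x y) = Exp x * Exp y"
  by (simp add: Exp_def rho_bch nf.nexp_dynkin[OF rho_mem rho_mem])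

lemma inj_Exp: "inj Exp"
proof (rule injI)
  fix x y :: "'a rvec" assume "Exp x = Exp y"
  then have "rho x = rho y" unfolding Exp_def by (metis nf.nlog_nexp[OF rho_mem])
  then show "x = y" by (rule injD[OF inj_rho])
qed

lemma Exp_0: "Exp 0 = 1"
  by (simp add: Exp_def linear_0[OF linear_rho] nf.nexp_def power_0_left if_distrib cong: if_cong)

lemma Exp_minus: "Exp (- x) * Exp x = 1" "Exp x * Exp (- x) = 1"
  using nf.nexp_inverse[OF rho_mem, of x] nf.nexp_inverse'[OF rho_mem, of x]
  by (auto simp: Exp_def linear_neg[OF linear_rho])

lemma bch_assoc: "bch (bch x y) z = bch x (bch y z)"
  by (rule injD[OF inj_Exp]) (simp add: Exp_bch mult.assoc)

lemma bch_0_left [simp]: "bch 0 x = x" and bch_0_right [simp]: "bch x 0 = x"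
  by (auto intro!: injD[OF inj_Exp] simp: Exp_bch Exp_0)

lemma bch_minus_left [simp]: "bch (- x) x = 0" and bch_minus_right [simp]: "bch x (- x) = 0"
  by (auto intro!: injD[OF inj_Exp] simp: Exp_bch Exp_0 Exp_minus)

subsection \<open>Smoothness of polynomial functions\<close>

lemma has_derivative_frechet: "f differentiable at x \<Longrightarrow> (f has_derivative frechet_derivative f (at x)) (at x)"
  using frechet_derivative_works by blast

lemma frechet_derivative_eq: "(f has_derivative f') (at x) \<Longrightarrow> frechet_derivative f (at x) = f'"
  by (rule frechet_derivative_at[symmetric])

lemmas real_polynomial_differentiable = differentiable_at_real_polynomial_function[where S=UNIV]

lemma frechet_linear: "bounded_linear f \<Longrightarrow> frechet_derivative f (at x) = f"
  by (rule frechet_derivative_eq) (rule bounded_linear_imp_has_derivative)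

lemma frechet_add:
  "f differentiable at x \<Longrightarrow> g differentiable at x \<Longrightarrow>
   frechet_derivative (\<lambda>x. f x + g x) (at x) = (\<lambda>v. frechet_derivative f (at x) v + frechet_derivative g (at x) v)"
  by (rule frechet_derivative_eq) (intro has_derivative_add has_derivative_frechet)

lemma frechet_mult:
  fixes f g :: "'a::real_normed_vector \<Rightarrow> real"
  shows "f differentiable at x \<Longrightarrow> g differentiable at x \<Longrightarrow>
   frechet_derivative (\<lambda>x. f x * g x) (at x) = (\<lambda>v. f x * frechet_derivative g (at x) v + frechet_derivative f (at x) v * g x)"
  by (rule frechet_derivative_eq) (intro has_derivative_mult has_derivative_frechet)

text \<open>Left-invariant forms will have polynomial coefficients, because exponential and
  logarithm are finite sums. For polynomials, smoothness and symmetry of second derivatives go by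
  structural induction.\<close>

lemma real_polynomial_frechet:
  "real_polynomial_function f \<Longrightarrow> real_polynomial_function (\<lambda>x. frechet_derivative f (at x) v)"
proof (induction f rule: real_polynomial_function.induct)
  case (linear f)
  then show ?case by (auto simp: frechet_linear)
next
  case (const c)
  then show ?case by (auto simp: frechet_derivative_const)
next
  case (add f g)
  then show ?case by (auto simp: frechet_add real_polynomial_differentiable)
next
  case (mult f g)
  then show ?case by (auto simp: frechet_mult real_polynomial_differentiable)
qed

lemma frechet_symmetric:
  "real_polynomial_function f \<Longrightarrow>
   frechet_derivative (\<lambda>y. frechet_derivative f (at y) v) (at x) u =
   frechet_derivative (\<lambda>y. frechet_derivative f (at y) u) (at x) v"
proof (induction f rule: real_polynomial_function.induct)
  case (linear f)
  then show ?case by (simp add: frechet_linear frechet_derivative_const)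
next
  case (const c)
  then show ?case by (simp add: frechet_derivative_const)
next
  case (add f g)
  then show ?case by (simp add: frechet_add real_polynomial_differentiable real_polynomial_frechet)
next
  case (mult f g)
  note [simp] = mult.hyps[THEN real_polynomial_differentiable]
    mult.hyps[THEN real_polynomial_frechet, THEN real_polynomial_differentiable]
  show ?case by (simp add: frechet_mult frechet_add mult.IH)
qed

lemma C_k_polynomial: "real_polynomial_function f \<Longrightarrow> C_k k f"
proof (induction k arbitrary: f)
  case 0
  then show ?case
    by (auto simp: continuous_on_eq_continuous_at differentiable_imp_continuous_within real_polynomial_differentiable)
next
  case (Suc k)
  then show ?case
    by (auto simp: differentiable_on_def real_polynomial_differentiable intro: real_polynomial_frechet)
qed

lemma smooth_polynomial: "real_polynomial_function f \<Longrightarrow> smooth f"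
  by (simp add: smooth_def C_k_polynomial)

subsection \<open>The Maurer--Cartan form\<close>

lemma linear_frechet: "f differentiable at x \<Longrightarrow> linear (frechet_derivative f (at x))"
  using has_derivative_frechet has_derivative_linear by blast

lemma has_derivative_sqmat:
  fixes f :: "'a::real_normed_vector \<Rightarrow> 'k::finite sqmat"
  assumes "\<And>p q. ((\<lambda>x. entry (f x) p q) has_derivative (\<lambda>v. entry (f' v) p q)) (at x)"
  shows "(f has_derivative f') (at x)"
proof -
  define U where "U p q = Mat (\<lambda>r s. if r = p \<and> s = q then 1 else 0 :: real)" for p q :: 'k
  have expand: "A = (\<Sum>p\<in>UNIV. \<Sum>q\<in>UNIV. entry A p q *\<^sub>R U p q)" for A :: "'k sqmat"
  proof (unfold sqmat_eq_iff, intro allI)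
    fix r s
    have "(\<Sum>p\<in>UNIV. \<Sum>q\<in>UNIV. entry A p q * (if r = p \<and> s = q then 1 else 0)) =
       (\<Sum>p\<in>UNIV. if p = r then \<Sum>q\<in>UNIV. if q = s then entry A p q else 0 else 0)"
    proof (rule sum.cong[OF refl])
      fix p
      have "(\<Sum>q\<in>UNIV. entry A p q * (if r = p \<and> s = q then 1 else 0)) =
          (\<Sum>q\<in>UNIV. if q = s then (if p = r then entry A p q else 0) else 0)"
        by (rule sum.cong) auto
      then show "(\<Sum>q\<in>UNIV. entry A p q * (if r = p \<and> s = q then 1 else 0)) =
          (if p = r then \<Sum>q\<in>UNIV. if q = s then entry A p q else 0 else 0)" by simp
    qed
    then show "entry A r s = entry (\<Sum>p\<in>UNIV. \<Sum>q\<in>UNIV. entry A p q *\<^sub>R U p q) r s"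
      by (simp add: entry_sum U_def)
  qed
  have "((\<lambda>x. \<Sum>p\<in>UNIV. \<Sum>q\<in>UNIV. entry (f x) p q *\<^sub>R U p q) has_derivative
      (\<lambda>v. \<Sum>p\<in>UNIV. \<Sum>q\<in>UNIV. entry (f' v) p q *\<^sub>R U p q)) (at x)"
    by (intro has_derivative_sum has_derivative_scaleR_left assms)
  then show ?thesis by (simp flip: expand)
qed

lemma frechet_sqmat:
  fixes f :: "'a::real_normed_vector \<Rightarrow> 'k::finite sqmat"
  assumes "\<And>p q. (\<lambda>x. entry (f x) p q) differentiable at x"
  shows "f differentiable at x"
    and "entry (frechet_derivative f (at x) v) p q = frechet_derivative (\<lambda>x. entry (f x) p q) (at x) v"
proof -
  have *: "(f has_derivative (\<lambda>v. Mat (\<lambda>p q. frechet_derivative (\<lambda>x. entry (f x) p q) (at x) v))) (at x)"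
    by (rule has_derivative_sqmat) (auto intro: has_derivative_frechet assms)
  then show "f differentiable at x" by (auto simp: differentiable_def)
  show "entry (frechet_derivative f (at x) v) p q = frechet_derivative (\<lambda>x. entry (f x) p q) (at x) v"
    by (simp add: frechet_derivative_eq[OF *])
qed

definition poly_matrix :: "('a::real_normed_vector \<Rightarrow> 'k::finite sqmat) \<Rightarrow> bool"
  where "poly_matrix f \<longleftrightarrow> (\<forall>p q. real_polynomial_function (\<lambda>x. entry (f x) p q))"

lemma poly_matrix_mult: "poly_matrix f \<Longrightarrow> poly_matrix g \<Longrightarrow> poly_matrix (\<lambda>x. f x * g x)"
  by (auto simp: poly_matrix_def entry_mult intro!: real_polynomial_function_sum)

lemma poly_matrix_const: "poly_matrix (\<lambda>x. A)"
  by (auto simp: poly_matrix_def)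

lemma poly_matrix_power: "poly_matrix f \<Longrightarrow> poly_matrix (\<lambda>x. f x ^ k)"
  by (induction k) (auto intro: poly_matrix_mult poly_matrix_const)

lemma poly_matrix_sum: "finite I \<Longrightarrow> (\<And>i. i \<in> I \<Longrightarrow> poly_matrix (\<lambda>x. f x i)) \<Longrightarrow> poly_matrix (\<lambda>x. \<Sum>i\<in>I. f x i)"
  by (auto simp: poly_matrix_def entry_sum intro!: real_polynomial_function_sum)

lemma poly_matrix_scaleR: "poly_matrix f \<Longrightarrow> poly_matrix (\<lambda>x. c *\<^sub>R f x)"
  by (auto simp: poly_matrix_def)

lemma poly_matrix_diff: "poly_matrix f \<Longrightarrow> poly_matrix g \<Longrightarrow> poly_matrix (\<lambda>x. f x - g x)"
  by (auto simp: poly_matrix_def)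

lemma poly_matrix_differentiable: "poly_matrix f \<Longrightarrow> f differentiable at x"
  by (rule frechet_sqmat) (auto simp: poly_matrix_def real_polynomial_differentiable)

lemma entry_frechet:
  "poly_matrix f \<Longrightarrow> entry (frechet_derivative f (at x) v) p q = frechet_derivative (\<lambda>x. entry (f x) p q) (at x) v"
  by (rule frechet_sqmat) (auto simp: poly_matrix_def real_polynomial_differentiable)

lemma poly_matrix_frechet: "poly_matrix f \<Longrightarrow> poly_matrix (\<lambda>x. frechet_derivative f (at x) v)"
  by (auto simp: poly_matrix_def[of "\<lambda>x. frechet_derivative f (at x) v"] entry_frechet)
     (auto simp: poly_matrix_def intro: real_polynomial_frechet)

lemma poly_matrix_frechet_symmetric:
  assumes "poly_matrix f"
  shows "frechet_derivative (\<lambda>y. frechet_derivative f (at y) v) (at x) u =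
    frechet_derivative (\<lambda>y. frechet_derivative f (at y) u) (at x) v"
  using assms
  by (auto simp: sqmat_eq_iff entry_frechet[OF poly_matrix_frechet] entry_frechet)
     (auto simp: poly_matrix_def intro: frechet_symmetric)

lemma bounded_linear_rho: "bounded_linear rho"
  using linear_rho linear_conv_bounded_linear by blast

lemma poly_matrix_rho: "poly_matrix rho"
  unfolding poly_matrix_def
  using bounded_linear_compose[OF bounded_linear_entry bounded_linear_rho] by (auto simp: o_def)

lemma poly_matrix_Exp: "poly_matrix Exp"
  unfolding Exp_def nf.nexp_def
  by (intro poly_matrix_sum poly_matrix_scaleR poly_matrix_power poly_matrix_rho) auto

lemma poly_matrix_Exp_minus: "poly_matrix (\<lambda>x. Exp (- x))"
  unfolding Exp_def nf.nexp_def linear_neg[OF linear_rho]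
  by (intro poly_matrix_sum poly_matrix_scaleR poly_matrix_power)
     (use poly_matrix_scaleR[OF poly_matrix_rho, of "-1"] in auto)

abbreviation DExp :: "('n::{finite,linorder}) rvec \<Rightarrow> 'n rvec \<Rightarrow> 'n option sqmat"
  where "DExp x \<equiv> frechet_derivative Exp (at x)"

lemma has_derivative_Exp: "(Exp has_derivative DExp x) (at x)"
  by (intro has_derivative_frechet poly_matrix_differentiable poly_matrix_Exp)

lemma rho_bch_nlog: "rho (bch g x) = nf.nlog (Exp g * Exp x - 1)"
  unfolding Exp_bch[symmetric] by (simp add: Exp_def nf.nlog_nexp[OF rho_mem])

lemma bch_differentiable: "bch g differentiable at x"
proof -
  have "poly_matrix (\<lambda>x. rho (bch g x))"
    unfolding rho_bch_nlog nf.nlog_def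
    by (intro poly_matrix_sum poly_matrix_scaleR poly_matrix_power poly_matrix_diff poly_matrix_mult
      poly_matrix_const poly_matrix_Exp) auto
  then have "(\<lambda>x. bch g x $ i) differentiable at x" for i
    unfolding entry_rho_None[of "bch g _" i, symmetric]
    by (intro real_polynomial_differentiable) (simp add: poly_matrix_def)
  then show ?thesis
    by (subst differentiable_componentwise_within) (auto simp: Basis_vec_def inner_axis)
qed

lemma has_derivative_bch: "(bch g has_derivative frechet_derivative (bch g) (at x)) (at x)"
  by (intro has_derivative_frechet bch_differentiable)

lemma DExp_bch: "DExp (bch g x) (frechet_derivative (bch g) (at x) v) = Exp g * DExp x v"
proof -
  have "((\<lambda>y. Exp (bch g y)) has_derivative (\<lambda>v. DExp (bch g x) (frechet_derivative (bch g) (at x) v))) (at x)"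
    using diff_chain_at[OF has_derivative_bch has_derivative_Exp] by (simp add: o_def)
  moreover have "((\<lambda>y. Exp g * Exp y) has_derivative (\<lambda>v. Exp g * DExp x v)) (at x)"
    by (intro has_derivative_mult_right has_derivative_Exp)
  ultimately have "(\<lambda>v. DExp (bch g x) (frechet_derivative (bch g) (at x) v)) = (\<lambda>v. Exp g * DExp x v)"
    unfolding Exp_bch by (rule has_derivative_unique)
  from fun_cong[OF this, of v] show ?thesis .
qed

lemma DExp_0: "DExp 0 v = rho v" for v :: "('n::{finite,linorder}) rvec"
proof -
  have "((\<lambda>t. t *\<^sub>R v) has_derivative (\<lambda>t. t *\<^sub>R v)) (at (0::real))"
    by (intro bounded_linear_imp_has_derivative bounded_linear_scaleR_left)
  from diff_chain_at[OF this, of Exp "DExp 0"] 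
  have "((\<lambda>t. Exp (t *\<^sub>R v)) has_derivative (\<lambda>t. DExp 0 (t *\<^sub>R v))) (at (0::real))"
    using has_derivative_Exp[of 0] by (simp add: o_def)
  moreover have "((\<lambda>t. Exp (t *\<^sub>R v)) has_derivative (\<lambda>t. t *\<^sub>R (rho v))) (at (0::real))"
    using nf.nexp_scaled_derivative[OF rho_mem, of v 0] Exp_0[where 'a='n]
    by (simp add: Exp_def linear_scale[OF linear_rho] has_vector_derivative_def linear_0[OF linear_rho])
  ultimately have "(\<lambda>t. DExp 0 (t *\<^sub>R v)) = (\<lambda>t::real. t *\<^sub>R (rho v))"
    by (rule has_derivative_unique)
  from fun_cong[OF this, of 1] show ?thesis by simp
qed

text \<open>The left Maurer-Cartan form: its components are the coframe, and in matrices it is the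
  logarithmic derivative of \<open>Exp\<close>.\<close>

definition mc_form :: "('n::{finite,linorder}) rvec \<Rightarrow> 'n rvec \<Rightarrow> 'n rvec"
  where "mc_form x = frechet_derivative (bch (- x)) (at x)"

lemma rho_mc_form: "rho (mc_form x v) = Exp (- x) * DExp x v"
  using DExp_bch[of "- x" x v] by (simp add: mc_form_def DExp_0)

lemma linear_mc_form: "linear (mc_form x)"
  unfolding mc_form_def by (rule linear_frechet[OF bch_differentiable])

lemma mc_form_nth: "mc_form x v $ i = entry (Exp (- x) * DExp x v) None (Some i)"
  unfolding rho_mc_form[symmetric] entry_rho_None ..

lemma real_polynomial_mc_form: "real_polynomial_function (\<lambda>x. mc_form x v $ i)"
  using poly_matrix_mult[OF poly_matrix_Exp_minus poly_matrix_frechet[OF poly_matrix_Exp, of v]]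
  unfolding mc_form_nth by (simp add: poly_matrix_def)

lemma mc_form_bch: "mc_form (bch g x) (frechet_derivative (bch g) (at x) v) = mc_form x v"
proof (rule injD[OF inj_rho])
  have "Exp (- bch g x) * (Exp g * Exp x) * Exp (- x) = Exp (- x)"
    by (simp flip: Exp_bch)
  then have "Exp (- bch g x) * Exp g = Exp (- x)"
    by (simp add: mult.assoc Exp_minus)
  then show "rho (mc_form (bch g x) (frechet_derivative (bch g) (at x) v)) = rho (mc_form x v)"
    by (simp add: rho_mc_form DExp_bch flip: mult.assoc)
qed

text \<open>In matrices the form is A^(-1) dA. Second derivatives of A are symmetric and cancel, and
  d(A^(-1)) = - A^(-1) dA A^(-1) turns the rest into a commutator.\<close>

lemma maurer_cartan:
  "frechet_derivative (\<lambda>y. mc_form y v $ i) (at x) u - frechet_derivative (\<lambda>y. mc_form y u $ i) (at x) v =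
   - (lie (mc_form x u) (mc_form x v) $ i)"
proof -
  define I' where "I' = frechet_derivative (\<lambda>y. Exp (- y)) (at x)"
  define D2 where "D2 v = frechet_derivative (\<lambda>y. DExp y v) (at x)" for v
  have dI: "((\<lambda>y. Exp (- y)) has_derivative I') (at x)"
    unfolding I'_def by (intro has_derivative_frechet poly_matrix_differentiable poly_matrix_Exp_minus)
  have dD: "((\<lambda>y. DExp y v) has_derivative D2 v) (at x)" for v
    unfolding D2_def by (intro has_derivative_frechet poly_matrix_differentiable poly_matrix_frechet poly_matrix_Exp)
  have "((\<lambda>y. Exp (- y) * Exp y) has_derivative (\<lambda>u. Exp (- x) * DExp x u + I' u * Exp x)) (at x)"
    by (intro has_derivative_mult dI has_derivative_Exp)
  then have "((\<lambda>y. 1) has_derivative (\<lambda>u. Exp (- x) * DExp x u + I' u * Exp x)) (at x)"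
    by (simp add: Exp_minus)
  then have "(\<lambda>u. Exp (- x) * DExp x u + I' u * Exp x) = (\<lambda>u. 0)"
    by (rule has_derivative_unique[OF _ has_derivative_const])
  from fun_cong[OF this] have "I' u * Exp x = - (Exp (- x) * DExp x u)" for u
    by (simp add: add_eq_0_iff)
  then have "I' u * Exp x * Exp (- x) = - (rho (mc_form x u)) * Exp (- x)" for u
    by (simp add: rho_mc_form)
  then have I': "I' u = - (rho (mc_form x u)) * Exp (- x)" for u
    by (simp add: mult.assoc Exp_minus)
  have "((\<lambda>y. entry (Exp (- y) * DExp y v) None (Some i)) has_derivative
      (\<lambda>u. entry (Exp (- x) * D2 v u + I' u * DExp x v) None (Some i))) (at x)" for v
    by (intro bounded_linear.has_derivative[OF bounded_linear_entry] has_derivative_mult dI dD)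
  from frechet_derivative_eq[OF this]
  have d: "frechet_derivative (\<lambda>y. mc_form y v $ i) (at x) u =
      entry (Exp (- x) * D2 v u - rho (mc_form x u) * rho (mc_form x v)) None (Some i)" for u v
    unfolding mc_form_nth by (simp add: I' rho_mc_form[of x v] mult.assoc)
  have "D2 v u = D2 u v"
    unfolding D2_def by (rule poly_matrix_frechet_symmetric[OF poly_matrix_Exp])
  then have "frechet_derivative (\<lambda>y. mc_form y v $ i) (at x) u - frechet_derivative (\<lambda>y. mc_form y u $ i) (at x) v =
     entry (- rho (lie (mc_form x u) (mc_form x v))) None (Some i)"
    unfolding d rho_lie commutator_def by simp
  then show ?thesis by (simp add: entry_rho_None)
qed

subsection \<open>Forms of low degree\<close>

lemma wedge_two:
  "(a \<and>\<^sub>w b) x [u, v] = a x [] * b x [u, v] + a x [u] * b x [v] - a x [v] * b x [u] + a x [u, v] * b x []"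
proof -
  let ?c = "\<lambda>S. {(i, j). i \<in> S \<and> j \<in> {0, 1} - S \<and> j < (i::nat)}"
  define c where "c S = card (?c S)" for S
  have "(a \<and>\<^sub>w b) x [u, v] = (\<Sum>S\<in>{{}, {0}, {1}, {0, 1}}. (-1) ^ c S *
      a x (nths [u, v] S) * b x (nths [u, v] ({0, 1} - S)))"
  proof -
    have "{..<length [u, v]} = {0, 1}" "Pow {0, 1 :: nat} = {{}, {0}, {1}, {0, 1}}" by auto
    then show ?thesis unfolding wedge_def c_def by simp
  qed
  moreover have "?c {} = {}" "?c {0} = {}" "?c {1} = {(1, 0)}" "?c {0, 1} = {}" by auto
  note c = this
  have "c {} = 0" "c {0} = 0" "c {1} = 1" "c {0, 1} = 0" unfolding c_def c by simp_all
  moreover have "{0, 1} - {0} = {1 :: nat}" "{0, 1} - {1} = {0 :: nat}" by auto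
  ultimately show ?thesis
    by (simp add: nths_Cons doubleton_eq_iff del: One_nat_def)
qed

lemma wedge_one_forms:
  assumes a: "\<And>vs. length vs \<noteq> 1 \<Longrightarrow> a x vs = 0" and b: "\<And>vs. length vs \<noteq> 1 \<Longrightarrow> b x vs = 0"
    and "length vs \<noteq> 2"
  shows "(a \<and>\<^sub>w b) x vs = 0"
  unfolding wedge_def
proof (rule sum.neutral, rule ballI)
  fix S assume "S \<in> Pow {..<length vs}"
  then have "{i. i < length vs \<and> i \<in> S} = S" "{i. i < length vs \<and> i \<in> {..<length vs} - S} = {..<length vs} - S"
    by auto
  then have "length (nths vs S) + length (nths vs ({..<length vs} - S)) = length vs"
    using \<open>S \<in> Pow {..<length vs}\<close> unfolding length_nths
    by (simp add: card_Diff_subset finite_subset card_mono[of "{..<length vs}" S, simplified])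
  then have "length (nths vs S) \<noteq> 1 \<or> length (nths vs ({..<length vs} - S)) \<noteq> 1"
    using \<open>length vs \<noteq> 2\<close> by linarith
  then show "(-1) ^ card {(i,j). i \<in> S \<and> j \<in> {..<length vs} - S \<and> j < i} *
      a x (nths vs S) * b x (nths vs ({..<length vs} - S)) = 0"
    using a b by auto
qed

lemma ext_d_two:
  "ext_d a x [u, v] = frechet_derivative (\<lambda>y. a y [v]) (at x) u - frechet_derivative (\<lambda>y. a y [u]) (at x) v"
  by (simp add: ext_d_def numeral_2_eq_2)

lemma ext_d_one_form:
  assumes "\<And>x vs. length vs \<noteq> 1 \<Longrightarrow> a x vs = 0" and "length vs \<noteq> 2"
  shows "ext_d a x vs = 0"
  unfolding ext_d_def
proof (rule sum.neutral, rule ballI)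
  fix i assume "i \<in> {..<length vs}"
  then have "length (take i vs @ drop (Suc i) vs) \<noteq> 1" using assms(2) by auto
  then show "(- 1) ^ i * frechet_derivative (\<lambda>y. a y (take i vs @ drop (Suc i) vs)) (at x) (vs ! i) = 0"
    by (simp add: assms(1))
qed

subsection \<open>Left-invariant forms\<close>

text \<open>A multiple of the coframe element with numerical index \<open>k\<close>, hence zero for
  \<open>k\<close> outside 1, ..., n. The scalar is built in so that \<open>bar\<close> stays within
  this family.\<close>

definition inv_form :: "real \<Rightarrow> nat \<Rightarrow> ('n::{finite,linorder}) form"
  where "inv_form c k x vs = (case vs of [v] \<Rightarrow> c * coord (mc_form x v) k | _ \<Rightarrow> 0)"

lemma inv_form_simps [simp]: "inv_form c k x [v] = c * coord (mc_form x v) k" "length vs \<noteq> 1 \<Longrightarrow> inv_form c k x vs = 0"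
  by (auto simp: inv_form_def split: list.splits)

lemma coframe_simps [simp]: "coframe i x [v] = mc_form x v $ i" "length vs \<noteq> 1 \<Longrightarrow> coframe i x vs = 0"
  by (auto simp: coframe_def mc_form_def split: list.splits)

lemma inv_form_mem: "(inv_form c k :: ('n::{finite,linorder}) form) \<in> forms_deg 1 \<inter> aug_ideal"
proof -
  have "real_polynomial_function (\<lambda>x. if idx i = k then mc_form x v $ i else 0)"
    for v :: "'n rvec" and i
    by (cases "idx i = k") (auto simp: real_polynomial_mc_form)
  then have poly: "real_polynomial_function (\<lambda>x. c * coord (mc_form x v) k)" for v :: "'n rvec"
    unfolding coord_def by (intro real_polynomial_function.intros(2,4) real_polynomial_function_sum) auto
  have "linear (\<lambda>v. inv_form c k x (us @ v # ws))" for x :: "'n rvec" and us ws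
  proof (cases "us = [] \<and> ws = []")
    case True
    have "linear (\<lambda>v. c * coord (mc_form x v) k)"
      using linear_compose_scale_right[OF linear_compose[OF linear_mc_form[of x] linear_coord[of k]], of c] by (simp add: o_def)
    then show ?thesis using True by simp
  next
    case False
    then have "length (us @ v # ws) \<noteq> 1" for v by auto
    then have "(\<lambda>v. inv_form c k x (us @ v # ws)) = (\<lambda>v. 0)" by (intro ext inv_form_simps(2))
    then show ?thesis by (simp add: linear_zero)
  qed
  moreover have "\<not> distinct vs \<longrightarrow> inv_form c k x vs = 0" for x :: "'n rvec" and vs
    by (auto simp: inv_form_def split: list.splits)
  moreover have "smooth (\<lambda>x. inv_form c k x vs)" for vs :: "'n rvec list"
  proof (cases "length vs = 1")
    case True
    then obtain v where "vs = [v]" by (auto simp: length_Suc_conv)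
    then show ?thesis using smooth_polynomial[OF poly] by simp
  qed (use smooth_polynomial[OF real_polynomial_function.intros(2)] in simp)
  moreover have "inv_form c k (bch g x) (map (frechet_derivative (bch g) (at x)) vs) = inv_form c k x vs"
    for g x :: "'n rvec" and vs
    by (auto simp: inv_form_def mc_form_bch split: list.splits)
  ultimately have "(inv_form c k :: 'n form) \<in> forms" by (simp add: forms_def)
  then show ?thesis by (auto simp: forms_deg_def aug_ideal_def)
qed

lemma bar_inv_form: "bar (inv_form c k) = inv_form (- c) k"
  by (auto simp: bar_def inv_form_def fun_eq_iff split: list.splits)

lemma wedge_inv_form:
  "(inv_form c j \<and>\<^sub>w inv_form d k) x [u, v] =
    c * d * (coord (mc_form x u) j * coord (mc_form x v) k - coord (mc_form x v) j * coord (mc_form x u) k)"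
  "length vs \<noteq> 2 \<Longrightarrow> (inv_form c j \<and>\<^sub>w inv_form d k) x vs = 0"
  by (auto simp: wedge_two algebra_simps intro!: wedge_one_forms)

lemma frechet_scaled_mc_form:
  fixes v :: "('n::{finite,linorder}) rvec"
  shows "frechet_derivative (\<lambda>y. c * coord (mc_form y v) k) (at x) u - frechet_derivative (\<lambda>y. c * coord (mc_form y u) k) (at x) v =
    - c * coord (lie (mc_form x u) (mc_form x v)) k"
proof (cases "k \<in> range (idx :: 'n \<Rightarrow> nat)")
  case True
  then obtain i :: 'n where k: "k = idx i" by auto
  have "frechet_derivative (\<lambda>y. c * mc_form y v $ i) (at x) u = c * frechet_derivative (\<lambda>y. mc_form y v $ i) (at x) u" for u v
    by (simp add: frechet_mult real_polynomial_differentiable real_polynomial_mc_form)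
  then show ?thesis
    unfolding k by (simp add: maurer_cartan flip: right_diff_distrib)
next
  case False
  then have "coord z k = 0" for z :: "'n rvec"
    by (intro coord_0) (auto simp: range_idx not_less_eq_eq)
  then show ?thesis by simp
qed

lemma ext_d_inv_form:
  fixes x :: "('n::{finite,linorder}) rvec"
  shows "k \<le> CARD('n) \<Longrightarrow> ext_d (inv_form c k) x [u, v] =
    - c * (\<Sum>a=1..<k. (real (k - a) - real a) * coord (mc_form x u) a * coord (mc_form x v) (k - a))"
  and "length vs \<noteq> 2 \<Longrightarrow> ext_d (inv_form c k) x vs = 0"
proof -
  assume "k \<le> CARD('n)"
  then show "ext_d (inv_form c k) x [u, v] =
    - c * (\<Sum>a=1..<k. (real (k - a) - real a) * coord (mc_form x u) a * coord (mc_form x v) (k - a))"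
    by (simp only: ext_d_two inv_form_simps frechet_scaled_mc_form coord_lie)
qed (simp add: ext_d_one_form)

text \<open>The second factor changes sign under s -> k - s, so \<open>e\<close> drops out. This is
  why the rows of the connection matrix, with their different constants, all produce the structure
  constants of the Lie algebra.\<close>

lemma sum_antisym:
  fixes P Q :: "nat \<Rightarrow> real"
  shows "(\<Sum>s=1..<k. (e - real s) * (P s * Q (k - s) - Q s * P (k - s))) =
    (\<Sum>s=1..<k. (real (k - s) - real s) * P s * Q (k - s))"
proof -
  have "(\<Sum>s=1..<k. (e - real s) * (Q s * P (k - s))) = (\<Sum>s=1..<k. (e - real (k - s)) * (Q (k - s) * P s))"
    by (rule sum_reflect)
  then have "(\<Sum>s=1..<k. (e - real s) * (P s * Q (k - s) - Q s * P (k - s))) =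
    (\<Sum>s=1..<k. (e - real s) * (P s * Q (k - s))) - (\<Sum>s=1..<k. (e - real (k - s)) * (Q (k - s) * P s))"
    by (simp add: right_diff_distrib sum_subtractf)
  then show ?thesis by (simp add: algebra_simps flip: sum_subtractf)
qed

text \<open>Collecting both orders of each pair exhibits \<open>Omega\<close> as the coordinate 2m +
  1 that the truncated bracket lacks.\<close>

lemma Omega_eq:
  fixes x :: "('n::{finite,linorder}) rvec"
  assumes "CARD('n) = 2 * m"
  shows "Omega m x [u, v] = (\<Sum>s=1..<2*m+1. (real (2*m+1 - s) - real s) * coord (mc_form x u) s * coord (mc_form x v) (2*m+1 - s))"
    and "length vs \<noteq> 2 \<Longrightarrow> Omega m x vs = 0"
proof -
  let ?f = "\<lambda>i j. (real (idx j) - real (idx i)) * mc_form x u $ i * mc_form x v $ j"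
  let ?S = "\<lambda>R. {(i :: 'n, j). R i j \<and> idx i + idx j = 2 * m + 1}"
  have fin: "finite (?S R)" for R by (rule finite_subset[of _ UNIV]) auto
  have "Omega m x [u, v] = (\<Sum>(i, j)\<in>?S (<). ?f i j + ?f j i)"
    unfolding Omega_def by (rule sum.cong) (auto simp: wedge_two algebra_simps)
  also have "\<dots> = (\<Sum>(i, j)\<in>?S (<). ?f i j) + (\<Sum>(i, j)\<in>?S (<). ?f j i)"
    by (simp add: sum.distrib case_prod_unfold)
  also have "(\<Sum>(i, j)\<in>?S (<). ?f j i) = (\<Sum>(i, j)\<in>?S (>). ?f i j)"
    by (rule sum.reindex_bij_witness[of _ prod.swap prod.swap]) auto
  also have "(\<Sum>(i, j)\<in>?S (<). ?f i j) + \<dots> = (\<Sum>(i, j)\<in>?S (<) \<union> ?S (>). ?f i j)"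
    by (rule sum.union_disjoint[symmetric]) (auto simp: fin)
  also have "\<dots> = (\<Sum>(i, j)\<in>UNIV. if idx i + idx j = 2 * m + 1 then ?f i j else 0)"
  proof (rule sum.mono_neutral_cong_left)
    \<comment> \<open>Since 2m + 1 is odd, no diagonal pair is lost.\<close>
    have "idx i + idx i \<noteq> 2 * m + 1" for i :: 'n by presburger
    then show "\<forall>p\<in>UNIV - (?S (<) \<union> ?S (>)). (case p of (i, j) \<Rightarrow> if idx i + idx j = 2 * m + 1 then ?f i j else 0) = 0"
      by (clarsimp simp: not_less_iff_gr_or_eq) (metis add.right_neutral add_Suc_right linorder_less_linear)
  qed auto
  also have "\<dots> = (\<Sum>i\<in>UNIV. \<Sum>j\<in>UNIV. if idx i + idx j = 2 * m + 1 then ?f i j else 0)"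
    unfolding UNIV_Times_UNIV[symmetric] by (rule sum.cartesian_product[symmetric])
  also have "\<dots> = (\<Sum>i\<in>(UNIV::'n set). \<Sum>j\<in>(UNIV::'n set).
      if idx j = 2 * m + 1 - idx i then (real (2*m+1 - idx i) - real (idx i)) * coord (mc_form x u) (idx i) * coord (mc_form x v) (2*m+1 - idx i) else 0)"
  proof (intro sum.cong refl)
    fix i j :: 'n
    have "idx i + idx j = 2 * m + 1 \<longleftrightarrow> idx j = 2 * m + 1 - idx i"
      using idx_le[of i] idx_le[of j] assms by auto
    then show "(if idx i + idx j = 2 * m + 1 then ?f i j else 0) =
      (if idx j = 2 * m + 1 - idx i then (real (2*m+1 - idx i) - real (idx i)) * coord (mc_form x u) (idx i) * coord (mc_form x v) (2*m+1 - idx i) else 0)"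
      by (metis coord_idx)
  qed
  also have "\<dots> = (\<Sum>a=1..CARD('n). \<Sum>b=1..CARD('n).
      if b = 2 * m + 1 - a then (real (2*m+1 - a) - real a) * coord (mc_form x u) a * coord (mc_form x v) (2*m+1 - a) else 0)"
    unfolding sum_idx[of "\<lambda>b. if b = _ then _ else 0", where 'n='n] by (rule sum_idx)
  also have "\<dots> = (\<Sum>s=1..<2*m+1. (real (2*m+1 - s) - real s) * coord (mc_form x u) s * coord (mc_form x v) (2*m+1 - s))"
    by (rule sum.cong) (use assms in auto)
  finally show "Omega m x [u, v] = (\<Sum>s=1..<2*m+1. (real (2*m+1 - s) - real s) * coord (mc_form x u) s * coord (mc_form x v) (2*m+1 - s))" .
  show "length vs \<noteq> 2 \<Longrightarrow> Omega m x vs = 0"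
    unfolding Omega_def by (auto intro!: sum.neutral simp: wedge_one_forms)
qed

subsection \<open>The symplectic class as a Massey product\<close>

text \<open>The connection matrix of the module with basis \<open>f\<^sub>0, f\<^sub>2, f\<^sub>3, \<dots>\<close> obtained from
  \<open>e\<^sub>i f\<^sub>j = (j - 1) f\<^sub>i\<^sub>+\<^sub>j\<close> by dividing out the submodule spanned by \<open>f\<^sub>1\<close>;
  its diagonal is \<open>\<langle>\<omega>\<^sub>2, \<omega>\<^sub>1, \<dots>, \<omega>\<^sub>1\<rangle>\<close> up to scalars.\<close>

definition conn :: "nat \<Rightarrow> nat \<Rightarrow> ('n::{finite,linorder}) form"
  where "conn i j = (if i = 1 then inv_form (- 1) (j + 1) else inv_form (1 - real i) (j - i + 1))"

definition conn_matrix :: "nat \<Rightarrow> nat \<Rightarrow> ('n::{finite,linorder}) form gmatrix"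
  where "conn_matrix i j = \<lparr>nrows = 1, ncols = 1, dg = (\<lambda>p q. 1), ent = (\<lambda>p q. conn i j)\<rparr>"

lemma conn_matrix_simps [simp]:
  "nrows (conn_matrix i j) = 1" "ncols (conn_matrix i j) = 1" "dg (conn_matrix i j) p q = 1"
  "ent (conn_matrix i j) p q = conn i j"
  by (auto simp: conn_matrix_def)

lemma conn_mem: "conn i j \<in> forms_deg 1 \<inter> aug_ideal"
  using inv_form_mem by (auto simp: conn_def)

text \<open>Up to a factor depending on the row, the coefficients have the form e - s, with e = 1 in
  the first row and e = 1 - i in the others, so \<open>sum_antisym\<close> applies. The corner (1,
  n) is the case k = n + 1.\<close>

lemma conn_product:
  assumes "1 \<le> i" "i \<le> j"
  shows "(\<Sum>r=i..<j. bar_mult (conn_matrix i r) (conn_matrix (r + 1) j) p q x [u, v]) =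
      (let k = (if i = 1 then j + 1 else j - i + 1); c = (if i = 1 then - 1 else 1 - real i)
       in - c * (\<Sum>s=1..<k. (real (k - s) - real s) * coord (mc_form x u) s * coord (mc_form x v) (k - s)))"
    and "length vs \<noteq> 2 \<Longrightarrow> (\<Sum>r=i..<j. bar_mult (conn_matrix i r) (conn_matrix (r + 1) j) p q x vs) = 0"
proof -
  let ?P = "coord (mc_form x u)" and ?Q = "coord (mc_form x v)"
  have b: "bar_mult (conn_matrix i r) (conn_matrix (r + 1) j) p q x ws = (bar (conn i r) \<and>\<^sub>w conn (r + 1) j) x ws" for i r ws
    by (simp add: bar_mult_def)
  show "(\<Sum>r=i..<j. bar_mult (conn_matrix i r) (conn_matrix (r + 1) j) p q x [u, v]) =
      (let k = (if i = 1 then j + 1 else j - i + 1); c = (if i = 1 then - 1 else 1 - real i)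
       in - c * (\<Sum>s=1..<k. (real (k - s) - real s) * ?P s * ?Q (k - s)))"
  proof (cases "i = 1")
    case True
    have "(\<Sum>r=1..<j. (bar (conn 1 r) \<and>\<^sub>w conn (r + 1) j) x [u, v]) =
      (\<Sum>s=2..<j+1. (1 - real s) * (?P s * ?Q (j + 1 - s) - ?Q s * ?P (j + 1 - s)))"
      by (rule sum.reindex_bij_witness[of _ "\<lambda>s. s - 1" Suc])
         (auto simp: conn_def bar_inv_form wedge_inv_form Suc_diff_Suc algebra_simps)
    \<comment> \<open>The added summand s = 1 belongs to the removed vector \<open>f_1\<close>; its
      coefficient 1 - s is 0.\<close>
    also have "\<dots> = (\<Sum>s=1..<j+1. (1 - real s) * (?P s * ?Q (j + 1 - s) - ?Q s * ?P (j + 1 - s)))"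
      by (rule sum.mono_neutral_left) (auto simp: not_le less_Suc_eq numeral_2_eq_2)
    finally show ?thesis by (simp only: True b sum_antisym Let_def if_True) simp
  next
    case False
    then have i: "i \<ge> 2" using assms by simp
    have "(\<Sum>r=i..<j. (bar (conn i r) \<and>\<^sub>w conn (r + 1) j) x [u, v]) =
      (\<Sum>s=1..<j-i+1. - (1 - real i) * (((1 - real i) - real s) * (?P s * ?Q (j - i + 1 - s) - ?Q s * ?P (j - i + 1 - s))))"
      by (rule sum.reindex_bij_witness[of _ "\<lambda>s. s + i - 1" "\<lambda>r. r - i + 1"])
         (use i in \<open>auto simp: conn_def bar_inv_form wedge_inv_form of_nat_diff Suc_diff_Suc\<close>)
    then show ?thesis
      using False by (simp only: b sum_distrib_left[symmetric] sum_antisym Let_def if_False)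
  qed
  have "(bar (conn i r) \<and>\<^sub>w conn (r + 1) j) x vs = 0" if "length vs \<noteq> 2" for r
    using that by (auto simp: conn_def bar_inv_form wedge_inv_form)
  then show "length vs \<noteq> 2 \<Longrightarrow> (\<Sum>r=i..<j. bar_mult (conn_matrix i r) (conn_matrix (r + 1) j) p q x vs) = 0"
    by (simp only: b not_False_eq_True simp_thms sum.neutral_const)
qed

lemma ext_d_conn:
  assumes "1 \<le> i" "i \<le> j" "j \<le> CARD('n)" "(i, j) \<noteq> (1, CARD('n))"
  shows "ext_d (conn i j :: ('n::{finite,linorder}) form) =
    (\<lambda>x vs. \<Sum>r=i..<j. bar_mult (conn_matrix i r) (conn_matrix (r + 1) j) p q x vs)"
proof (intro ext)
  fix x :: "'n rvec" and vs
  show "ext_d (conn i j) x vs = (\<Sum>r=i..<j. bar_mult (conn_matrix i r) (conn_matrix (r + 1) j) p q x vs)"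
  proof (cases "length vs = 2")
    case True
    then obtain u v where vs: "vs = [u, v]" by (auto simp: numeral_2_eq_2 length_Suc_conv)
    \<comment> \<open>Only the excluded pair (1, n) would call for a form of index n + 1.\<close>
    have k: "(if i = 1 then j + 1 else j - i + 1) \<le> CARD('n)" using assms by auto
    show ?thesis
      unfolding vs conn_product(1)[OF assms(1,2)] Let_def ext_d_inv_form(1)[OF k, symmetric]
      by (simp add: conn_def)
  next
    case False
    then show ?thesis
      unfolding conn_product(2)[OF assms(1,2) False] conn_def by (simp add: ext_d_inv_form(2))
  qed
qed

text \<open>The cocycle of this defining system is \<open>Omega\<close> itself, not merely a
  cohomologous form: the product formula still holds at (1, n), where the primitive is
  missing.\<close>

lemma Omega_massey:
  assumes "m \<ge> 1" "CARD('n::{finite,linorder}) = 2 * m"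
  shows "\<exists>V. massey_arguments (2 * m) V \<and>
     (\<exists>C\<in>massey (2 * m) V. nrows C = 1 \<and> ncols C = 1 \<and> dg C 0 0 = 2 \<and>
        ent C 0 0 = cohom_class (Omega m :: 'n form))"
proof -
  define X where "X i = (conn_matrix i i :: 'n form gmatrix)" for i
  have cyc: "(conn i i :: 'n form) \<in> cocycles" if "i \<in> {1..2*m}" for i
  proof -
    have "ext_d (conn i i :: 'n form) = (\<lambda>x vs. 0)"
      using ext_d_conn[where 'n='n, of i i] that assms by auto
    then show ?thesis using conn_mem[of i i] by (auto simp: cocycles_def forms_deg_def)
  qed
  have N_I: "N_I (conn_matrix i j :: 'n form gmatrix)" for i j
    using conn_mem by (auto simp: N_I_def matrix_of_def)
  have "massey_arguments (2 * m) (\<lambda>i. class_matrix (X i))"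
    using assms(1) cyc conn_mem
    by (auto simp: massey_arguments_def N_H_plus_def matrix_of_def multipliable_def class_matrix_def X_def cohom_def intro!: imageI)
  moreover have rep: "represents (X i) (class_matrix (X i))" if "i \<in> {1..2*m}" for i
    using cyc[OF that] N_I by (auto simp: represents_def class_matrix_def X_def)
  have chain: "deg_chain X i k = (\<lambda>p q. 0)" for i k
    by (induction k) (auto simp: X_def)
  have "defining_system (2 * m) X conn_matrix"
    unfolding defining_system_def
    using N_I ext_d_conn[where 'n='n] assms by (auto simp: chain X_def)
  then have "class_matrix (massey_cocycle (2 * m) X conn_matrix) \<in> massey (2 * m) (\<lambda>i. class_matrix (X i))"
    using rep unfolding massey_def by blast
  moreover have "(\<lambda>x vs. \<Sum>r=1..<2*m. bar_mult (conn_matrix 1 r) (conn_matrix (r + 1) (2*m)) 0 0 x vs) = (Omega m :: 'n form)"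
  proof (intro ext)
    fix x :: "'n rvec" and vs
    have m: "(1::nat) \<le> 1" "1 \<le> 2 * m" using assms by auto
    show "(\<Sum>r=1..<2*m. bar_mult (conn_matrix 1 r) (conn_matrix (r + 1) (2*m)) 0 0 x vs) = Omega m x vs"
    proof (cases "length vs = 2")
      case True
      then obtain u v where vs: "vs = [u, v]" by (auto simp: numeral_2_eq_2 length_Suc_conv)
      show ?thesis unfolding vs conn_product(1)[OF m] Omega_eq(1)[OF assms(2)] by simp
    next
      case False
      show ?thesis by (simp only: conn_product(2)[OF m False] Omega_eq(2)[OF assms(2) False])
    qed
  qed
  ultimately show ?thesis
    by (intro exI[of _ "\<lambda>i. class_matrix (X i)"] conjI
        bexI[of _ "class_matrix (massey_cocycle (2 * m) X conn_matrix)"])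
       (auto simp: class_matrix_def massey_cocycle_def chain X_def)
qed

subsection \<open>Primitives of closed 1-forms\<close>

definition C1 :: "(('n::finite) rvec \<Rightarrow> real) \<Rightarrow> bool"
  where "C1 f \<longleftrightarrow> C_k 1 f"

lemma C_1_iff: "C1 f \<longleftrightarrow> (\<forall>x. f differentiable at x) \<and> (\<forall>v. continuous_on UNIV (\<lambda>x. frechet_derivative f (at x) v))"
  by (simp add: C1_def differentiable_on_def)

lemma C_1_differentiable: "C1 f \<Longrightarrow> f differentiable at x"
  and C_1_continuous_frechet: "C1 f \<Longrightarrow> continuous_on UNIV (\<lambda>x. frechet_derivative f (at x) v)"
  by (auto simp: C_1_iff)

lemma C_1_continuous: "C1 f \<Longrightarrow> continuous_on UNIV f"
  by (simp add: continuous_on_eq_continuous_at C_1_differentiable differentiable_imp_continuous_within)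

lemma C_1_const: "C1 (\<lambda>x. c)"
  by (simp only: C_1_iff frechet_derivative_const) auto

lemma C_1_add: "C1 f \<Longrightarrow> C1 g \<Longrightarrow> C1 (\<lambda>x. f x + g x)"
  by (simp only: C_1_iff frechet_add) (auto intro: continuous_intros)

lemma C_1_mult:
  assumes "C1 f" "C1 g" shows "C1 (\<lambda>x. f x * g x)"
proof -
  note [continuous_intros] = assms[THEN C_1_continuous] assms[THEN C_1_continuous_frechet]
  show ?thesis
    using assms[THEN C_1_differentiable]
    by (simp only: C_1_iff frechet_mult) (auto intro!: continuous_intros)
qed

lemma C_1_sum: "(\<And>i. i \<in> I \<Longrightarrow> C1 (f i)) \<Longrightarrow> C1 (\<lambda>x. \<Sum>i\<in>I. f i x)"
  by (induction I rule: infinite_finite_induct) (simp_all add: C_1_const C_1_add)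

lemma C_1_smooth: "smooth f \<Longrightarrow> C1 f"
  by (simp add: C1_def smooth_def del: C_k.simps)

lemma frechet_sum:
  "(\<And>i. i \<in> I \<Longrightarrow> f i differentiable at x) \<Longrightarrow>
   frechet_derivative (\<lambda>x. \<Sum>i\<in>I. f i x) (at x) = (\<lambda>v. \<Sum>i\<in>I. frechet_derivative (f i) (at x) v)"
  by (rule frechet_derivative_eq) (intro has_derivative_sum has_derivative_frechet)

lemma linear_rvec_expand:
  fixes f :: "('n::finite) rvec \<Rightarrow> real"
  assumes "linear f" shows "f v = (\<Sum>i\<in>UNIV. v $ i * f (axis i 1))"
proof -
  have "f v = f (\<Sum>i\<in>UNIV. v $ i *\<^sub>R axis i 1)"
    using basis_expansion[of v] by (simp add: scalar_mult_eq_scaleR)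
  then show ?thesis by (simp add: linear_sum[OF assms] linear_scale[OF assms])
qed

lemma continuous_on_scaled: 
  fixes f :: "'a::real_normed_vector \<Rightarrow> real"
  shows "continuous_on UNIV f \<Longrightarrow> continuous_on S (\<lambda>(x, t). f (t *\<^sub>R x))"
  unfolding case_prod_unfold
  by (rule continuous_on_compose2[of UNIV f]) (auto intro!: continuous_intros)

text \<open>The primitive is the integral of theta at t x, applied to x, over t in [0, 1].
  Continuous first derivatives suffice, which is all that is established for parallel rows.\<close>

lemma poincare_lemma:
  fixes \<theta> :: "('n::finite) rvec \<Rightarrow> 'n rvec \<Rightarrow> real"
  assumes lin: "\<And>x. linear (\<theta> x)" and C1: "\<And>v. C1 (\<lambda>x. \<theta> x v)"
    and closed: "\<And>x u v. frechet_derivative (\<lambda>y. \<theta> y v) (at x) u = frechet_derivative (\<lambda>y. \<theta> y u) (at x) v"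
  obtains F where "\<And>x. (F has_derivative \<theta> x) (at x)"
proof -
  define g where "g i x = \<theta> x (axis i 1)" for i x
  have gC: "C1 (g i)" for i unfolding g_def by (rule C1)
  have \<theta>_eq: "\<theta> x v = (\<Sum>i\<in>UNIV. v $ i * g i x)" for x v
    unfolding g_def by (rule linear_rvec_expand[OF lin])
  have D\<theta>: "frechet_derivative (\<lambda>y. \<theta> y v) (at x) w = (\<Sum>i\<in>UNIV. v $ i * frechet_derivative (g i) (at x) w)" for v x w
    unfolding \<theta>_eq by (simp add: frechet_sum frechet_mult C_1_differentiable[OF gC] differentiable_mult)
  define f where "f x t = \<theta> (t *\<^sub>R x) x" for x and t :: real
  define f' where "f' x t w = (\<Sum>i\<in>UNIV. x $ i * (t * frechet_derivative (g i) (at (t *\<^sub>R x)) w) + w $ i * g i (t *\<^sub>R x))"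
    for x and t :: real and w
  have df: "((\<lambda>x. f x t) has_derivative f' x t) (at x)" for x t
  proof -
    have "((\<lambda>x. g i (t *\<^sub>R x)) has_derivative (\<lambda>w. t * frechet_derivative (g i) (at (t *\<^sub>R x)) w)) (at x)" for i
    proof -
      have "((\<lambda>x. t *\<^sub>R x) has_derivative (\<lambda>w. t *\<^sub>R w)) (at x)" by (intro derivative_intros)
      from diff_chain_at[OF this has_derivative_frechet[OF C_1_differentiable[OF gC[of i]]]]
      show ?thesis
        using linear_scale[OF linear_frechet[OF C_1_differentiable[OF gC[of i]]]] by (simp add: o_def)
    qed
    moreover have "((\<lambda>x. x $ i) has_derivative (\<lambda>w. w $ i)) (at x)" for i
      by (intro bounded_linear_imp_has_derivative bounded_linear_vec_nth)
    ultimately show ?thesis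
      unfolding f_def \<theta>_eq f'_def by (intro has_derivative_sum has_derivative_mult)
  qed
  \<comment> \<open>The Leibniz rule for integrals expects the derivative as a bounded linear
    map.\<close>
  define fb where "fb x t = Blinfun (f' x t)" for x t
  have fb: "blinfun_apply (fb x t) = f' x t" for x t
    unfolding fb_def by (rule bounded_linear_Blinfun_apply[OF has_derivative_bounded_linear[OF df]])
  have contg: "continuous_on S (\<lambda>(x, t). g i (t *\<^sub>R x))"
    "continuous_on S (\<lambda>(x, t). frechet_derivative (g i) (at (t *\<^sub>R x)) w)" for i w S
    by (intro continuous_on_scaled[OF C_1_continuous[OF gC]] continuous_on_scaled[OF C_1_continuous_frechet[OF gC]])+
  have cont_fb: "continuous_on (UNIV \<times> cbox 0 1) (\<lambda>(x, t). fb x t)"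
  proof (rule continuous_on_blinfun_componentwise)
    fix w :: "'n rvec"
    have "continuous_on (UNIV \<times> cbox 0 1) (\<lambda>z. f' (fst z) (snd z) w)"
      unfolding f'_def
      by (intro continuous_intros contg[unfolded case_prod_unfold])
    then show "continuous_on (UNIV \<times> cbox 0 1) (\<lambda>z. blinfun_apply (case z of (x, t) \<Rightarrow> fb x t) w)"
      by (simp add: fb case_prod_unfold)
  qed
  \<comment> \<open>Closedness is what makes the differentiated integrand a total
    t-derivative.\<close>
  have dtheta: "((\<lambda>t. t * \<theta> (t *\<^sub>R x) w) has_vector_derivative f' x t w) (at t within {0..1})" for x w t
  proof -
    have line: "((\<lambda>t. t *\<^sub>R x) has_derivative (\<lambda>r. r *\<^sub>R x)) (at t within {0..1})"
      by (intro bounded_linear_imp_has_derivative bounded_linear_scaleR_left)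
    have "((\<lambda>y. \<theta> y w) has_derivative frechet_derivative (\<lambda>y. \<theta> y w) (at (t *\<^sub>R x)))
        (at (t *\<^sub>R x) within (\<lambda>t. t *\<^sub>R x) ` {0..1})"
      by (rule has_derivative_at_withinI) (intro has_derivative_frechet C_1_differentiable C1)
    from diff_chain_within[OF line this]
    have "((\<lambda>t. \<theta> (t *\<^sub>R x) w) has_derivative
       (\<lambda>r. frechet_derivative (\<lambda>y. \<theta> y w) (at (t *\<^sub>R x)) (r *\<^sub>R x))) (at t within {0..1})"
      by (simp add: o_def)
    then have "((\<lambda>t. \<theta> (t *\<^sub>R x) w) has_real_derivative
       frechet_derivative (\<lambda>y. \<theta> y w) (at (t *\<^sub>R x)) x) (at t within {0..1})"
      unfolding has_field_derivative_def linear_scale[OF linear_frechet[OF C_1_differentiable[OF C1]]]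
      by (simp add: mult_commute_abs)
    then have "((\<lambda>t. t * \<theta> (t *\<^sub>R x) w) has_real_derivative
       (t * frechet_derivative (\<lambda>y. \<theta> y w) (at (t *\<^sub>R x)) x + \<theta> (t *\<^sub>R x) w)) (at t within {0..1})"
      by (auto intro!: derivative_eq_intros)
    moreover have "t * frechet_derivative (\<lambda>y. \<theta> y w) (at (t *\<^sub>R x)) x + \<theta> (t *\<^sub>R x) w = f' x t w"
    proof -
      have "frechet_derivative (\<lambda>y. \<theta> y w) (at (t *\<^sub>R x)) x = (\<Sum>i\<in>UNIV. x $ i * frechet_derivative (g i) (at (t *\<^sub>R x)) w)"
        unfolding closed[of w _ x] by (rule D\<theta>)
      then show ?thesis
        unfolding f'_def by (simp add: \<theta>_eq[of "t *\<^sub>R x" w] sum.distrib sum_distrib_left mult_ac)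
    qed
    ultimately show ?thesis by (simp add: has_real_derivative_iff_has_vector_derivative)
  qed
  have "((\<lambda>x. integral (cbox 0 1) (f x)) has_derivative blinfun_apply (integral (cbox 0 1) (fb x0))) (at x0)" for x0
  proof (rule leibniz_rule[where U=UNIV and f=f and fx=fb])
    show "f x integrable_on cbox 0 1" for x
      unfolding f_def \<theta>_eq
      by (intro integrable_continuous continuous_intros continuous_on_compose2[OF C_1_continuous[OF gC]]) auto
  qed (use cont_fb in \<open>auto simp: fb df\<close>)
  moreover have "blinfun_apply (integral (cbox 0 1) (fb x0)) = \<theta> x0" for x0
  proof
    fix w
    have "continuous_on (cbox 0 1) (fb x0)"
      using continuous_on_compose2[OF cont_fb, of "cbox 0 1" "\<lambda>t. (x0, t)"] by (simp add: continuous_on_Pair image_subset_iff)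
    then have "blinfun_apply (integral (cbox 0 1) (fb x0)) w = integral (cbox 0 1) (\<lambda>t. f' x0 t w)"
      using blinfun_apply_integral[OF integrable_continuous[of 0 1 "fb x0"], of w] by (simp add: fb)
    also have "((\<lambda>t. f' x0 t w) has_integral 1 * \<theta> (1 *\<^sub>R x0) w - 0 * \<theta> (0 *\<^sub>R x0) w) {0..1}"
      by (rule fundamental_theorem_of_calculus) (auto intro: dtheta)
    then have "integral (cbox 0 1) (\<lambda>t. f' x0 t w) = \<theta> x0 w"
      by (auto simp: integral_unique)
    finally show "blinfun_apply (integral (cbox 0 1) (fb x0)) w = \<theta> x0 w" .
  qed
  ultimately show ?thesis using that by auto
qed

subsection \<open>Integration over a parallelogram\<close>

definition para_integral :: "('n::finite) rvec \<Rightarrow> 'n rvec \<Rightarrow> ('n rvec \<Rightarrow> real) \<Rightarrow> real"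
  where "para_integral a b f = integral {0..1} (\<lambda>s. integral {0..1} (\<lambda>t. f (s *\<^sub>R a + t *\<^sub>R b)))"

text \<open>Continuity is included to make the notion closed under linear combinations.\<close>

definition null_integral :: "('n::finite) rvec \<Rightarrow> 'n rvec \<Rightarrow> ('n rvec \<Rightarrow> real) \<Rightarrow> bool"
  where "null_integral a b f \<longleftrightarrow> continuous_on UNIV f \<and> para_integral a b f = 0"

context
  fixes a b :: "('n::finite) rvec"
begin

lemma continuous_on_para:
  fixes f :: "'n rvec \<Rightarrow> real"
  assumes "continuous_on UNIV f"
  shows "continuous_on S (\<lambda>(s, t). f (s *\<^sub>R a + t *\<^sub>R b))"
    and "continuous_on I (\<lambda>t. f (s *\<^sub>R a + t *\<^sub>R b))" "continuous_on I (\<lambda>s. f (s *\<^sub>R a + t *\<^sub>R b))"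
  unfolding case_prod_unfold
  by (rule continuous_on_compose2[OF assms]; auto intro!: continuous_intros)+

lemma para_inner_continuous:
  fixes f :: "'n rvec \<Rightarrow> real"
  assumes "continuous_on UNIV f"
  shows "continuous_on {0..1} (\<lambda>s. integral {0..1} (\<lambda>t. f (s *\<^sub>R a + t *\<^sub>R b)))"
  using integral_continuous_on_param[of "{0..1}" 0 1 "\<lambda>s t. f (s *\<^sub>R a + t *\<^sub>R b)"] continuous_on_para(1)[OF assms]
  by simp

lemma para_integral_lincomb:
  assumes "continuous_on UNIV f" "continuous_on UNIV g"
  shows "para_integral a b (\<lambda>x. f x + c * g x) = para_integral a b f + c * para_integral a b g"
proof -
  have "integral {0..1} (\<lambda>t. f (s *\<^sub>R a + t *\<^sub>R b) + c * g (s *\<^sub>R a + t *\<^sub>R b)) =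
      integral {0..1} (\<lambda>t. f (s *\<^sub>R a + t *\<^sub>R b)) + c * integral {0..1} (\<lambda>t. g (s *\<^sub>R a + t *\<^sub>R b))" for s :: real
    by (subst integral_add)
       (auto intro!: integrable_continuous_real continuous_intros continuous_on_para assms)
  then show ?thesis
    unfolding para_integral_def
    by (simp, subst integral_add)
       (auto intro!: integrable_continuous_real continuous_intros para_inner_continuous assms)
qed

lemma null_lincomb: "null_integral a b f \<Longrightarrow> null_integral a b g \<Longrightarrow> null_integral a b (\<lambda>x. f x + c * g x)"
  by (auto simp: null_integral_def para_integral_lincomb intro!: continuous_intros)

lemma null_zero: "null_integral a b (\<lambda>x. 0)"
  by (simp add: null_integral_def para_integral_def)

lemma null_sum: "(\<And>i. i \<in> I \<Longrightarrow> null_integral a b (f i)) \<Longrightarrow> null_integral a b (\<lambda>x. \<Sum>i\<in>I. c i * f i x)"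
proof (induction I rule: infinite_finite_induct)
  case (insert i I)
  then show ?case using null_lincomb[of "\<lambda>x. \<Sum>i\<in>I. c i * f i x" "f i" "c i"] by (simp add: add.commute)
qed (auto simp: null_zero)

lemma ftc_line:
  fixes f :: "'n rvec \<Rightarrow> real"
  assumes "\<And>x. (f has_derivative f' x) (at x)"
  shows "integral {0..1} (\<lambda>t. f' (x + t *\<^sub>R v) v) = f (x + v) - f x"
proof -
  have "((\<lambda>t. f (x + t *\<^sub>R v)) has_vector_derivative f' (x + t *\<^sub>R v) v) (at t within {0..1})" for t
  proof -
    have "((\<lambda>t. x + t *\<^sub>R v) has_derivative (\<lambda>r. r *\<^sub>R v)) (at t)"
      by (auto intro!: derivative_eq_intros)
    from diff_chain_at[OF this assms]
    have "((\<lambda>t. f (x + t *\<^sub>R v)) has_derivative (\<lambda>r. r *\<^sub>R f' (x + t *\<^sub>R v) v)) (at t)"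
      using linear_scale[OF has_derivative_linear[OF assms[of "x + t *\<^sub>R v"]]] by (simp add: o_def)
    then show ?thesis by (simp add: has_vector_derivative_def has_derivative_at_withinI)
  qed
  then have "((\<lambda>t. f' (x + t *\<^sub>R v) v) has_integral f (x + 1 *\<^sub>R v) - f (x + 0 *\<^sub>R v)) {0..1}"
    by (intro fundamental_theorem_of_calculus) auto
  then show ?thesis by (simp add: integral_unique)
qed

text \<open>Stokes on the parallelogram. The conditions on opposite sides differ in strength on
  purpose: on the sides along \<open>a\<close> the values agree pointwise, on those along
  \<open>b\<close> only the integrals will be comparable in \<open>null_corner\<close>.\<close>

lemma null_exact:
  fixes \<eta> :: "'n rvec \<Rightarrow> 'n rvec \<Rightarrow> real"
  assumes C1: "\<And>v. C1 (\<lambda>x. \<eta> x v)"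
    and A: "integral {0..1} (\<lambda>t. \<eta> (a + t *\<^sub>R b) b - \<eta> (t *\<^sub>R b) b) = 0"
    and B: "\<And>s. \<eta> (s *\<^sub>R a + b) a = \<eta> (s *\<^sub>R a) a"
  shows "null_integral a b (\<lambda>x. frechet_derivative (\<lambda>y. \<eta> y b) (at x) a - frechet_derivative (\<lambda>y. \<eta> y a) (at x) b)"
proof -
  define f where "f x = frechet_derivative (\<lambda>y. \<eta> y b) (at x) a" for x
  define g where "g x = frechet_derivative (\<lambda>y. \<eta> y a) (at x) b" for x
  have cont: "continuous_on UNIV f" "continuous_on UNIV g"
    unfolding f_def g_def by (auto intro!: C_1_continuous_frechet C1)
  have line: "integral {0..1} (\<lambda>t. frechet_derivative (\<lambda>y. \<eta> y w) (at (x + t *\<^sub>R v)) v) = \<eta> (x + v) w - \<eta> x w" for x v w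
    by (rule ftc_line) (intro has_derivative_frechet C_1_differentiable C1)
  have "para_integral a b f = integral {0..1} (\<lambda>t. integral {0..1} (\<lambda>s. f (s *\<^sub>R a + t *\<^sub>R b)))"
    unfolding para_integral_def
    using integral_swap_continuous[of 0 0 1 1 "\<lambda>s t. f (s *\<^sub>R a + t *\<^sub>R b)"] continuous_on_para(1)[OF cont(1)] by simp
  also have "\<dots> = integral {0..1} (\<lambda>t. \<eta> (a + t *\<^sub>R b) b - \<eta> (t *\<^sub>R b) b)"
    using line[of b "_ *\<^sub>R b" a] by (simp add: f_def add.commute)
  finally have "para_integral a b f = 0" using A by simp
  moreover have "para_integral a b g = 0"
    unfolding para_integral_def g_def using line[of a "_ *\<^sub>R a" b] B by simp
  ultimately have "para_integral a b (\<lambda>x. f x + (- 1) * g x) = 0"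
    unfolding para_integral_lincomb[OF cont] by simp
  then show ?thesis
    using continuous_on_diff[OF cont] by (simp add: null_integral_def f_def g_def)
qed

end

subsection \<open>Commutators in the lattice\<close>

text \<open>Lattice commutators of weight \<open>k\<close>. The element g h g^(-1) h^(-1) is
  characterised by gh = z hg, the form in which it acts on translated functions.\<close>

inductive iter_commutator :: "nat \<Rightarrow> ('n::{finite,linorder}) rvec \<Rightarrow> bool" where
  iter_commutator_base: "g \<in> lattice \<Longrightarrow> iter_commutator 1 g"
| iter_commutator_commutator: "iter_commutator i g \<Longrightarrow> iter_commutator j h \<Longrightarrow> z \<in> lattice \<Longrightarrow> bch g h = bch z (bch h g) \<Longrightarrow> iter_commutator (i + j) z"

lemma iter_commutator_lattice: "iter_commutator k z \<Longrightarrow> z \<in> lattice"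
  by (induction rule: iter_commutator.induct) auto

section \<open>Leading terms in the filtration\<close>

context nilpotent_filtration
begin

lemma power_mem: "x \<in> F d \<Longrightarrow> x ^ k \<in> F (k * d)"
  by (induction k) (use one mult[of x d] in auto)

text \<open>From the square on, the powers of \<open>x\<close> lie in depth 2d, which exceeds
  d.\<close>

lemma op_series_leading:
  assumes x: "x \<in> F d" "d \<ge> 1" and f: "fps_nth f 0 = 0" "fps_nth f 1 = 1"
  shows "op_series N ((*) x) f 1 - x \<in> F (Suc d)"
proof -
  have "op_series N ((*) x) f 1 = (\<Sum>k\<in>insert 1 ({..N} - {1}). fps_nth f k *\<^sub>R x ^ k)"
    unfolding op_series_def mult_funpow using N_pos by (intro sum.cong) auto
  also have "\<dots> = x + (\<Sum>k\<in>{..N} - {1}. fps_nth f k *\<^sub>R x ^ k)"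
    by (subst sum.insert) (use f in auto)
  finally have "op_series N ((*) x) f 1 - x = (\<Sum>k\<in>{..N} - {1}. fps_nth f k *\<^sub>R x ^ k)" by simp
  also have "\<dots> \<in> F (Suc d)"
  proof (rule subspace_sum[OF subspace])
    fix k assume k: "k \<in> {..N} - {1}"
    show "fps_nth f k *\<^sub>R x ^ k \<in> F (Suc d)"
    proof (cases "k = 0")
      case True
      then show ?thesis using f subspace_0[OF subspace] by simp
    next
      case False
      then have "2 * d \<le> k * d" using k by (intro mult_right_mono) auto
      then have "Suc d \<le> k * d" using x(2) by linarith
      then show ?thesis using power_mem[OF x(1), of k] antimono subspace_scale[OF subspace] by blast
    qed
  qed
  finally show ?thesis .
qed

lemma nexp_leading: "x \<in> F d \<Longrightarrow> d \<ge> 1 \<Longrightarrow> nexp x - 1 - x \<in> F (Suc d)"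
  unfolding nexp_minus_one by (rule op_series_leading) auto

lemma nlog_leading: "x \<in> F d \<Longrightarrow> d \<ge> 1 \<Longrightarrow> nlog x - x \<in> F (Suc d)"
  unfolding op_series_ln[symmetric] by (rule op_series_leading) (auto simp: fps_ln_nth)

lemma leading_mem: "y - x \<in> F (Suc d) \<Longrightarrow> x \<in> F d \<Longrightarrow> y \<in> F d"
  using subspace_add[OF subspace, of "y - x" d x] antimono[of d "Suc d"] by auto

end

lemma entry_congruent:
  assumes "A - B \<in> Fil d" "lev q < lev p + d"
  shows "entry A p q = entry B p q"
  using assms by (auto simp: Fil_def)

text \<open>To leading order the group commutator is the Lie bracket: both have depth at least
  \<open>k + 1\<close>, and the error lies one step deeper.\<close>

lemma commutator_leading:
  fixes a c :: "('n::{finite,linorder}) rvec"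
  assumes k: "k \<ge> 1" and c: "rho c \<in> Fil k" and z: "bch a c = bch z (bch c a)"
  shows "rho z - commutator (rho a) (rho c) \<in> Fil (k + 2)"
proof -
  note sub = nf.subspace[where 'n='n]
  define A C EA EC where "A = rho a" and "C = rho c" and "EA = Exp a - 1" and "EC = Exp c - 1"
  have A: "A \<in> Fil 1" and C: "C \<in> Fil k" using c rho_mem by (auto simp: A_def C_def)
  have EA': "EA - A \<in> Fil 2"
    using nf.nexp_leading[OF rho_mem, of a] by (simp add: EA_def A_def Exp_def numeral_2_eq_2)
  have EC': "EC - C \<in> Fil (Suc k)"
    using nf.nexp_leading[OF c k] by (simp add: EC_def C_def Exp_def)
  have EA: "EA \<in> Fil 1" using nf.leading_mem[of EA A 1] EA' A by (simp add: numeral_2_eq_2)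
  have EC: "EC \<in> Fil k" using nf.leading_mem[OF EC' C] .
  have lead: "EA * EC - A * C \<in> Fil (k + 2)" "EC * EA - C * A \<in> Fil (k + 2)"
  proof -
    have "EA * EC - A * C = (EA - A) * EC + A * (EC - C)" "EC * EA - C * A = (EC - C) * EA + C * (EA - A)"
      by (simp_all add: algebra_simps)
    moreover have "(EA - A) * EC \<in> Fil (k + 2)" "A * (EC - C) \<in> Fil (k + 2)"
      "(EC - C) * EA \<in> Fil (k + 2)" "C * (EA - A) \<in> Fil (k + 2)"
      using nf.mult[OF EA' EC] nf.mult[OF A EC'] nf.mult[OF EC' EA] nf.mult[OF C EA'] by (simp_all add: add_ac)
    ultimately show "EA * EC - A * C \<in> Fil (k + 2)" "EC * EA - C * A \<in> Fil (k + 2)"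
      using subspace_add[OF sub] by metis+
  qed
  define Q where "Q = EA * EC - EC * EA"
  have Q': "Q - commutator A C \<in> Fil (k + 2)"
  proof -
    have "Q - commutator A C = (EA * EC - A * C) - (EC * EA - C * A)" by (simp add: Q_def commutator_def)
    then show ?thesis using lead subspace_diff[OF sub] by metis
  qed
  have Q: "Q \<in> Fil (Suc k)"
    using nf.leading_mem[of Q "commutator A C" "Suc k"] Q' nf.commutator_mem[OF A C] by simp
  have "Exp a * Exp c = Exp z * (Exp c * Exp a)" using z by (metis Exp_bch)
  then have "(Exp z - 1) * (Exp c * Exp a) = Q"
    by (simp add: Q_def EA_def EC_def algebra_simps)
  then have "(Exp z - 1) * Exp (bch c a) * Exp (- bch c a) = Q * Exp (- bch c a)"
    by (simp add: Exp_bch)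
  then have u: "Exp z - 1 = Q * Exp (- bch c a)" by (simp add: mult.assoc Exp_minus)
  have "Exp z - 1 - Q = Q * (Exp (- bch c a) - 1)" by (simp add: u algebra_simps)
  moreover have "Exp (- bch c a) - 1 \<in> Fil 1"
    unfolding Exp_def by (rule nf.nexp_minus_one_mem[OF rho_mem])
  ultimately have u': "Exp z - 1 - Q \<in> Fil (k + 2)" using nf.mult[OF Q] by fastforce
  then have "Exp z - 1 \<in> Fil (Suc k)" using nf.leading_mem[of "Exp z - 1" Q "Suc k"] Q by simp
  then have "nf.nlog (Exp z - 1) - (Exp z - 1) \<in> Fil (k + 2)"
    using nf.nlog_leading[of "Exp z - 1" "Suc k"] by simp
  then have "rho z - (Exp z - 1) \<in> Fil (k + 2)"
    by (simp add: Exp_def nf.nlog_nexp[OF rho_mem])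
  from subspace_add[OF sub this subspace_add[OF sub u' Q']]
  show ?thesis by (simp add: A_def C_def)
qed

text \<open>Start from \<open>e_2\<close> and keep taking commutators with \<open>e_1\<close>:
  [e_1, e_k] = (k - 1) e_(k+1), with nonzero factor from k = 2 on. Since \<open>e_2\<close> has
  weight 1 but depth 2, weight \<open>k - 1\<close> reaches depth \<open>k\<close>.\<close>

lemma iter_commutator_chain:
  assumes "2 \<le> k" "k \<le> CARD('n::{finite,linorder})"
  shows "\<exists>c :: 'n rvec. iter_commutator (k - 1) c \<and> rho c \<in> Fil k \<and> coord c k \<noteq> 0"
  using assms
proof (induction k rule: dec_induct)
  case base
  then have "2 \<in> range (idx :: 'n \<Rightarrow> nat)" by (auto simp: range_idx)
  then obtain i :: 'n where i: "idx i = 2" by (metis imageE)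
  have coord: "coord (axis i 1) k = (if k = 2 then 1 else 0)" for k
  proof -
    have "coord (axis i 1) k = (\<Sum>j\<in>UNIV. if j = i then (if k = 2 then 1 else 0) else 0)"
      unfolding coord_def by (rule sum.cong) (auto simp: axis_def i)
    then show ?thesis by simp
  qed
  have "iter_commutator (2 - 1) (axis i 1)" using iter_commutator_base[OF lattice.basis, of i] by simp
  moreover have "rho (axis i 1) \<in> Fil 2" by (auto simp: Fil_def entry_rho coord)
  ultimately show ?case using coord[of 2] by (intro exI[of _ "axis i 1"]) simp
next
  case (step k)
  then obtain c :: "'n rvec" where c: "iter_commutator (k - 1) c" "rho c \<in> Fil k" "coord c k \<noteq> 0" by auto
  have "1 \<in> range (idx :: 'n \<Rightarrow> nat)" using step by (auto simp: range_idx)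
  then obtain i :: 'n where i: "idx i = 1" by (metis imageE)
  have "Suc k \<in> range (idx :: 'n \<Rightarrow> nat)" using step by (auto simp: range_idx)
  then obtain j :: 'n where j: "idx j = Suc k" by (metis imageE)
  define a :: "'n rvec" where "a = axis i 1"
  have coa: "coord a k = (if k = 1 then 1 else 0)" for k
  proof -
    have "coord a k = (\<Sum>j\<in>UNIV. if j = i then (if k = 1 then 1 else 0) else 0)"
      unfolding coord_def a_def by (rule sum.cong) (auto simp: axis_def i)
    then show ?thesis by simp
  qed
  have a: "a \<in> lattice" unfolding a_def by (rule lattice.basis)
  define z where "z = bch (bch a c) (bch (- a) (- c))"
  have z: "z \<in> lattice" unfolding z_def
    using a iter_commutator_lattice[OF c(1)] by (intro lattice.intros)
  have "bch (bch (- a) (- c)) (bch c a) = bch (- a) (bch (bch (- c) c) a)"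
    by (simp only: bch_assoc)
  then have comm: "bch a c = bch z (bch c a)"
    by (simp add: z_def bch_assoc)
  have "iter_commutator (1 + (k - 1)) z"
    by (rule iter_commutator_commutator[OF iter_commutator_base[OF a] c(1) z comm])
  then have iter_commutator: "iter_commutator (Suc k - 1) z" using step by simp
  have lead: "rho z - commutator (rho a) (rho c) \<in> Fil (k + 2)"
    by (rule commutator_leading[OF _ c(2) comm]) (use step in auto)
  have Fz: "rho z \<in> Fil (Suc k)"
    using nf.leading_mem[of "rho z" "commutator (rho a) (rho c)" "Suc k"] lead nf.commutator_mem[OF rho_mem c(2), of a] by simp
  have "coord z (Suc k) = entry (rho z) None (Some j)" by (simp add: entry_rho_None flip: j)
  also have "\<dots> = entry (rho (lie a c)) None (Some j)"
    unfolding rho_lie by (rule entry_congruent[OF lead]) (simp add: j)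
  also have "\<dots> = coord (lie a c) (Suc k)" by (simp add: entry_rho_None flip: j)
  also have "\<dots> = (\<Sum>s=1..<Suc k. (real (Suc k - s) - real s) * coord a s * coord c (Suc k - s))"
    by (rule coord_lie) (use step in auto)
  also have "\<dots> = (\<Sum>s\<in>{1}. (real (Suc k - s) - real s) * coord a s * coord c (Suc k - s))"
    using step by (intro sum.mono_neutral_right) (auto simp: coa)
  also have "\<dots> = (real k - 1) * coord c k" by (simp add: coa)
  finally have "coord z (Suc k) \<noteq> 0" using c(3) step by auto
  then show ?case using iter_commutator Fz by blast
qed

text \<open>Nothing lies beyond depth n, so the chain ends on an exact multiple of
  \<open>e_n\<close>, without error terms.\<close>

lemma central_iter_commutator:
  assumes "idx (i :: 'n::{finite,linorder}) = CARD('n)" "CARD('n) \<ge> 2"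
  shows "\<exists>r. r \<noteq> 0 \<and> iter_commutator (CARD('n) - 1) (r *\<^sub>R axis i 1 :: 'n rvec)"
proof -
  obtain c :: "'n rvec" where c: "iter_commutator (CARD('n) - 1) c" "rho c \<in> Fil CARD('n)" "coord c CARD('n) \<noteq> 0"
    using iter_commutator_chain[of "CARD('n)"] assms by auto
  have "c $ j = 0" if "j \<noteq> i" for j
  proof -
    have "idx j \<noteq> CARD('n)" using that assms(1) by (metis idx_eq_iff)
    then have "idx j < CARD('n)" using idx_le[of j] by simp
    then have "entry (rho c) None (Some j) = 0" using c(2) by (auto simp: Fil_def)
    then show ?thesis by (simp add: entry_rho_None)
  qed
  then have "c = (c $ i) *\<^sub>R axis i 1" by (auto simp: vec_eq_iff axis_def)
  moreover have "c $ i \<noteq> 0" using c(3) by (simp flip: assms(1))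
  ultimately show ?thesis using c(1) by metis
qed

subsection \<open>Commuting elements\<close>

lemma lie_self: "lie x x = 0" and lie_antisym: "lie x y = - lie y x"
  by (rule injD[OF inj_rho]; simp add: rho_lie linear_neg[OF linear_rho] linear_0[OF linear_rho] commutator_def)+

text \<open>Only the two one-letter words survive in Dynkin's sum.\<close>

lemma bch_commuting:
  fixes x y :: "('n::{finite,linorder}) rvec"
  assumes "lie x y = 0"
  shows "bch x y = x + y"
proof -
  have 0: "lie v w = 0" if "v \<in> {x, y}" "w \<in> {x, y}" for v w
    using that assms lie_antisym[of y x] by (auto simp: lie_self)
  have lie0: "lie v 0 = 0" for v :: "'n rvec" 
    by (rule injD[OF inj_rho]) (simp add: rho_lie linear_0[OF linear_rho] commutator_def)
  have nested: "set vs \<subseteq> {x, y} \<Longrightarrow> length vs \<ge> 2 \<Longrightarrow> nested_lie vs = 0" for vs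
  proof (induction vs rule: nested_lie.induct)
    case (3 v w vs)
    then show ?case by (cases vs) (auto simp: 0 lie0)
  qed auto
  let ?t = "\<lambda>ps. dynkin_coeff ps *\<^sub>R nested_lie (word x y ps)"
  have zero: "?t ps = 0" if in_words: "ps \<in> dynkin_words CARD('n) - {[(1, 0)], [(0, 1)]}" for ps
  proof -
    have "length (word x y ps) = weight ps" by (induction ps) auto
    moreover have "weight ps \<ge> 2"
    proof -
      have "ps \<noteq> []" using in_words by (auto simp: dynkin_words_def)
      then obtain r s qs where ps: "ps = (r, s) # qs" by (metis list.exhaust surj_pair)
      have rs: "r + s > 0" using in_words by (auto simp: ps dynkin_words_def)
      show ?thesis
      proof (cases qs)
        case Nil
        then have "\<not> (r = 1 \<and> s = 0)" "\<not> (r = 0 \<and> s = 1)" using in_words by (auto simp: ps)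
        then show ?thesis using rs by (auto simp: ps Nil)
      next
        case (Cons q qs')
        then have "fst q + snd q > 0" using in_words by (auto simp: ps dynkin_words_def)
        then show ?thesis using rs by (auto simp: ps Cons split_def)
      qed
    qed
    ultimately show ?thesis using nested[OF set_word] by simp
  qed
  have fin: "finite (dynkin_words CARD('n))" by (rule nf.finite_dynkin_words)
  have "bch x y = (\<Sum>ps\<in>{[(1, 0)], [(0, 1)]}. ?t ps)"
    unfolding bch_def using zero by (intro sum.mono_neutral_right fin) (auto simp: dynkin_words_def Suc_le_eq)
  then show ?thesis by (simp add: dynkin_coeff_def)
qed

subsection \<open>Parallel transport\<close>

text \<open>The entries \<open>\<alpha> p q\<close> of a strictly upper triangular connection matrix, with rows and columns
  indexed by the nodes in \<open>P\<close>.\<close>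

locale invariant_connection =
  fixes P :: "'p set" and level :: "'p \<Rightarrow> nat"
    and \<alpha> :: "'p \<Rightarrow> 'p \<Rightarrow> ('n::{finite,linorder}) rvec \<Rightarrow> 'n rvec \<Rightarrow> real"
  assumes finite: "finite P"
    and lin: "linear (\<alpha> p q x)"
    and upper: "level q \<le> level p \<Longrightarrow> \<alpha> p q x v = 0"
    and invariant: "g \<in> lattice \<Longrightarrow> \<alpha> p q (bch g x) (frechet_derivative (bch g) (at x) v) = \<alpha> p q x v"
begin

lemma level_less: "\<alpha> p q x v \<noteq> 0 \<Longrightarrow> level p < level q"
  using upper[of q p x v] by force

text \<open>Rows with dh = h \<alpha>, demanded only in the columns \<open>R\<close>, because the
  last column need not be solvable.\<close>

definition parallel :: "'p set \<Rightarrow> ('p \<Rightarrow> 'n rvec \<Rightarrow> real) \<Rightarrow> bool"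
  where "parallel R h \<longleftrightarrow> (\<forall>q\<in>R. \<forall>x. (h q has_derivative (\<lambda>v. \<Sum>p\<in>P. h p x * \<alpha> p q x v)) (at x))"

lemma parallel_translate:
  assumes "parallel R h" "g \<in> lattice"
  shows "parallel R (\<lambda>q x. h q (bch g x))"
  unfolding parallel_def
proof (intro ballI allI)
  fix q x assume "q \<in> R"
  then have "(h q has_derivative (\<lambda>v. \<Sum>p\<in>P. h p (bch g x) * \<alpha> p q (bch g x) v)) (at (bch g x))"
    using assms by (auto simp: parallel_def)
  from diff_chain_at[OF has_derivative_bch this]
  show "((\<lambda>x. h q (bch g x)) has_derivative (\<lambda>v. \<Sum>p\<in>P. h p (bch g x) * \<alpha> p q x v)) (at x)"
    by (simp add: o_def invariant assms(2))
qed

lemma parallel_diff: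
  assumes "parallel R h" "parallel R h'"
  shows "parallel R (\<lambda>q x. h q x - h' q x)"
  unfolding parallel_def
proof (intro ballI allI)
  fix q x assume "q \<in> R"
  then have "((\<lambda>x. h q x - h' q x) has_derivative
     (\<lambda>v. (\<Sum>p\<in>P. h p x * \<alpha> p q x v) - (\<Sum>p\<in>P. h' p x * \<alpha> p q x v))) (at x)"
    using assms by (auto simp: parallel_def intro!: has_derivative_diff)
  then show "((\<lambda>x. h q x - h' q x) has_derivative (\<lambda>v. \<Sum>p\<in>P. (h p x - h' p x) * \<alpha> p q x v)) (at x)"
    by (simp add: left_diff_distrib sum_subtractf)
qed

definition vanishes :: "nat \<Rightarrow> ('p \<Rightarrow> 'n rvec \<Rightarrow> real) \<Rightarrow> bool"
  where "vanishes d h \<longleftrightarrow> (\<forall>p\<in>P. level p < d \<longrightarrow> (\<forall>x. h p x = 0))"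

lemma vanishesD: "vanishes d h \<Longrightarrow> p \<in> P \<Longrightarrow> level p < d \<Longrightarrow> h p x = 0"
  by (auto simp: vanishes_def)

text \<open>Translation by \<open>g\<close> minus the identity shifts parallel rows up by the weight
  of \<open>g\<close>. At weight 1, components up to level \<open>d\<close> have zero derivative and
  are constant. For commutators, the operator identity gh - hg = (g - 1)(h - 1) - (h - 1)(g - 1)
  adds up the two shifts.\<close>

lemma iter_commutator_raises_level:
  assumes "iter_commutator k g" "parallel P h" "vanishes d h"
  shows "vanishes (d + k) (\<lambda>p x. h p (bch g x) - h p x)"
  using assms
proof (induction arbitrary: h d rule: iter_commutator.induct)
  case (iter_commutator_base g)
  have "h p (bch g x) = h p x" if "p \<in> P" "level p < d + 1" for p x
  proof -
    have "\<alpha> s p y v = 0 \<or> h s y = 0" if "s \<in> P" for s y v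
      using upper[of p s y v] iter_commutator_base(3) that \<open>level p < d + 1\<close>
      by (cases "level s < d") (auto simp: vanishes_def)
    then have "(\<Sum>s\<in>P. h s y * \<alpha> s p y v) = 0" for y v by (intro sum.neutral) auto
    moreover have "(h p has_derivative (\<lambda>v. \<Sum>s\<in>P. h s y * \<alpha> s p y v)) (at y)" for y
      using iter_commutator_base(2) \<open>p \<in> P\<close> by (auto simp: parallel_def)
    ultimately have "(h p has_derivative (\<lambda>v. 0)) (at y within UNIV)" for y by simp
    then obtain c where "h p y = c" for y
      using has_derivative_zero_constant[of UNIV "h p"] by auto
    then show ?thesis by metis
  qed
  then show ?case by (auto simp: vanishes_def)
next
  case (iter_commutator_commutator i g j g' z)
  define T where "T g h = (\<lambda>p (x :: 'n rvec). h p (bch g x) - h p x)" for g and h :: "'p \<Rightarrow> 'n rvec \<Rightarrow> real"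
  have T_parallel: "parallel P (T g h)" if "iter_commutator i g" "parallel P h" for i g h
    unfolding T_def using parallel_diff[OF parallel_translate[OF that(2) iter_commutator_lattice[OF that(1)]] that(2)] .
  have "vanishes (d + j + i) (T g (T g' h))" "vanishes (d + i + j) (T g' (T g h))"
    unfolding T_def[of g "T g' h"] T_def[of g' "T g h"]
    by (intro iter_commutator_commutator.IH T_parallel[OF iter_commutator_commutator.hyps(1)] T_parallel[OF iter_commutator_commutator.hyps(2)] iter_commutator_commutator.prems
      iter_commutator_commutator.IH[folded T_def])+
  then have eq: "h p (bch g (bch g' x)) = h p (bch g' (bch g x))" if "p \<in> P" "level p < d + (i + j)" for p x
  proof -
    have "T g (T g' h) p x = 0" "T g' (T g h) p x = 0"
      using \<open>vanishes (d + j + i) _\<close> \<open>vanishes (d + i + j) _\<close> that by (auto simp: vanishes_def add_ac)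
    then show ?thesis by (simp add: T_def)
  qed
  have "h p (bch z x) = h p x" if "p \<in> P" "level p < d + (i + j)" for p x
  proof -
    \<comment> \<open>Chosen so that x = g' g y; then z x = z g' g y = g g' y.\<close>
    define y where "y = bch (- g) (bch (- g') x)"
    have x: "bch g' (bch g y) = x" unfolding y_def by (simp flip: bch_assoc)
    have "bch z x = bch g (bch g' y)"
      unfolding x[symmetric] using iter_commutator_commutator.hyps(4) by (metis bch_assoc)
    then show ?thesis using eq[OF that, of y] x by simp
  qed
  then show ?case by (auto simp: vanishes_def)
qed

end

section \<open>Tori spanned by commuting lattice elements\<close>

lemma frechet_bch_translation:
  assumes "\<And>r. bch g (x + r *\<^sub>R v) = y + r *\<^sub>R v"
  shows "frechet_derivative (bch g) (at x) v = v"
proof -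
  have "((\<lambda>r. x + r *\<^sub>R v) has_derivative (\<lambda>r. r *\<^sub>R v)) (at (0::real))"
    by (auto intro!: derivative_eq_intros)
  moreover have "(bch g has_derivative frechet_derivative (bch g) (at x)) (at (x + 0 *\<^sub>R v))"
    using has_derivative_bch[of g x] by simp
  ultimately have "((\<lambda>r. bch g (x + r *\<^sub>R v)) has_derivative (\<lambda>r. frechet_derivative (bch g) (at x) (r *\<^sub>R v))) (at (0::real))"
    using diff_chain_at by (force simp: o_def)
  then have "((\<lambda>r. y + r *\<^sub>R v) has_derivative (\<lambda>r. frechet_derivative (bch g) (at x) (r *\<^sub>R v))) (at (0::real))"
    by (simp only: assms)
  moreover have "((\<lambda>r. y + r *\<^sub>R v) has_derivative (\<lambda>r. r *\<^sub>R v)) (at (0::real))"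
    by (auto intro!: derivative_eq_intros)
  ultimately have "(\<lambda>r::real. frechet_derivative (bch g) (at x) (r *\<^sub>R v)) = (\<lambda>r. r *\<^sub>R v)"
    by (rule has_derivative_unique)
  from fun_cong[OF this, of 1] show ?thesis by simp
qed

text \<open>Two commuting lattice elements span a torus in the nilmanifold.\<close>

locale torus =
  fixes a b :: "('n::{finite,linorder}) rvec"
  assumes a: "a \<in> lattice" and b: "b \<in> lattice" and commute: "lie a b = 0"
begin

lemma bch_plane: "bch (p *\<^sub>R a + q *\<^sub>R b) (s *\<^sub>R a + t *\<^sub>R b) = (p + s) *\<^sub>R a + (q + t) *\<^sub>R b"
proof -
  have ab: "rho a * rho b = rho b * rho a"
    using rho_lie[of a b] commute by (simp add: commutator_def linear_0[OF linear_rho])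
  have "lie (p *\<^sub>R a + q *\<^sub>R b) (s *\<^sub>R a + t *\<^sub>R b) = 0"
    by (rule injD[OF inj_rho])
       (simp add: rho_lie commutator_def linear_0[OF linear_rho] linear_add[OF linear_rho] linear_scale[OF linear_rho] algebra_simps ab)
  then show ?thesis by (simp add: bch_commuting algebra_simps)
qed

lemma translate_a: "bch a (s *\<^sub>R a + t *\<^sub>R b) = (1 + s) *\<^sub>R a + t *\<^sub>R b"
  and translate_b: "bch b (s *\<^sub>R a + t *\<^sub>R b) = s *\<^sub>R a + (1 + t) *\<^sub>R b"
  using bch_plane[of 1 0] bch_plane[of 0 1] by simp_all

lemma frechet_translate_a: "frechet_derivative (bch a) (at (s *\<^sub>R a + t *\<^sub>R b)) b = b"
proof (rule frechet_bch_translation)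
  show "bch a ((s *\<^sub>R a + t *\<^sub>R b) + r *\<^sub>R b) = ((1 + s) *\<^sub>R a + t *\<^sub>R b) + r *\<^sub>R b" for r
    using translate_a[of s "t + r"] by (simp add: algebra_simps)
qed

lemma frechet_translate_b: "frechet_derivative (bch b) (at (s *\<^sub>R a + t *\<^sub>R b)) a = a"
proof (rule frechet_bch_translation)
  show "bch b ((s *\<^sub>R a + t *\<^sub>R b) + r *\<^sub>R a) = (s *\<^sub>R a + (1 + t) *\<^sub>R b) + r *\<^sub>R a" for r
    using translate_b[of "s + r" t] by (simp add: algebra_simps)
qed

text \<open>Stokes: lattice invariance identifies the opposite sides of the parallelogram.\<close>

lemma null_ext_d:
  assumes "\<beta> \<in> forms"
  shows "null_integral a b (\<lambda>x. ext_d \<beta> x [a, b])"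
  unfolding ext_d_two
proof (rule null_exact)
  show "C1 (\<lambda>x. \<beta> x [v])" for v
    using assms by (intro C_1_smooth) (auto simp: forms_def)
  have inv: "g \<in> lattice \<Longrightarrow> \<beta> (bch g x) [frechet_derivative (bch g) (at x) v] = \<beta> x [v]" for g x v
  proof -
    have "g \<in> lattice \<Longrightarrow> \<beta> (bch g x) (map (frechet_derivative (bch g) (at x)) [v]) = \<beta> x [v]"
      using assms unfolding forms_def by blast
    then show "g \<in> lattice \<Longrightarrow> \<beta> (bch g x) [frechet_derivative (bch g) (at x) v] = \<beta> x [v]" by simp
  qed
  show "\<beta> (s *\<^sub>R a + b) [a] = \<beta> (s *\<^sub>R a) [a]" for s
    using inv[OF b, of "s *\<^sub>R a + 0 *\<^sub>R b" a] unfolding translate_b frechet_translate_b by simp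
  have "\<beta> (a + t *\<^sub>R b) [b] = \<beta> (t *\<^sub>R b) [b]" for t
    using inv[OF a, of "0 *\<^sub>R a + t *\<^sub>R b" b] unfolding translate_a frechet_translate_a by simp
  then show "integral {0..1} (\<lambda>t. \<beta> (a + t *\<^sub>R b) [b] - \<beta> (t *\<^sub>R b) [b]) = 0" by simp
qed

end

text \<open>A connection which is flat except for the entry with row \<open>start\<close> and column \<open>stop\<close>.
  Its curvature in that entry is minus the sum in \<open>corner\<close> below.\<close>

locale flat_connection = invariant_connection P level \<alpha>
  for P :: "'p set" and level :: "'p \<Rightarrow> nat"
    and \<alpha> :: "'p \<Rightarrow> 'p \<Rightarrow> ('n::{finite,linorder}) rvec \<Rightarrow> 'n rvec \<Rightarrow> real" +
  fixes start stop :: 'p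
  assumes start: "start \<in> P" "level start = 0" and stop: "stop \<in> P"
    and between: "p \<in> P \<Longrightarrow> p \<noteq> start \<Longrightarrow> p \<noteq> stop \<Longrightarrow> 0 < level p \<and> level p < level stop"
    and stop_pos: "level stop > 0"
    and smooth: "C1 (\<lambda>x. \<alpha> p q x v)"
    and flat: "p \<in> P \<Longrightarrow> q \<in> P \<Longrightarrow> (p, q) \<noteq> (start, stop) \<Longrightarrow>
      frechet_derivative (\<lambda>y. \<alpha> p q y v) (at x) u - frechet_derivative (\<lambda>y. \<alpha> p q y u) (at x) v =
      - (\<Sum>s\<in>P. \<alpha> p s x u * \<alpha> s q x v - \<alpha> p s x v * \<alpha> s q x u)"
begin

lemma start_neq_stop: "start \<noteq> stop"
  using start stop_pos by auto

lemma level_le: "p \<in> P \<Longrightarrow> level p \<le> level stop"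
  using between[of p] start by (cases "p = start"; cases "p = stop") auto

lemma parallel_C1:
  assumes "parallel {q} h" "\<And>p. p \<in> P \<Longrightarrow> level p < level q \<Longrightarrow> continuous_on UNIV (h p)"
  shows "C1 (h q)"
proof -
  have d: "(h q has_derivative (\<lambda>v. \<Sum>p\<in>P. h p x * \<alpha> p q x v)) (at x)" for x
    using assms(1) by (auto simp: parallel_def)
  have "continuous_on UNIV (\<lambda>x. h p x * \<alpha> p q x v)" if "p \<in> P" for p v
  proof (cases "level p < level q")
    case True
    then show ?thesis using assms(2)[OF that] C_1_continuous[OF smooth] by (intro continuous_on_mult)
  next
    case False
    then show ?thesis by (simp add: upper)
  qed
  then have "continuous_on UNIV (\<lambda>x. \<Sum>p\<in>P. h p x * \<alpha> p q x v)" for v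
    by (rule continuous_on_sum)
  then show ?thesis
    unfolding C_1_iff frechet_derivative_eq[OF d] using d by (auto simp: differentiable_def)
qed

text \<open>The first double sum comes from differentiating \<open>h\<close>, the second from
  flatness of \<alpha>. They cancel as soon as \<open>s\<close> can be restricted to
  \<open>R\<close> in both.\<close>

lemma curvature:
  assumes R: "R \<subseteq> P" and par: "parallel R h" and q: "q \<in> P" "q = stop \<Longrightarrow> start \<notin> R"
  shows "frechet_derivative (\<lambda>y. \<Sum>p\<in>R. h p y * \<alpha> p q y v) (at x) u -
      frechet_derivative (\<lambda>y. \<Sum>p\<in>R. h p y * \<alpha> p q y u) (at x) v =
    (\<Sum>p\<in>R. \<Sum>s\<in>P. h s x * (\<alpha> s p x u * \<alpha> p q x v - \<alpha> s p x v * \<alpha> p q x u)) -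
    (\<Sum>p\<in>R. \<Sum>s\<in>P. h p x * (\<alpha> p s x u * \<alpha> s q x v - \<alpha> p s x v * \<alpha> s q x u))"
proof -
  have d: "p \<in> R \<Longrightarrow> (h p has_derivative (\<lambda>v. \<Sum>s\<in>P. h s x * \<alpha> s p x v)) (at x)" for p
    using par by (auto simp: parallel_def)
  have diff: "p \<in> R \<Longrightarrow> h p differentiable at x" for p using d by (auto simp: differentiable_def)
  have D: "frechet_derivative (\<lambda>y. \<Sum>p\<in>R. h p y * \<alpha> p q y v) (at x) u =
    (\<Sum>p\<in>R. h p x * frechet_derivative (\<lambda>y. \<alpha> p q y v) (at x) u + (\<Sum>s\<in>P. h s x * \<alpha> s p x u) * \<alpha> p q x v)" for u v
    by (simp add: frechet_sum frechet_mult diff C_1_differentiable[OF smooth] differentiable_mult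
        frechet_derivative_eq[OF d] cong: sum.cong)
  have "frechet_derivative (\<lambda>y. \<Sum>p\<in>R. h p y * \<alpha> p q y v) (at x) u -
      frechet_derivative (\<lambda>y. \<Sum>p\<in>R. h p y * \<alpha> p q y u) (at x) v =
    (\<Sum>p\<in>R. h p x * (frechet_derivative (\<lambda>y. \<alpha> p q y v) (at x) u - frechet_derivative (\<lambda>y. \<alpha> p q y u) (at x) v) +
      ((\<Sum>s\<in>P. h s x * \<alpha> s p x u) * \<alpha> p q x v - (\<Sum>s\<in>P. h s x * \<alpha> s p x v) * \<alpha> p q x u))"
    unfolding D by (simp add: algebra_simps flip: sum_subtractf)
  also have "\<dots> = (\<Sum>p\<in>R. (\<Sum>s\<in>P. h s x * (\<alpha> s p x u * \<alpha> p q x v - \<alpha> s p x v * \<alpha> p q x u)) -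
     (\<Sum>s\<in>P. h p x * (\<alpha> p s x u * \<alpha> s q x v - \<alpha> p s x v * \<alpha> s q x u)))"
  proof (rule sum.cong[OF refl])
    fix p assume "p \<in> R"
    then have "p \<in> P" "(p, q) \<noteq> (start, stop)" using R q(2) by auto
    from flat[OF this(1) q(1) this(2)]
    show "h p x * (frechet_derivative (\<lambda>y. \<alpha> p q y v) (at x) u - frechet_derivative (\<lambda>y. \<alpha> p q y u) (at x) v) +
      ((\<Sum>s\<in>P. h s x * \<alpha> s p x u) * \<alpha> p q x v - (\<Sum>s\<in>P. h s x * \<alpha> s p x v) * \<alpha> p q x u) =
      (\<Sum>s\<in>P. h s x * (\<alpha> s p x u * \<alpha> p q x v - \<alpha> s p x v * \<alpha> p q x u)) -
      (\<Sum>s\<in>P. h p x * (\<alpha> p s x u * \<alpha> s q x v - \<alpha> p s x v * \<alpha> s q x u))"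
      by (simp add: sum_distrib_left sum_distrib_right right_diff_distrib sum_subtractf mult.assoc)
  qed
  also have "\<dots> = (\<Sum>p\<in>R. \<Sum>s\<in>P. h s x * (\<alpha> s p x u * \<alpha> p q x v - \<alpha> s p x v * \<alpha> p q x u)) -
    (\<Sum>p\<in>R. \<Sum>s\<in>P. h p x * (\<alpha> p s x u * \<alpha> s q x v - \<alpha> p s x v * \<alpha> s q x u))"
    by (rule sum_subtractf)
  finally show ?thesis .
qed

text \<open>The right side of the equation for column \<open>q\<close> is closed, so it has a
  primitive. In the last column the corner entry, exempt from flatness, would interfere; it is
  multiplied by \<open>h start = 0\<close>.\<close>

lemma parallel_extend:
  assumes par: "parallel {p \<in> P. level p < level q} h" and q: "q \<in> P" "q = stop \<Longrightarrow> (\<forall>x. h start x = 0)"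
    and cont: "\<And>p. p \<in> P \<Longrightarrow> level p < level q \<Longrightarrow> C1 (h p)"
  shows "\<exists>f. \<forall>x. (f has_derivative (\<lambda>v. \<Sum>p\<in>P. h p x * \<alpha> p q x v)) (at x)"
proof -
  define R where "R = {p \<in> P. level p < level q \<and> (q = stop \<longrightarrow> p \<noteq> start)}"
  have R: "R \<subseteq> P" "finite R" using finite by (auto simp: R_def)
  have sum_R: "(\<Sum>p\<in>P. h p x * \<alpha> p q x v) = (\<Sum>p\<in>R. h p x * \<alpha> p q x v)" for x v
    using q(2) by (intro sum.mono_neutral_right) (auto simp: R_def finite dest: level_less)
  have "C1 (\<lambda>x. \<Sum>p\<in>R. h p x * \<alpha> p q x v)" for v
    by (intro C_1_sum C_1_mult smooth cont) (auto simp: R_def)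
  moreover have "linear (\<lambda>v. \<Sum>p\<in>R. h p x * \<alpha> p q x v)" for x
    using linear_compose_scale_right[OF lin] by (intro linear_compose_sum) (auto simp: real_scaleR_def)
  moreover have "frechet_derivative (\<lambda>y. \<Sum>p\<in>R. h p y * \<alpha> p q y v) (at x) u =
      frechet_derivative (\<lambda>y. \<Sum>p\<in>R. h p y * \<alpha> p q y u) (at x) v" for x u v
  proof -
    have "parallel R h" using par by (auto simp: parallel_def R_def)
    from curvature[OF R(1) this q(1)] have "frechet_derivative (\<lambda>y. \<Sum>p\<in>R. h p y * \<alpha> p q y v) (at x) u -
        frechet_derivative (\<lambda>y. \<Sum>p\<in>R. h p y * \<alpha> p q y u) (at x) v =
      (\<Sum>p\<in>R. \<Sum>s\<in>P. h s x * (\<alpha> s p x u * \<alpha> p q x v - \<alpha> s p x v * \<alpha> p q x u)) -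
      (\<Sum>p\<in>R. \<Sum>s\<in>P. h p x * (\<alpha> p s x u * \<alpha> s q x v - \<alpha> p s x v * \<alpha> s q x u))" (is "_ = ?A - ?B")
      by (auto simp: R_def)
    also have "?A = (\<Sum>p\<in>R. \<Sum>s\<in>R. h s x * (\<alpha> s p x u * \<alpha> p q x v - \<alpha> s p x v * \<alpha> p q x u))"
    proof (intro sum.cong[OF refl] sum.mono_neutral_right[OF finite R(1)] ballI)
      fix p s assume p: "p \<in> R" and s: "s \<in> P - R"
      then have "(q = stop \<and> s = start) \<or> level p \<le> level s" unfolding R_def by auto
      then consider "q = stop" "s = start" | "level p \<le> level s" by blast
      then show "h s x * (\<alpha> s p x u * \<alpha> p q x v - \<alpha> s p x v * \<alpha> p q x u) = 0"
        using q(2) by cases (auto simp: upper)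
    qed
    \<comment> \<open>Outside \<open>R\<close> nothing is lost: no entry leads into
      \<open>start\<close>, and none leads to \<open>q\<close> from a level at or above its
      own.\<close>
    also have "?B = (\<Sum>p\<in>R. \<Sum>s\<in>R. h p x * (\<alpha> p s x u * \<alpha> s q x v - \<alpha> p s x v * \<alpha> s q x u))"
    proof (intro sum.cong[OF refl] sum.mono_neutral_right[OF finite R(1)] ballI)
      fix p s assume p: "p \<in> R" and s: "s \<in> P - R"
      then have "s = start \<or> level q \<le> level s" unfolding R_def by auto
      then consider "s = start" | "level q \<le> level s" by blast
      then show "h p x * (\<alpha> p s x u * \<alpha> s q x v - \<alpha> p s x v * \<alpha> s q x u) = 0"
        using start by cases (auto simp: upper)
    qed
    also have "\<dots> = (\<Sum>p\<in>R. \<Sum>s\<in>R. h s x * (\<alpha> s p x u * \<alpha> p q x v - \<alpha> s p x v * \<alpha> p q x u))"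
      by (rule sum.swap)
    finally show ?thesis by simp
  qed
  ultimately obtain f where "(f has_derivative (\<lambda>v. \<Sum>p\<in>R. h p x * \<alpha> p q x v)) (at x)" for x
    using poincare_lemma[of "\<lambda>x v. \<Sum>p\<in>R. h p x * \<alpha> p q x v"] by blast
  then show ?thesis by (auto simp: sum_R)
qed

text \<open>Parallel transport is built level by level, as each column involves only components of
  lower level.\<close>

lemma parallel_exists:
  "\<exists>h. h start = (\<lambda>x. 1) \<and> parallel {q \<in> P. level q < d \<and> q \<noteq> stop} h \<and> (\<forall>q\<in>P. q \<noteq> stop \<longrightarrow> level q < d \<longrightarrow> C1 (h q))"
proof (induction d)
  case 0
  then show ?case by (intro exI[of _ "\<lambda>_ _. 1"]) (auto simp: parallel_def)
next
  case (Suc d)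
  then obtain h where h: "h start = (\<lambda>x. 1)" "parallel {q \<in> P. level q < d \<and> q \<noteq> stop} h"
    "\<And>q. q \<in> P \<Longrightarrow> q \<noteq> stop \<Longrightarrow> level q < d \<Longrightarrow> C1 (h q)" by blast
  have low: "p \<noteq> stop" if "p \<in> P" "level p < level q" "q \<in> P" "q \<noteq> stop" for p q
    using that between[of q] start stop_pos by force
  define prim where "prim q f \<longleftrightarrow> (\<forall>x. (f has_derivative (\<lambda>v. \<Sum>p\<in>P. h p x * \<alpha> p q x v)) (at x))" for q f
  have "\<exists>f. prim q f"
    if "q \<in> P" "q \<noteq> stop" "level q = d" for q
    unfolding prim_def
  proof (rule parallel_extend)
    show "parallel {p \<in> P. level p < level q} h"
      using h(2) low[OF _ _ that(1,2)] that(3) by (auto simp: parallel_def)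
    show "C1 (h p)" if "p \<in> P" "level p < level q" for p
      using h(3)[OF that(1)] low[OF that \<open>q \<in> P\<close> \<open>q \<noteq> stop\<close>] that(2) \<open>level q = d\<close> by simp
  qed (use that in auto)
  then obtain f where "\<And>q. q \<in> P \<Longrightarrow> q \<noteq> stop \<Longrightarrow> level q = d \<Longrightarrow> prim q (f q)" by metis
  then have f: "(f q has_derivative (\<lambda>v. \<Sum>p\<in>P. h p x * \<alpha> p q x v)) (at x)"
    if "q \<in> P" "q \<noteq> stop" "level q = d" for q x
    using that by (auto simp: prim_def)
  \<comment> \<open>New components of level \<open>d\<close> do not affect columns up to level
    \<open>d\<close>; \<open>start\<close> is exempted to keep the value 1.\<close>
  define h' where "h' q = (if q \<in> P \<and> q \<noteq> stop \<and> q \<noteq> start \<and> level q = d then f q else h q)" for q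
  have same: "(\<Sum>p\<in>P. h' p x * \<alpha> p q x v) = (\<Sum>p\<in>P. h p x * \<alpha> p q x v)" if "level q \<le> d" for q x v
    using that by (intro sum.cong) (auto simp: h'_def upper)
  have par: "parallel {q \<in> P. level q < Suc d \<and> q \<noteq> stop} h'"
    unfolding parallel_def
  proof (intro ballI allI)
    fix q x assume "q \<in> {q \<in> P. level q < Suc d \<and> q \<noteq> stop}"
    then have q: "q \<in> P" "level q \<le> d" "q \<noteq> stop" by auto
    show "(h' q has_derivative (\<lambda>v. \<Sum>p\<in>P. h' p x * \<alpha> p q x v)) (at x)"
      unfolding same[OF q(2)]
    proof (cases "q = start")
      case True
      then show "(h' q has_derivative (\<lambda>v. \<Sum>p\<in>P. h p x * \<alpha> p q x v)) (at x)"
        using start by (simp add: h'_def h(1) upper)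
    next
      case False
      then show "(h' q has_derivative (\<lambda>v. \<Sum>p\<in>P. h p x * \<alpha> p q x v)) (at x)"
        using q f h(2) by (cases "level q = d") (auto simp: h'_def parallel_def)
    qed
  qed
  have C1_old: "C1 (h' q)" if "q \<in> P" "q \<noteq> stop" "level q < d" for q
    using h(3)[OF that] that by (simp add: h'_def)
  have "C1 (h' q)" if "q \<in> P" "q \<noteq> stop" "level q < Suc d" for q
  proof (rule parallel_C1)
    show "parallel {q} h'" using par that by (auto simp: parallel_def)
    fix p assume "p \<in> P" "level p < level q"
    then show "continuous_on UNIV (h' p)"
      using that low[of p q] by (intro C_1_continuous C1_old) auto
  qed
  moreover have "h' start = (\<lambda>x. 1)" by (simp add: h'_def h(1))
  ultimately show ?case using par by blast
qed

definition corner :: "'n rvec \<Rightarrow> 'n rvec \<Rightarrow> 'n rvec \<Rightarrow> real"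
  where "corner u v x = (\<Sum>s\<in>P. \<alpha> start s x u * \<alpha> s stop x v - \<alpha> start s x v * \<alpha> s stop x u)"

text \<open>Let \<open>F\<close> be the first row of the parallel transport; \<open>\<theta> = \<Sum>\<^sub>p F\<^sub>p \<alpha>\<^sub>p\<^sub>,\<^sub>s\<^sub>t\<^sub>o\<^sub>p\<close> is
  a primitive of \<open>corner\<close> on the universal cover. The monodromy along \<open>b\<close> is trivial because
  \<open>b\<close> is a long commutator, so opposite sides parallel to \<open>a\<close> cancel. The other two sides differ
  by the period along \<open>b\<close> of a primitive \<open>G\<^sub>s\<^sub>t\<^sub>o\<^sub>p\<close>, which vanishes for the same reason.\<close>

lemma null_corner:
  assumes "torus a b" and iter_commutator: "iter_commutator k b" "level stop \<le> k"
  shows "null_integral a b (corner a b)"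
proof -
  interpret torus a b by fact
  define Q where "Q = P - {stop}"
  define R where "R = P - {start, stop}"
  have R: "R \<subseteq> P" "finite R" using finite by (auto simp: R_def)
  obtain F where F: "F start = (\<lambda>x. 1)" "parallel {q \<in> P. level q < level stop \<and> q \<noteq> stop} F"
    "\<And>q. q \<in> P \<Longrightarrow> q \<noteq> stop \<Longrightarrow> level q < level stop \<Longrightarrow> C1 (F q)"
    using parallel_exists[of "level stop"] by blast
  have lower: "level p < level stop" if "p \<in> Q" for p
    using that between[of p] start stop_pos by (cases "p = start") (auto simp: Q_def)
  have FQ: "parallel Q F" using F(2) lower by (auto simp: parallel_def Q_def)
  have FC: "C1 (F p)" if "p \<in> Q" for p using F(3) lower that by (auto simp: Q_def)
  have sumQ: "(\<Sum>p\<in>P. h p * \<alpha> p q x v) = (\<Sum>p\<in>Q. h p * \<alpha> p q x v)" if "q \<in> P" for h q x v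
    using that level_le[OF that] by (intro sum.mono_neutral_right) (auto simp: Q_def finite upper)
  interpret Q: invariant_connection Q level \<alpha>
    by (rule invariant_connection.intro) (simp_all add: Q_def finite lin upper invariant)
  have Q_parallel: "Q.parallel Q h \<longleftrightarrow> parallel Q h" for h
    unfolding Q.parallel_def parallel_def by (intro ball_cong refl) (auto simp: Q_def sumQ[unfolded Q_def])
  \<comment> \<open>With \<open>d = 0\<close>, weight \<open>k\<close> covers the levels below
    \<open>k\<close>, hence all of \<open>Q\<close>.\<close>
  have F_b: "F p (bch b x) = F p x" if "p \<in> Q" for p x
    using Q.iter_commutator_raises_level[OF iter_commutator(1), of F 0] FQ that lower[OF that] iter_commutator(2)
    by (auto simp: Q_parallel Q.vanishes_def)
  define G where "G p x = F p (bch a x) - F p x" for p x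
  have G_start: "G start x = 0" for x by (simp add: G_def F(1))
  have GQ: "parallel Q G"
    unfolding G_def by (rule parallel_diff[OF parallel_translate[OF FQ a] FQ])
  have GC: "C1 (G p)" if "p \<in> Q" for p
    using that
  proof (induction "level p" arbitrary: p rule: less_induct)
    case less
    show ?case
    proof (rule parallel_C1)
      show "parallel {p} G" using GQ less.prems by (auto simp: parallel_def)
      fix s assume "s \<in> P" "level s < level p"
      then show "continuous_on UNIV (G s)"
        using less.hyps[of s] lower[OF less.prems] by (cases "s = stop") (auto simp: Q_def intro: C_1_continuous)
    qed
  qed
  \<comment> \<open>The last column, perhaps unsolvable for \<open>F\<close>, is solvable for
    \<open>G\<close> because \<open>G start\<close> is 0.\<close>
  obtain g where g: "\<And>x. (g has_derivative (\<lambda>v. \<Sum>p\<in>P. G p x * \<alpha> p stop x v)) (at x)"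
    using parallel_extend[of stop G] GQ GC G_start stop by (auto simp: parallel_def Q_def)
  define G' where "G' = G(stop := g)"
  have "parallel P G'"
    unfolding parallel_def
  proof (intro ballI allI)
    fix q x assume q: "q \<in> P"
    have "(\<Sum>p\<in>P. G' p x * \<alpha> p q x v) = (\<Sum>p\<in>P. G p x * \<alpha> p q x v)" for v
      unfolding sumQ[OF q] by (rule sum.cong) (auto simp: G'_def Q_def)
    then show "(G' q has_derivative (\<lambda>v. \<Sum>p\<in>P. G' p x * \<alpha> p q x v)) (at x)"
      using g GQ q by (auto simp: G'_def parallel_def Q_def)
  qed
  \<comment> \<open>Vanishing at level 0 gains one level: weight \<open>k\<close> now covers level
    \<open>k\<close> too, hence \<open>stop\<close>. Here the bound
    \<open>level stop \<le> k\<close> is used in full.\<close>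
  moreover have "vanishes 1 G'"
  proof -
    have "G' p x = 0" if "p \<in> P" "level p < 1" for p x
      using between[OF that(1)] that(2) G_start stop_pos start_neq_stop
      by (cases "p = start"; cases "p = stop") (auto simp: G'_def)
    then show ?thesis by (auto simp: vanishes_def)
  qed
  ultimately have "vanishes (1 + k) (\<lambda>p x. G' p (bch b x) - G' p x)"
    by (rule iter_commutator_raises_level[OF iter_commutator(1)])
  from vanishesD[OF this stop] have g_b: "g (bch b x) = g x" for x
    using iter_commutator(2) by (simp add: G'_def)
  \<comment> \<open>\<open>start\<close> is left out, since its term would be the corner
    entry.\<close>
  define \<theta> where "\<theta> x v = (\<Sum>p\<in>R. F p x * \<alpha> p stop x v)" for x v
  have "null_integral a b (\<lambda>x. frechet_derivative (\<lambda>y. \<theta> y b) (at x) a - frechet_derivative (\<lambda>y. \<theta> y a) (at x) b)"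
  proof (rule null_exact)
    show "C1 (\<lambda>x. \<theta> x v)" for v
      unfolding \<theta>_def by (intro C_1_sum C_1_mult smooth FC) (auto simp: R_def Q_def)
    show "\<theta> (s *\<^sub>R a + b) a = \<theta> (s *\<^sub>R a) a" for s
    proof -
      have x: "bch b (s *\<^sub>R a) = s *\<^sub>R a + b" using translate_b[of s 0] by simp
      have "\<alpha> p stop (s *\<^sub>R a + b) a = \<alpha> p stop (s *\<^sub>R a) a" for p
        using invariant[OF b, of p stop "s *\<^sub>R a + 0 *\<^sub>R b" a] unfolding frechet_translate_b by (simp add: x)
      moreover have "F p (s *\<^sub>R a + b) = F p (s *\<^sub>R a)" if "p \<in> R" for p
        using F_b[of p "s *\<^sub>R a"] that by (simp add: x R_def Q_def)
      ultimately show ?thesis by (simp add: \<theta>_def)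
    qed
    \<comment> \<open>This difference is the derivative of \<open>g\<close> along \<open>b\<close>,
      so its integral is the period of \<open>g\<close>.\<close>
    have "\<theta> (a + t *\<^sub>R b) b - \<theta> (t *\<^sub>R b) b = (\<Sum>p\<in>P. G p (0 + t *\<^sub>R b) * \<alpha> p stop (0 + t *\<^sub>R b) b)" for t
    proof -
      have x: "bch a (t *\<^sub>R b) = a + t *\<^sub>R b" using translate_a[of 0 t] by simp
      have "\<alpha> p stop (a + t *\<^sub>R b) b = \<alpha> p stop (t *\<^sub>R b) b" for p
        using invariant[OF a, of p stop "0 *\<^sub>R a + t *\<^sub>R b" b] unfolding frechet_translate_a by (simp add: x)
      moreover have "F p (a + t *\<^sub>R b) = F p (bch a (t *\<^sub>R b))" for p by (simp add: x)
      ultimately have "\<theta> (a + t *\<^sub>R b) b - \<theta> (t *\<^sub>R b) b = (\<Sum>p\<in>R. G p (t *\<^sub>R b) * \<alpha> p stop (t *\<^sub>R b) b)"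
        by (simp add: \<theta>_def G_def left_diff_distrib sum_subtractf)
      also have "\<dots> = (\<Sum>p\<in>P. G p (t *\<^sub>R b) * \<alpha> p stop (t *\<^sub>R b) b)"
        by (intro sum.mono_neutral_left finite R(1)) (auto simp: R_def G_start upper)
      finally show ?thesis by simp
    qed
    then have "integral {0..1} (\<lambda>t. \<theta> (a + t *\<^sub>R b) b - \<theta> (t *\<^sub>R b) b) = g (0 + b) - g 0"
      by (simp only: ftc_line[OF g])
    also have "\<dots> = 0" using g_b[of 0] by simp
    finally show "integral {0..1} (\<lambda>t. \<theta> (a + t *\<^sub>R b) b - \<theta> (t *\<^sub>R b) b) = 0" .
  qed
  \<comment> \<open>The only node outside \<open>R\<close> leading into \<open>R\<close> is
    \<open>start\<close>, where \<open>F\<close> is 1; its terms form \<open>corner\<close> and all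
    others cancel.\<close>
  moreover have "frechet_derivative (\<lambda>y. \<theta> y b) (at x) a - frechet_derivative (\<lambda>y. \<theta> y a) (at x) b = corner a b x" for x
  proof -
    have "parallel R F" using FQ by (auto simp: parallel_def R_def Q_def)
    from curvature[OF R(1) this stop]
    have "frechet_derivative (\<lambda>y. \<theta> y b) (at x) a - frechet_derivative (\<lambda>y. \<theta> y a) (at x) b =
      (\<Sum>p\<in>R. \<Sum>s\<in>P. F s x * (\<alpha> s p x a * \<alpha> p stop x b - \<alpha> s p x b * \<alpha> p stop x a)) -
      (\<Sum>p\<in>R. \<Sum>s\<in>P. F p x * (\<alpha> p s x a * \<alpha> s stop x b - \<alpha> p s x b * \<alpha> s stop x a))" (is "_ = ?A - ?B")
      unfolding \<theta>_def by (auto simp: R_def)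
    also have "?A = (\<Sum>p\<in>R. \<Sum>s\<in>insert start R. F s x * (\<alpha> s p x a * \<alpha> p stop x b - \<alpha> s p x b * \<alpha> p stop x a))"
    proof (intro sum.cong[OF refl] sum.mono_neutral_right[OF finite])
      fix p assume "p \<in> R"
      then have "level p < level stop" using between by (auto simp: R_def)
      then show "\<forall>s\<in>P - insert start R. F s x * (\<alpha> s p x a * \<alpha> p stop x b - \<alpha> s p x b * \<alpha> p stop x a) = 0"
        by (auto simp: R_def upper)
    qed (use start R in auto)
    also have "\<dots> = (\<Sum>p\<in>R. \<alpha> start p x a * \<alpha> p stop x b - \<alpha> start p x b * \<alpha> p stop x a) +
       (\<Sum>p\<in>R. \<Sum>s\<in>R. F s x * (\<alpha> s p x a * \<alpha> p stop x b - \<alpha> s p x b * \<alpha> p stop x a))"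
      using R(2) by (subst sum.insert) (auto simp: R_def F(1) sum.distrib)
    also have "(\<Sum>p\<in>R. \<Sum>s\<in>R. F s x * (\<alpha> s p x a * \<alpha> p stop x b - \<alpha> s p x b * \<alpha> p stop x a)) =
        (\<Sum>p\<in>R. \<Sum>s\<in>R. F p x * (\<alpha> p s x a * \<alpha> s stop x b - \<alpha> p s x b * \<alpha> s stop x a))"
      by (rule sum.swap)
    also have "\<dots> = ?B"
      by (intro sum.cong[OF refl] sum.mono_neutral_left[OF finite R(1)]) (auto simp: R_def upper start)
    also have "(\<Sum>p\<in>R. \<alpha> start p x a * \<alpha> p stop x b - \<alpha> start p x b * \<alpha> p stop x a) = corner a b x"
      unfolding corner_def
      by (intro sum.mono_neutral_left[OF finite R(1)]) (auto simp: R_def upper start)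
    finally show ?thesis by simp
  qed
  ultimately show ?thesis by simp
qed

end

subsection \<open>Short Massey products vanish on the torus\<close>

lemma zero_form: "(\<lambda>x vs. 0) \<in> forms"
proof -
  have "smooth (\<lambda>x. 0)"
    by (rule smooth_polynomial) (rule real_polynomial_function.intros)
  then show ?thesis by (auto simp: forms_def linear_zero)
qed

lemma cohom_class_refl: "a \<in> cohom_class a" for a :: "('n::{finite,linorder}) form"
proof -
  have "ext_d (\<lambda>x vs. 0 :: real) = (\<lambda>(x :: 'n rvec) vs. 0)"
    by (simp add: ext_d_def fun_eq_iff)
  then show ?thesis
    unfolding cohom_class_def using zero_form by (intro CollectI exI[of _ "\<lambda>x vs. 0"]) simp
qed

lemma cohom_classD:
  assumes "cohom_class a = cohom_class b"
  obtains c where "c \<in> forms" "\<And>x vs. a x vs = b x vs + ext_d c x vs"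
proof -
  have "a \<in> cohom_class b" using cohom_class_refl[of a] assms by simp
  then show ?thesis using that by (auto simp: cohom_class_def)
qed

section \<open>The flat connection of a defining system\<close>

locale massey_system =
  fixes l :: nat and V :: "nat \<Rightarrow> ('n::{finite,linorder}) form set gmatrix"
    and X :: "nat \<Rightarrow> 'n form gmatrix" and A :: "nat \<Rightarrow> nat \<Rightarrow> 'n form gmatrix" and p q :: nat
  assumes args: "massey_arguments l V"
    and rep: "i \<in> {1..l} \<Longrightarrow> represents (X i) (V i)"
    and sys: "defining_system l X A"
    and p: "p < nrows (X 1)" and q: "q < ncols (X l)"
begin

lemma l: "l \<ge> 2" using args by (simp add: massey_arguments_def)

lemma V_props:
  assumes "1 \<le> i" "i \<le> l"
  shows "nrows (X i) = nrows (V i)" "ncols (X i) = ncols (V i)" "N_I (X i)" "N_H_plus (V i)"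
    "s < nrows (X i) \<Longrightarrow> t < ncols (X i) \<Longrightarrow> dg (X i) s t = dg (V i) s t"
  using rep[of i] args assms unfolding represents_def massey_arguments_def by simp_all

lemma dims:
  "1 \<le> i \<Longrightarrow> i \<le> l \<Longrightarrow> 0 < ncols (X i)"
  "1 \<le> i \<Longrightarrow> i \<le> l \<Longrightarrow> 0 < nrows (X i)"
  "1 \<le> i \<Longrightarrow> i < l \<Longrightarrow> ncols (X i) = nrows (X (i + 1))"
proof -
  show "1 \<le> i \<Longrightarrow> i \<le> l \<Longrightarrow> 0 < ncols (X i)" "1 \<le> i \<Longrightarrow> i \<le> l \<Longrightarrow> 0 < nrows (X i)"
    using V_props(3)[of i] unfolding N_I_def matrix_of_def by blast+
  assume i: "1 \<le> i" "i < l"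
  then have "ncols (V i) = nrows (V (i + 1))"
    using args by (simp add: massey_arguments_def multipliable_def)
  then show "ncols (X i) = nrows (X (i + 1))"
    using V_props(2)[of i] V_props(1)[of "i + 1"] i by simp
qed

lemma dg_pos:
  assumes "1 \<le> i" "i \<le> l" "s < nrows (X i)" "t < ncols (X i)"
  shows "dg (X i) s t \<ge> 1"
proof -
  have "s < nrows (V i)" "t < ncols (V i)" using assms V_props(1,2)[of i] by simp_all
  then have "ent (V i) s t \<in> (if dg (V i) s t > 0 then cohom (dg (V i) s t) else {})"
    using V_props(4)[OF assms(1,2)] unfolding N_H_plus_def matrix_of_def by blast
  then have "dg (V i) s t > 0" by (metis empty_iff)
  then show ?thesis using V_props(5)[OF assms] by simp
qed

text \<open>The arguments have positive degree, so lowering each degree by one leaves sums at least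
  0; every entry of a defining system thus has degree at least 1.\<close>

lemma deg_chain_nonneg:
  "1 \<le> i \<Longrightarrow> i + k \<le> l \<Longrightarrow> s < nrows (X i) \<Longrightarrow> t < ncols (X (i + k)) \<Longrightarrow> deg_chain X i k s t \<ge> 0"
proof (induction k arbitrary: t)
  case 0
  then show ?case using dg_pos[of i s t] by simp
next
  case (Suc k)
  have "0 \<le> deg_chain X i k s 0"
    by (rule Suc.IH) (use Suc.prems dims(1)[of "i + k"] in auto)
  moreover have "1 \<le> dg (X (i + k + 1)) 0 t"
    by (rule dg_pos) (use Suc.prems dims(2)[of "i + k + 1"] in auto)
  ultimately show ?case by simp
qed

lemma entry_props:
  assumes ij: "1 \<le> i" "i \<le> j" "j \<le> l" "(i, j) \<noteq> (1, l)" and st: "s < nrows (X i)" "t < ncols (X j)"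
  shows "ent (A i j) s t \<in> forms" "ent (A i j) s t x [] = 0" "nrows (A i j) = nrows (X i)" "ncols (A i j) = ncols (X j)"
    "ext_d (ent (A i j) s t) = (\<lambda>x vs. \<Sum>r=i..<j. bar_mult (A i r) (A (r + 1) j) s t x vs)"
proof -
  have c: "1 \<le> i \<and> i \<le> j \<and> j \<le> l \<and> (i, j) \<noteq> (1, l)" using ij by blast
  note * = sys[unfolded defining_system_def, THEN spec[of _ i], THEN spec[of _ j], THEN mp, OF c]
  have D: "N_I (A i j)" "nrows (A i j) = nrows (X i)" "ncols (A i j) = ncols (X j)"
    by (use * in blast)+
  then have "s < nrows (A i j)" "t < ncols (A i j)" using st by simp_all
  with * have D': "dg (A i j) s t = deg_chain X i (j - i) s t + 1"
    "ext_d (ent (A i j) s t) = (\<lambda>x vs. \<Sum>r=i..<j. bar_mult (A i r) (A (r + 1) j) s t x vs)"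
    by blast+
  show "nrows (A i j) = nrows (X i)" "ncols (A i j) = ncols (X j)"
    "ext_d (ent (A i j) s t) = (\<lambda>x vs. \<Sum>r=i..<j. bar_mult (A i r) (A (r + 1) j) s t x vs)"
    by (fact D D')+
  have "ent (A i j) s t \<in> forms_deg (dg (A i j) s t)"
    using D(1-3) st by (auto simp: N_I_def matrix_of_def)
  moreover have "dg (A i j) s t \<noteq> 0"
    using deg_chain_nonneg[of i "j - i" s t] ij st D'(1) by simp
  ultimately show "ent (A i j) s t \<in> forms" "ent (A i j) s t x [] = 0"
    by (auto simp: forms_deg_def)
qed

text \<open>The node \<open>(r, s)\<close> stands for column \<open>s\<close> of \<open>X\<^sub>r\<close>, which is row \<open>s\<close> of
  \<open>X\<^sub>r\<^sub>+\<^sub>1\<close>; only row \<open>p\<close> of \<open>X\<^sub>1\<close> and column \<open>q\<close> of \<open>X\<^sub>l\<close> matter. Entries of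
  degree other than 1 do not contribute to the degree 2 component of the cocycle, because no
  entry has degree 0.\<close>

definition nodes :: "(nat \<times> nat) set"
  where "nodes = insert (0, p) (insert (l, q) (SIGMA r:{1..<l}. {..<ncols (X r)}))"

text \<open>Row indices are shifted by one: between nodes (r, s) and (r', s') stands entry (s, s')
  of \<open>A (r + 1) r'\<close>. The corner, for which a defining system has no matrix, is set to
  0.\<close>

definition conn_entry :: "nat \<times> nat \<Rightarrow> nat \<times> nat \<Rightarrow> 'n rvec \<Rightarrow> 'n rvec \<Rightarrow> real"
  where "conn_entry m n x v =
    (if m \<in> nodes \<and> n \<in> nodes \<and> fst m < fst n \<and> (m, n) \<noteq> ((0, p), (l, q))
     then ent (A (fst m + 1) (fst n)) (snd m) (snd n) x [v] else 0)"

lemma conn_entry_upper: "fst n \<le> fst m \<Longrightarrow> conn_entry m n x v = 0"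
  by (simp add: conn_entry_def)

lemma finite_nodes: "finite nodes"
  by (auto simp: nodes_def)

lemma node_index:
  assumes "m \<in> nodes" "n \<in> nodes" "fst m < fst n"
  shows "fst m + 1 \<le> fst n" "fst n \<le> l" "snd m < nrows (X (fst m + 1))" "snd n < ncols (X (fst n))"
    "(m, n) \<noteq> ((0, p), (l, q)) \<Longrightarrow> (fst m + 1, fst n) \<noteq> (1, l)"
proof -
  have n: "fst n \<le> l" "n = (l, q) \<or> (1 \<le> fst n \<and> fst n < l \<and> snd n < ncols (X (fst n)))"
    using assms(2,3) by (auto simp: nodes_def)
  have m: "m = (0, p) \<or> (1 \<le> fst m \<and> fst m < l \<and> snd m < ncols (X (fst m)))"
    using assms(1,3) n(1) by (auto simp: nodes_def)
  show "fst m + 1 \<le> fst n" "fst n \<le> l" using assms(3) n by auto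
  show "snd m < nrows (X (fst m + 1))" using m p dims(3)[of "fst m"] by auto
  show "snd n < ncols (X (fst n))" using n(2) q by auto
  show "(m, n) \<noteq> ((0, p), (l, q)) \<Longrightarrow> (fst m + 1, fst n) \<noteq> (1, l)"
    using m n(2) by auto
qed

lemma conn_entry_form:
  obtains "\<And>x v. conn_entry m n x v = 0"
  | a where "a \<in> forms" "\<And>x v. conn_entry m n x v = a x [v]"
proof (cases "m \<in> nodes \<and> n \<in> nodes \<and> fst m < fst n \<and> (m, n) \<noteq> ((0, p), (l, q))")
  case True
  then have "ent (A (fst m + 1) (fst n)) (snd m) (snd n) \<in> forms"
    using node_index[of m n] by (intro entry_props(1)) auto
  then show ?thesis using True that(2) by (simp add: conn_entry_def)
next
  case False
  then show ?thesis using that(1) by (auto simp: conn_entry_def)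
qed

text \<open>The minus sign is that of \<open>bar\<close> on 1-forms, and nodes not strictly between
  \<open>m\<close> and \<open>n\<close> contribute 0. For the corner pair the left side is the
  Massey cocycle.\<close>

lemma bar_mult_sum:
  assumes "m \<in> nodes" "n \<in> nodes" "fst m < fst n"
  shows "(\<Sum>r=fst m + 1..<fst n. bar_mult (A (fst m + 1) r) (A (r + 1) (fst n)) (snd m) (snd n) x [u, v]) =
    - (\<Sum>s\<in>nodes. conn_entry m s x u * conn_entry s n x v - conn_entry m s x v * conn_entry s n x u)"
proof -
  note ix = node_index[OF assms]
  let ?f = "\<lambda>s. conn_entry m s x u * conn_entry s n x v - conn_entry m s x v * conn_entry s n x u"
  let ?S = "SIGMA r:{fst m + 1..<fst n}. {..<ncols (X r)}"
  have S: "?S \<subseteq> nodes" using ix(2) by (auto simp: nodes_def)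
  have bar: "bar_mult (A (fst m + 1) r) (A (r + 1) (fst n)) (snd m) (snd n) x [u, v] =
      (\<Sum>w<ncols (X r). - ?f (r, w))" if r: "r \<in> {fst m + 1..<fst n}" for r
  proof -
    have "ncols (A (fst m + 1) r) = ncols (X r)"
      using r ix(2,3) dims(1)[of r] by (intro entry_props(4)[where s="snd m" and t=0]) auto
    moreover have "(bar (ent (A (fst m + 1) r) (snd m) w) \<and>\<^sub>w ent (A (r + 1) (fst n)) w (snd n)) x [u, v] = - ?f (r, w)"
      if w: "w < ncols (X r)" for w
    proof -
      have rw: "(r, w) \<in> nodes" using S r w by auto
      have "ent (A (fst m + 1) r) (snd m) w x [] = 0"
        using r ix(2,3) w by (intro entry_props(2)) auto
      moreover have "ent (A (r + 1) (fst n)) w (snd n) x [] = 0"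
        using r ix(2,4) w dims(3)[of r] by (intro entry_props(2)) auto
      moreover have "conn_entry m (r, w) x v = ent (A (fst m + 1) r) (snd m) w x [v]" for v
        using assms(1) rw r ix(2) by (auto simp: conn_entry_def)
      moreover have "conn_entry (r, w) n x v = ent (A (r + 1) (fst n)) w (snd n) x [v]" for v
        using assms(2) rw r by (auto simp: conn_entry_def)
      ultimately show ?thesis by (simp add: wedge_two bar_def)
    qed
    ultimately show ?thesis by (simp add: bar_mult_def)
  qed
  have "(\<Sum>r=fst m + 1..<fst n. bar_mult (A (fst m + 1) r) (A (r + 1) (fst n)) (snd m) (snd n) x [u, v]) =
      (\<Sum>r=fst m + 1..<fst n. \<Sum>w<ncols (X r). - ?f (r, w))"
    by (rule sum.cong[OF refl bar])
  also have "\<dots> = (\<Sum>s\<in>?S. - ?f s)"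
    by (subst sum.Sigma) (auto simp: case_prod_unfold)
  also have "\<dots> = (\<Sum>s\<in>nodes. - ?f s)"
  proof (rule sum.mono_neutral_left[OF finite_nodes S], rule ballI)
    fix s assume s: "s \<in> nodes - ?S"
    have "\<not> (fst m < fst s \<and> fst s < fst n)"
    proof
      assume "fst m < fst s \<and> fst s < fst n"
      moreover obtain r w where rw: "s = (r, w)" by (cases s)
      ultimately have r: "fst m < r" "r < fst n" by simp_all
      then have "r \<noteq> 0" "r \<noteq> l" using ix(2) by auto
      then have "w < ncols (X r)" using s by (simp add: rw nodes_def)
      then show False using s r by (simp add: rw)
    qed
    then consider "fst s \<le> fst m" | "fst n \<le> fst s" by linarith
    then show "- ?f s = 0" by cases (simp_all add: conn_entry_upper)
  qed
  finally show ?thesis by (simp only: sum_negf)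
qed

lemma flat_connection_conn_entry: "flat_connection nodes fst conn_entry (0, p) (l, q)"
proof
  fix m n :: "nat \<times> nat" and x v u g :: "'n rvec"
  have "linear (conn_entry m n x)"
  proof (cases rule: conn_entry_form[of m n])
    case 1
    then have "conn_entry m n x = (\<lambda>v. 0)" by auto
    then show ?thesis by (simp add: linear_zero)
  next
    case (2 a)
    then have "linear (\<lambda>v. a x ([] @ v # []))" unfolding forms_def by blast
    moreover have "conn_entry m n x = (\<lambda>v. a x ([] @ v # []))" using 2 by auto
    ultimately show ?thesis by simp
  qed
  then show "conn_entry m n x (b1 + b2) = conn_entry m n x b1 + conn_entry m n x b2" 
    "conn_entry m n x (r *\<^sub>R b1) = r *\<^sub>R conn_entry m n x b1" for b1 b2 r
    by (auto simp: linear_add linear_scale)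
  show "conn_entry m n (bch g x) (frechet_derivative (bch g) (at x) v) = conn_entry m n x v" if "g \<in> lattice"
  proof (cases rule: conn_entry_form[of m n])
    case (2 a)
    then have "a (bch g x) (map (frechet_derivative (bch g) (at x)) [v]) = a x [v]"
      using that unfolding forms_def by blast
    then show ?thesis using 2 by simp
  qed simp
  show "C1 (\<lambda>x. conn_entry m n x v)"
  proof (cases rule: conn_entry_form[of m n])
    case 1
    then show ?thesis by (simp add: C_1_const)
  next
    case (2 a)
    then have "smooth (\<lambda>x. a x [v])" unfolding forms_def by blast
    then show ?thesis using 2 by (simp add: C_1_smooth)
  qed
  show "frechet_derivative (\<lambda>y. conn_entry m n y v) (at x) u - frechet_derivative (\<lambda>y. conn_entry m n y u) (at x) v =
      - (\<Sum>s\<in>nodes. conn_entry m s x u * conn_entry s n x v - conn_entry m s x v * conn_entry s n x u)"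
    if mn: "m \<in> nodes" "n \<in> nodes" "(m, n) \<noteq> ((0, p), (l, q))"
  proof (cases "fst m < fst n")
    case True
    note ix = node_index[OF mn(1,2) True]
    have "ext_d (ent (A (fst m + 1) (fst n)) (snd m) (snd n)) =
        (\<lambda>x vs. \<Sum>r=fst m + 1..<fst n. bar_mult (A (fst m + 1) r) (A (r + 1) (fst n)) (snd m) (snd n) x vs)"
      using ix mn(3) by (intro entry_props(5)) auto
    then have "ext_d (ent (A (fst m + 1) (fst n)) (snd m) (snd n)) x [u, v] =
      - (\<Sum>s\<in>nodes. conn_entry m s x u * conn_entry s n x v - conn_entry m s x v * conn_entry s n x u)"
      by (simp only: bar_mult_sum[OF mn(1,2) True])
    moreover have "conn_entry m n y w = ent (A (fst m + 1) (fst n)) (snd m) (snd n) y [w]" for y w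
      using mn True by (simp add: conn_entry_def)
    ultimately show ?thesis by (simp only: ext_d_two)
  next
    case False
    then have "conn_entry m n y w = 0" for y w by (simp add: conn_entry_upper)
    moreover have "conn_entry m s x w * conn_entry s n x w' = 0" for s w w'
    proof -
      have "fst s \<le> fst m \<or> fst n \<le> fst s" using False by linarith
      then show ?thesis by (elim disjE) (simp_all add: conn_entry_upper)
    qed
    ultimately show ?thesis by (simp only: frechet_derivative_const sum.neutral_const diff_self minus_zero)
  qed
  show "0 < fst m \<and> fst m < fst (l, q)" if "m \<in> nodes" "m \<noteq> (0, p)" "m \<noteq> (l, q)"
  proof -
    have "m \<in> (SIGMA r:{1..<l}. {..<ncols (X r)})" using that by (simp add: nodes_def)
    then show ?thesis by auto
  qed
  show "finite nodes" by (rule finite_nodes)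
  show "conn_entry m n x v = 0" if "fst n \<le> fst m" using that by (rule conn_entry_upper)
  show "(0, p) \<in> nodes" "(l, q) \<in> nodes" by (simp_all add: nodes_def)
  show "fst (0 :: nat, p) = 0" "0 < fst (l, q)" using l by simp_all
qed

sublocale flat_connection nodes fst conn_entry "(0, p)" "(l, q)"
  by (rule flat_connection_conn_entry)

lemma null_massey_cocycle:
  assumes "torus a b" "iter_commutator k b" "l \<le> k"
  shows "null_integral a b (\<lambda>x. ent (massey_cocycle l X A) p q x [a, b])"
proof -
  have "(\<Sum>r=1..<l. bar_mult (A 1 r) (A (r + 1) l) p q x [a, b]) = - corner a b x" for x
    using bar_mult_sum[OF start(1) stop, of x a b] l by (simp add: corner_def)
  then have eq: "(\<lambda>x. ent (massey_cocycle l X A) p q x [a, b]) = (\<lambda>x. 0 + (- 1) * corner a b x)"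
    by (simp add: massey_cocycle_def)
  show ?thesis
    unfolding eq by (rule null_lincomb[OF null_zero null_corner[OF assms(1,2)]]) (use assms(3) in simp)
qed

end

text \<open>Another representative of the class differs by an exact form, whose integral is
  zero.\<close>

lemma null_massey_entry:
  assumes "torus a b" "iter_commutator k b" "l \<le> k"
    and "cohom_class \<beta> \<in> massey_entries l"
  shows "null_integral a b (\<lambda>x. \<beta> x [a, b])"
proof -
  obtain V C p q where V: "massey_arguments l V" "C \<in> massey l V" "p < nrows C" "q < ncols C"
    "cohom_class \<beta> = ent C p q"
    using assms(4) unfolding massey_entries_def by blast
  then obtain X A where X: "C = class_matrix (massey_cocycle l X A)"
    "\<And>i. i \<in> {1..l} \<Longrightarrow> represents (X i) (V i)" "defining_system l X A"
    unfolding massey_def by blast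
  interpret massey_system l V X A p q
    using V X by unfold_locales (auto simp: class_matrix_def massey_cocycle_def)
  have "cohom_class \<beta> = cohom_class (ent (massey_cocycle l X A) p q)"
    using V(5) X(1) by (simp add: class_matrix_def)
  then obtain c where c: "c \<in> forms" "\<And>x vs. \<beta> x vs = ent (massey_cocycle l X A) p q x vs + ext_d c x vs"
    by (rule cohom_classD) (rule that)
  show ?thesis
    using null_lincomb[OF null_massey_cocycle[OF assms(1-3)] torus.null_ext_d[OF assms(1) c(1)], of 1]
    by (simp add: c(2))
qed

text \<open>On the plane the group law is addition, so the coframe has constant coefficients along
  the torus.\<close>

lemma mc_form_plane:
  assumes "torus a b"
  shows "mc_form (s *\<^sub>R a + t *\<^sub>R b) a = a" "mc_form (s *\<^sub>R a + t *\<^sub>R b) b = b"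
proof -
  interpret torus a b by fact
  let ?x = "s *\<^sub>R a + t *\<^sub>R b"
  have "bch (- ?x) (?x + r *\<^sub>R a) = 0 + r *\<^sub>R a" "bch (- ?x) (?x + r *\<^sub>R b) = 0 + r *\<^sub>R b" for r
    using bch_plane[of "- s" "- t" "s + r" t] bch_plane[of "- s" "- t" s "t + r"]
    by (simp_all add: algebra_simps)
  then show "mc_form ?x a = a" "mc_form ?x b = b"
    unfolding mc_form_def by (intro frechet_bch_translation; blast)+
qed

theorem proposition8:
  fixes m :: nat
  assumes "m \<ge> 1"
    and "CARD('n::{finite,linorder}) = 2 * m"
  shows "(\<exists>V. massey_arguments (2 * m) V \<and>
            (\<exists>C\<in>massey (2 * m) V. nrows C = 1 \<and> ncols C = 1 \<and> dg C 0 0 = 2 \<and>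
               ent C 0 0 = cohom_class (Omega m :: 'n form)))
       \<and> cohom_class (Omega m :: 'n form) \<notin> cohom_span (\<Union>l\<in>{2..<2 * m}. massey_entries l)"
proof (rule conjI[OF Omega_massey[OF assms]], rule notI)
  have "1 \<in> range (idx :: 'n \<Rightarrow> nat)" "2 * m \<in> range (idx :: 'n \<Rightarrow> nat)"
    using assms by (auto simp: range_idx)
  then obtain i j :: 'n where i: "idx i = 1" and j: "idx j = 2 * m" by (metis imageE)
  obtain r where r: "r \<noteq> 0" "iter_commutator (2 * m - 1) (r *\<^sub>R axis j 1 :: 'n rvec)"
    using central_iter_commutator[of j] assms j by auto
  \<comment> \<open>These directions pick out the term of \<open>Omega\<close> with indices 1 and
    2m.\<close>
  define a b :: "'n rvec" where "a = axis i 1" and "b = r *\<^sub>R axis j 1"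
  have coa: "coord a k = (if k = 1 then 1 else 0)" and cob: "coord b k = (if k = 2 * m then r else 0)" for k
  proof -
    have "coord a k = (\<Sum>l\<in>UNIV. if l = i then (if k = 1 then 1 else 0) else 0)"
      unfolding coord_def a_def by (rule sum.cong) (auto simp: axis_def i)
    then show "coord a k = (if k = 1 then 1 else 0)" by simp
    have "coord b k = (\<Sum>l\<in>UNIV. if l = j then (if k = 2 * m then r else 0) else 0)"
      unfolding coord_def b_def by (rule sum.cong) (auto simp: axis_def j)
    then show "coord b k = (if k = 2 * m then r else 0)" by simp
  qed
  \<comment> \<open>The bracket of \<open>e_1\<close> and \<open>e_(2m)\<close> would have index 2m
    + 1, beyond the truncation.\<close>
  have "lie a b $ k = 0" for k
  proof -
    have k: "idx k \<le> 2 * m" using idx_le[of k] assms(2) by simp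
    then have "lie a b $ k = (\<Sum>s=1..<idx k. (real (idx k - s) - real s) * coord a s * coord b (idx k - s))"
      using coord_lie[of "idx k" a b] assms(2) by simp
    also have "\<dots> = 0" by (rule sum.neutral) (use k in \<open>auto simp: coa cob\<close>)
    finally show ?thesis .
  qed
  then have torus: "torus a b"
    using iter_commutator_lattice[OF r(2)] by unfold_locales (auto simp: a_def b_def vec_eq_iff intro: lattice.basis)
  assume "cohom_class (Omega m :: 'n form) \<in> cohom_span (\<Union>l\<in>{2..<2 * m}. massey_entries l)"
  then obtain T c where T: "finite T" "cohom_class ` T \<subseteq> (\<Union>l\<in>{2..<2 * m}. massey_entries l)"
    "cohom_class (Omega m :: 'n form) = cohom_class (\<lambda>x vs. \<Sum>\<beta>\<in>T. c \<beta> * \<beta> x vs)"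
    unfolding cohom_span_def by blast
  from T(3) obtain \<gamma> where \<gamma>: "\<gamma> \<in> forms" "\<And>x vs. (Omega m :: 'n form) x vs = (\<Sum>\<beta>\<in>T. c \<beta> * \<beta> x vs) + ext_d \<gamma> x vs"
    by (rule cohom_classD) (rule that)
  have "null_integral a b (\<lambda>x. \<beta> x [a, b])" if "\<beta> \<in> T" for \<beta>
  proof -
    obtain l where "l \<in> {2..<2 * m}" "cohom_class \<beta> \<in> massey_entries l" using T(2) \<open>\<beta> \<in> T\<close> by blast
    \<comment> \<open>Lengths \<open>l < 2 * m\<close> are exactly those up to the weight 2m - 1 of
      \<open>b\<close>.\<close>
    then show ?thesis
      by (intro null_massey_entry[OF torus r(2)[folded b_def]]) auto
  qed
  then have "null_integral a b (\<lambda>x. (\<Sum>\<beta>\<in>T. c \<beta> * \<beta> x [a, b]) + 1 * ext_d \<gamma> x [a, b])"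
    by (rule null_lincomb[OF null_sum torus.null_ext_d[OF torus \<gamma>(1)]])
  then have "null_integral a b (\<lambda>x. Omega m x [a, b])"
    by (simp only: \<gamma>(2) mult_1)
  then have "para_integral a b (\<lambda>x. Omega m x [a, b]) = 0" by (simp add: null_integral_def)
  \<comment> \<open>The constant 2m - 1 is the coefficient of that term, and \<open>r\<close> comes
    from \<open>b\<close>.\<close>
  moreover have "Omega m (s *\<^sub>R a + t *\<^sub>R b) [a, b] = (2 * m - 1) * r" for s t
  proof -
    have "Omega m (s *\<^sub>R a + t *\<^sub>R b) [a, b] =
        (\<Sum>s=1..<2*m+1. (real (2*m+1 - s) - real s) * coord a s * coord b (2*m+1 - s))"
      unfolding Omega_eq(1)[OF assms(2)] mc_form_plane[OF torus] ..
    also have "\<dots> = (\<Sum>s\<in>{1}. (real (2*m+1 - s) - real s) * coord a s * coord b (2*m+1 - s))"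
      using assms(1) by (intro sum.mono_neutral_right) (auto simp: coa)
    finally show ?thesis using assms(1) by (simp add: coa cob of_nat_diff)
  qed
  ultimately have "(2 * m - 1) * r = 0" by (simp add: para_integral_def)
  then show False using r(1) assms(1) by auto
qed

end
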